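(* Let $m\ge 1$ be an integer, let $\mathcal{H}$ be a Hilbert space and let $T\in\mathcal{B}(\mathcal{H})$ be a $B_m$-contraction. Then there exist a Hilbert space $\mathcal{E}$ and a partially isometric multiplier $\theta\in\mathcal{M}(A^2_1(\mathcal{E}),A^2_m(\mathcal{D}_{m,T}))$ such that $$T\cong P_{\mathcal{Q}_\theta}M_z|_{\mathcal{Q}_\theta},\qquad\text{where}\qquad \mathcal{Q}_\theta=A^2_m(\mathcal{D}_{m,T})\ominus\theta A^2_1(\mathcal{E}).$$
   Context: $\mathbb{D}$ is the open unit disc in $\mathbb{C}$; $\mathcal{B}(\mathcal{H})$ is the space of bounded linear operators on $\mathcal{H}$; $P_{\mathcal{S}}$ is the orthogonal projection onto a closed subspace $\mathcal{S}$; $\cong$ between operators denotes unitary equivalence. For an integer $m\ge1$, $A^2_m$ is the weighted Bergman space on $\mathbb{D}$, i.e. the reproducing kernel Hilbert space with kernel $B_m(z,w)=(1-z\bar w)^{-m}$. For a Hilbert space $\mathcal{E}$, $A^2_m(\mathcal{E})\cong A^2_m\otimes\mathcal{E}$ is the reproducing kernel Hilbert space of $\mathcal{E}$-valued holomorphic functions on $\mathbb{D}$ with kernel $B_m(z,w)I_{\mathcal{E}}$; in particular $A^2_1(\mathcal{E})=H^2(\mathcal{E})$ is the $\mathcal{E}$-valued Hardy space. $M_z$ is the operator $(M_zf)(w)=wf(w)$. $T\in\mathcal{B}(\mathcal{H})$ is a $B_m$-contraction if $T$ is of class $C_{\cdot0}$ (i.e. $T^{*l}\to0$ in the strong operator topology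 as $l\to\infty$) and $$B_m^{-1}(z,w)(T,T^* ):=\sum_{k=0}^m(-1)^k\binom mk T^kT^{*k}\ge0.$$ Its defect operator is $D_{m,T}=\big(B_m^{-1}(z,w)(T,T^* )\big)^{1/2}$ and its defect space is $\mathcal{D}_{m,T}=\overline{\operatorname{ran}}\,D_{m,T}$. A multiplier from $A^2_{m_1}(\mathcal{E}_1)$ to $A^2_{m_2}(\mathcal{E}_2)$ is a holomorphic map $\Theta:\mathbb{D}\to\mathcal{B}(\mathcal{E}_1,\mathcal{E}_2)$ with $\Theta f\in A^2_{m_2}(\mathcal{E}_2)$ for all $f\in A^2_{m_1}(\mathcal{E}_1)$; $\mathcal{M}(A^2_{m_1}(\mathcal{E}_1),A^2_{m_2}(\mathcal{E}_2))$ is the set of all such multipliers, and $M_\Theta f=\Theta f$. A multiplier $\Theta$ is partially isometric if $M_\Theta$ is a partial isometry. *)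

theory Defs
  imports "HOL-Analysis.Analysis" "HOL-Library.Function_Algebras"
begin

class complex_vector = ab_group_add +
  fixes scaleC :: "complex \<Rightarrow> 'a \<Rightarrow> 'a"  (infixr \<open>*\<^sub>C\<close> 75)
  assumes scaleC_add_right: "c *\<^sub>C (x + y) = c *\<^sub>C x + c *\<^sub>C y"
    and scaleC_add_left: "(c + d) *\<^sub>C x = c *\<^sub>C x + d *\<^sub>C x"
    and scaleC_scaleC: "c *\<^sub>C (d *\<^sub>C x) = (c * d) *\<^sub>C x"
    and scaleC_one: "1 *\<^sub>C x = x"

instantiation "fun" :: (type, complex_vector) complex_vector
begin

definition scaleC_fun :: "complex \<Rightarrow> ('a \<Rightarrow> 'b) \<Rightarrow> 'a \<Rightarrow> 'b"
  where "scaleC_fun c f = (\<lambda>x. c *\<^sub>C f x)"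

instance
  by standard
    (auto simp: scaleC_fun_def fun_eq_iff scaleC_add_right scaleC_add_left scaleC_scaleC scaleC_one)

end

text \<open>
  A Hilbert space is a set of vectors of an ambient complex vector space (closed under its linear
  operations) with an inner product, linear in the first argument, of which only the values on that
  set matter. Carrier sets are needed because defect spaces, spaces of vector-valued functions and
  existentially quantified Hilbert spaces are not types. In the same way, an operator is an HOL
  function of which only the values on the carrier of its domain matter.
\<close>

record 'a hspace =
  hcarrier :: "'a set"
  hinner :: "'a \<Rightarrow> 'a \<Rightarrow> complex"

definition hnorm :: "'a hspace \<Rightarrow> 'a \<Rightarrow> real"
  where "hnorm H x = sqrt (Re (hinner H x x))"

locale hilbert_space =
  fixes H :: "'a::complex_vector hspace"
  assumes zero_closed: "0 \<in> hcarrier H"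
    and add_closed: "\<lbrakk>x \<in> hcarrier H; y \<in> hcarrier H\<rbrakk> \<Longrightarrow> x + y \<in> hcarrier H"
    and scaleC_closed: "x \<in> hcarrier H \<Longrightarrow> c *\<^sub>C x \<in> hcarrier H"
    and inner_add_left: "\<lbrakk>x \<in> hcarrier H; y \<in> hcarrier H; z \<in> hcarrier H\<rbrakk>
      \<Longrightarrow> hinner H (x + y) z = hinner H x z + hinner H y z"
    and inner_scaleC_left: "\<lbrakk>x \<in> hcarrier H; y \<in> hcarrier H\<rbrakk>
      \<Longrightarrow> hinner H (c *\<^sub>C x) y = c * hinner H x y"
    and inner_commute: "\<lbrakk>x \<in> hcarrier H; y \<in> hcarrier H\<rbrakk> \<Longrightarrow> hinner H x y = cnj (hinner H y x)"
    and inner_nonneg: "x \<in> hcarrier H \<Longrightarrow> Re (hinner H x x) \<ge> 0"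
    and inner_definite: "\<lbrakk>x \<in> hcarrier H; hinner H x x = 0\<rbrakk> \<Longrightarrow> x = 0"
    and complete:
      "\<lbrakk>range X \<subseteq> hcarrier H; \<forall>e>0. \<exists>N. \<forall>i\<ge>N. \<forall>j\<ge>N. hnorm H (X i - X j) < e\<rbrakk>
      \<Longrightarrow> \<exists>x\<in>hcarrier H. (\<lambda>i. hnorm H (X i - x)) \<longlonglongrightarrow> 0"

definition subspace_of :: "'a hspace \<Rightarrow> 'a set \<Rightarrow> 'a hspace"
  where "subspace_of H S = H\<lparr>hcarrier := S\<rparr>"

definition hclosure :: "'a::complex_vector hspace \<Rightarrow> 'a set \<Rightarrow> 'a set"
  where "hclosure H S = {x \<in> hcarrier H. \<forall>e>0. \<exists>y\<in>S. hnorm H (x - y) < e}"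

definition ominus :: "'a hspace \<Rightarrow> 'a set \<Rightarrow> 'a set"
  where "ominus H S = {x \<in> hcarrier H. \<forall>y\<in>S. hinner H x y = 0}"

definition proj :: "'a::complex_vector hspace \<Rightarrow> 'a set \<Rightarrow> 'a \<Rightarrow> 'a"
  where "proj H S x = (THE y. y \<in> S \<and> (\<forall>u\<in>S. hinner H (x - y) u = 0))"

definition bounded_op ::
    "'a::complex_vector hspace \<Rightarrow> 'b::complex_vector hspace \<Rightarrow> ('a \<Rightarrow> 'b) \<Rightarrow> bool"
  where "bounded_op H K A \<longleftrightarrow>
    A ` hcarrier H \<subseteq> hcarrier K \<and>
    (\<forall>x\<in>hcarrier H. \<forall>y\<in>hcarrier H. A (x + y) = A x + A y) \<and>
    (\<forall>c. \<forall>x\<in>hcarrier H. A (c *\<^sub>C x) = c *\<^sub>C A x) \<and>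
    (\<exists>C. \<forall>x\<in>hcarrier H. hnorm K (A x) \<le> C * hnorm H x)"

definition opnorm :: "'a hspace \<Rightarrow> 'b hspace \<Rightarrow> ('a \<Rightarrow> 'b) \<Rightarrow> real"
  where "opnorm H K A = Inf {C. C \<ge> 0 \<and> (\<forall>x\<in>hcarrier H. hnorm K (A x) \<le> C * hnorm H x)}"

definition adj :: "'a hspace \<Rightarrow> 'b hspace \<Rightarrow> ('a \<Rightarrow> 'b) \<Rightarrow> 'b \<Rightarrow> 'a"
  where "adj H K A y =
    (THE x. x \<in> hcarrier H \<and> (\<forall>u\<in>hcarrier H. hinner K (A u) y = hinner H u x))"

definition positive_op :: "'a::complex_vector hspace \<Rightarrow> ('a \<Rightarrow> 'a) \<Rightarrow> bool"
  where "positive_op H A \<longleftrightarrow> bounded_op H H A \<and>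
    (\<forall>x\<in>hcarrier H. Im (hinner H (A x) x) = 0 \<and> Re (hinner H (A x) x) \<ge> 0)"

text \<open>The positive square root of a positive operator is unique as an operator on the carrier of
  \<open>H\<close>, so the choice only affects irrelevant values outside it.\<close>

definition op_sqrt :: "'a::complex_vector hspace \<Rightarrow> ('a \<Rightarrow> 'a) \<Rightarrow> 'a \<Rightarrow> 'a"
  where "op_sqrt H A = (SOME S. positive_op H S \<and> (\<forall>x\<in>hcarrier H. S (S x) = A x))"

definition partial_isometry ::
    "'a::complex_vector hspace \<Rightarrow> 'b::complex_vector hspace \<Rightarrow> ('a \<Rightarrow> 'b) \<Rightarrow> bool"
  where "partial_isometry H K V \<longleftrightarrow> bounded_op H K V \<and>
    (\<forall>x \<in> ominus H {u \<in> hcarrier H. V u = 0}. hnorm K (V x) = hnorm H x)"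

definition unitary_op ::
    "'a::complex_vector hspace \<Rightarrow> 'b::complex_vector hspace \<Rightarrow> ('a \<Rightarrow> 'b) \<Rightarrow> bool"
  where "unitary_op H K U \<longleftrightarrow> bounded_op H K U \<and> bij_betw U (hcarrier H) (hcarrier K) \<and>
    (\<forall>x\<in>hcarrier H. \<forall>y\<in>hcarrier H. hinner K (U x) (U y) = hinner H x y)"

definition unitarily_equivalent ::
    "'a::complex_vector hspace \<Rightarrow> ('a \<Rightarrow> 'a) \<Rightarrow> 'b::complex_vector hspace \<Rightarrow> ('b \<Rightarrow> 'b) \<Rightarrow> bool"
  where "unitarily_equivalent H A K B \<longleftrightarrow>
    (\<exists>U. unitary_op H K U \<and> (\<forall>x\<in>hcarrier H. U (A x) = B (U x)))"

abbreviation unit_disc :: "complex set"  (\<open>\<D>\<close>)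
  where "\<D> \<equiv> ball 0 1"

definition vec_holomorphic :: "'a::complex_vector hspace \<Rightarrow> (complex \<Rightarrow> 'a) \<Rightarrow> bool"
  where "vec_holomorphic E f \<longleftrightarrow> (\<forall>z\<in>\<D>. f z \<in> hcarrier E \<and>
    (\<exists>d\<in>hcarrier E. ((\<lambda>h. hnorm E ((1 / h) *\<^sub>C (f (z + h) - f z) - d)) \<longlongrightarrow> 0) (at 0)))"

definition op_holomorphic ::
    "'a::complex_vector hspace \<Rightarrow> 'b::complex_vector hspace \<Rightarrow> (complex \<Rightarrow> 'a \<Rightarrow> 'b) \<Rightarrow> bool"
  where "op_holomorphic E F \<Theta> \<longleftrightarrow> (\<forall>z\<in>\<D>. bounded_op E F (\<Theta> z) \<and>
    (\<exists>L. bounded_op E F L \<and>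
      ((\<lambda>h. opnorm E F (\<lambda>x. (1 / h) *\<^sub>C (\<Theta> (z + h) x - \<Theta> z x) - L x)) \<longlongrightarrow> 0) (at 0)))"

text \<open>
  Functions on the disc are represented by functions on \<open>complex\<close> that vanish outside the disc.
  By the Moore--Aronszajn theorem the Hilbert space with reproducing kernel \<open>k(z,w) I\<^sub>E\<close> has a
  uniquely determined carrier, and its inner product is uniquely determined on this carrier.
\<close>

definition kernel_section :: "(complex \<Rightarrow> complex \<Rightarrow> complex) \<Rightarrow> complex \<Rightarrow> 'a::complex_vector \<Rightarrow> complex \<Rightarrow> 'a"
  where "kernel_section k w \<eta> = (\<lambda>z. if z \<in> \<D> then k z w *\<^sub>C \<eta> else 0)"

definition is_rkhs ::
    "(complex \<Rightarrow> complex \<Rightarrow> complex) \<Rightarrow> 'a::complex_vector hspace \<Rightarrow> (complex \<Rightarrow> 'a) hspace \<Rightarrow> bool"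
  where "is_rkhs k E F \<longleftrightarrow> hilbert_space F \<and>
    (\<forall>f\<in>hcarrier F. vec_holomorphic E f \<and> (\<forall>z. z \<notin> \<D> \<longrightarrow> f z = 0)) \<and>
    (\<forall>w\<in>\<D>. \<forall>\<eta>\<in>hcarrier E. kernel_section k w \<eta> \<in> hcarrier F \<and>
      (\<forall>f\<in>hcarrier F. hinner F f (kernel_section k w \<eta>) = hinner E (f w) \<eta>))"

definition bergman_kernel :: "nat \<Rightarrow> complex \<Rightarrow> complex \<Rightarrow> complex"
  where "bergman_kernel m z w = 1 / (1 - z * cnj w) ^ m"

definition A2 :: "nat \<Rightarrow> 'a::complex_vector hspace \<Rightarrow> (complex \<Rightarrow> 'a) hspace"
  where "A2 m E = (SOME F. is_rkhs (bergman_kernel m) E F)"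

definition Mz :: "(complex \<Rightarrow> 'a::complex_vector) \<Rightarrow> complex \<Rightarrow> 'a"
  where "Mz f = (\<lambda>w. w *\<^sub>C f w)"

definition Mult :: "(complex \<Rightarrow> 'a \<Rightarrow> 'b::zero) \<Rightarrow> (complex \<Rightarrow> 'a) \<Rightarrow> complex \<Rightarrow> 'b"
  where "Mult \<Theta> f = (\<lambda>z. if z \<in> \<D> then \<Theta> z (f z) else 0)"

definition multipliers :: "nat \<Rightarrow> 'a::complex_vector hspace \<Rightarrow> nat \<Rightarrow> 'b::complex_vector hspace
    \<Rightarrow> (complex \<Rightarrow> 'a \<Rightarrow> 'b) set"
  where "multipliers m1 E1 m2 E2 = {\<Theta>. op_holomorphic E1 E2 \<Theta> \<and>
    (\<forall>f\<in>hcarrier (A2 m1 E1). Mult \<Theta> f \<in> hcarrier (A2 m2 E2))}"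

definition partially_isometric_multiplier :: "nat \<Rightarrow> 'a::complex_vector hspace \<Rightarrow> nat
    \<Rightarrow> 'b::complex_vector hspace \<Rightarrow> (complex \<Rightarrow> 'a \<Rightarrow> 'b) \<Rightarrow> bool"
  where "partially_isometric_multiplier m1 E1 m2 E2 \<Theta> \<longleftrightarrow>
    \<Theta> \<in> multipliers m1 E1 m2 E2 \<and> partial_isometry (A2 m1 E1) (A2 m2 E2) (Mult \<Theta>)"

definition Bm_inv :: "nat \<Rightarrow> 'a::complex_vector hspace \<Rightarrow> ('a \<Rightarrow> 'a) \<Rightarrow> 'a \<Rightarrow> 'a"
  where "Bm_inv m H T x =
    (\<Sum>k\<le>m. ((-1) ^ k * of_nat (m choose k)) *\<^sub>C (T ^^ k) ((adj H H T ^^ k) x))"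

definition class_C_dot_0 :: "'a::complex_vector hspace \<Rightarrow> ('a \<Rightarrow> 'a) \<Rightarrow> bool"
  where "class_C_dot_0 H T \<longleftrightarrow>
    (\<forall>x\<in>hcarrier H. (\<lambda>l. hnorm H ((adj H H T ^^ l) x)) \<longlonglongrightarrow> 0)"

definition Bm_contraction :: "nat \<Rightarrow> 'a::complex_vector hspace \<Rightarrow> ('a \<Rightarrow> 'a) \<Rightarrow> bool"
  where "Bm_contraction m H T \<longleftrightarrow>
    bounded_op H H T \<and> class_C_dot_0 H T \<and> positive_op H (Bm_inv m H T)"

definition defect_op :: "nat \<Rightarrow> 'a::complex_vector hspace \<Rightarrow> ('a \<Rightarrow> 'a) \<Rightarrow> 'a \<Rightarrow> 'a"
  where "defect_op m H T = op_sqrt H (Bm_inv m H T)"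

definition defect_space :: "nat \<Rightarrow> 'a::complex_vector hspace \<Rightarrow> ('a \<Rightarrow> 'a) \<Rightarrow> 'a hspace"
  where "defect_space m H T = subspace_of H (hclosure H (defect_op m H T ` hcarrier H))"

definition model_space :: "nat \<Rightarrow> 'a::complex_vector hspace \<Rightarrow> 'b::complex_vector hspace
    \<Rightarrow> (complex \<Rightarrow> 'a \<Rightarrow> 'b) \<Rightarrow> (complex \<Rightarrow> 'b) set"
  where "model_space m E D \<theta> = ominus (A2 m D) (Mult \<theta> ` hcarrier (A2 1 E))"

end

theory Submission
  imports Defs
begin

text \<open>
  The operator \<open>T\<close> is realised on the range of a dilation, and the complement of that range is described
  by dilating a second time.

  Let \<open>D\<close> be the defect operator of \<open>T\<close>. The map \<open>V x = D (1 - z T\<^sup>*)\<^bsup>-m\<^esup> x\<close> goes from \<open>H\<close> into the Bergman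
  space with values in the defect space, and \<open>\<parallel>V x\<parallel>\<^sup>2 = \<Sum>\<^sub>k w\<^sub>k \<parallel>D T\<^sup>*\<^sup>k x\<parallel>\<^sup>2\<close> with the coefficients \<open>w\<^sub>k\<close> of
  \<open>(1 - x)\<^bsup>-m\<^esup>\<close>. Here \<open>\<parallel>D T\<^sup>*\<^sup>k x\<parallel>\<^sup>2\<close> is the \<open>m\<close>-th backward difference of the null sequence
  \<open>\<parallel>T\<^sup>*\<^sup>k x\<parallel>\<^sup>2\<close>, and summing by parts \<open>m\<close> times collapses the series to \<open>\<parallel>x\<parallel>\<^sup>2\<close> (\<open>backward_diff_sums\<close>,
  \<open>dil_sums\<close>). So \<open>V\<close> is an isometry, and it intertwines \<open>T\<^sup>*\<close> with the adjoint of \<open>Mz\<close>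
  (\<open>shift_inner_dil\<close>). Therefore \<open>T\<close> is unitarily equivalent to the compression of \<open>Mz\<close> to \<open>Q = ran V\<close>, and
  the complement \<open>S\<close> of \<open>Q\<close> is invariant under \<open>Mz\<close>.

  It remains to see that \<open>S\<close> is the range of a partially isometric multiplier on a Hardy space
  (\<open>invariant_subspace_is_range\<close>). The restriction \<open>R\<close> of \<open>Mz\<close> to \<open>S\<close> is a contraction of class \<open>C\<^sub>\<cdot>\<^sub>0\<close>, hence
  satisfies the hypotheses on \<open>T\<close> with \<open>m = 1\<close>. The adjoint of its dilation is a coisometry from a Hardy
  space onto \<open>S\<close>. A computation with kernel sections shows that it is the multiplication by
  \<open>\<theta>(z) \<eta> = (D\<^sub>R \<eta>)(z)\<close>, where \<open>D\<^sub>R\<close> is the defect operator of \<open>R\<close> (\<open>Mult_theta\<close>).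

  Underneath lie the Riesz representation theorem (\<open>Riesz\<close>), which yields projections, adjoints and
  point evaluations, the square root of a positive operator (\<open>positive_sqrt_exists\<close>), which makes the
  defect operators meaningful, and the identification of the Bergman spaces with weighted spaces of
  Taylor coefficients (\<open>A2_carrier\<close>, \<open>J_inner\<close>). The latter needs a construction of the reproducing kernel
  Hilbert space as well as its uniqueness (\<open>rkhs_unique_inner\<close>).
\<close>

section \<open>Hilbert spaces on carrier sets\<close>

lemma scaleC_zero_left [simp]: "0 *\<^sub>C x = 0"
  using scaleC_add_left[of 0 0 x] by simp

lemma scaleC_zero_right [simp]: "c *\<^sub>C 0 = 0"
  using scaleC_add_right[of c 0 0] by simp

lemma scaleC_minus_right [simp]: "c *\<^sub>C (- x) = - (c *\<^sub>C x)"
  using scaleC_add_right[of c x "- x"] by (simp add: eq_neg_iff_add_eq_0 add.commute)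

lemma scaleC_minus_left [simp]: "(- c) *\<^sub>C x = - (c *\<^sub>C x)"
  using scaleC_add_left[of c "- c" x] by (simp add: eq_neg_iff_add_eq_0 add.commute)

lemma scaleC_diff_right: "c *\<^sub>C (x - y) = c *\<^sub>C x - c *\<^sub>C y"
  using scaleC_add_right[of c x "- y"] by simp

lemma scaleC_fun_apply: "(c *\<^sub>C f) x = c *\<^sub>C f x"
  by (simp add: scaleC_fun_def)

declare scaleC_one [simp] scaleC_scaleC [simp]

context hilbert_space
begin

lemma uminus_closed: "x \<in> hcarrier H \<Longrightarrow> - x \<in> hcarrier H"
  using scaleC_closed[of x "-1"] by simp

lemma diff_closed: "\<lbrakk>x \<in> hcarrier H; y \<in> hcarrier H\<rbrakk> \<Longrightarrow> x - y \<in> hcarrier H"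
  using add_closed[of x "- y"] uminus_closed by simp

lemmas closed_rules = zero_closed add_closed scaleC_closed uminus_closed diff_closed

lemma sum_closed: "(\<And>i. i \<in> I \<Longrightarrow> f i \<in> hcarrier H) \<Longrightarrow> sum f I \<in> hcarrier H"
  by (induction I rule: infinite_finite_induct) (auto intro: closed_rules)

lemma inner_add_right:
  "\<lbrakk>x \<in> hcarrier H; y \<in> hcarrier H; z \<in> hcarrier H\<rbrakk>
    \<Longrightarrow> hinner H z (x + y) = hinner H z x + hinner H z y"
  by (metis add_closed complex_cnj_add inner_add_left inner_commute)

lemma inner_scaleC_right:
  "\<lbrakk>x \<in> hcarrier H; y \<in> hcarrier H\<rbrakk> \<Longrightarrow> hinner H y (c *\<^sub>C x) = cnj c * hinner H y x"
  by (metis scaleC_closed complex_cnj_mult inner_scaleC_left inner_commute)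

lemma inner_zero_left [simp]: "y \<in> hcarrier H \<Longrightarrow> hinner H 0 y = 0"
  using inner_scaleC_left[of 0 y 0] zero_closed by simp

lemma inner_zero_right [simp]: "y \<in> hcarrier H \<Longrightarrow> hinner H y 0 = 0"
  using inner_scaleC_right[of 0 y 0] zero_closed by simp

lemma inner_minus_left:
  "\<lbrakk>x \<in> hcarrier H; y \<in> hcarrier H\<rbrakk> \<Longrightarrow> hinner H (- x) y = - hinner H x y"
  using inner_scaleC_left[of x y "-1"] by simp

lemma inner_minus_right:
  "\<lbrakk>x \<in> hcarrier H; y \<in> hcarrier H\<rbrakk> \<Longrightarrow> hinner H y (- x) = - hinner H y x"
  using inner_scaleC_right[of x y "-1"] by simp

lemma inner_diff_left:
  "\<lbrakk>x \<in> hcarrier H; y \<in> hcarrier H; z \<in> hcarrier H\<rbrakk>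
    \<Longrightarrow> hinner H (x - y) z = hinner H x z - hinner H y z"
  using inner_add_left[of x "- y" z] by (simp add: inner_minus_left uminus_closed)

lemma inner_diff_right:
  "\<lbrakk>x \<in> hcarrier H; y \<in> hcarrier H; z \<in> hcarrier H\<rbrakk>
    \<Longrightarrow> hinner H z (x - y) = hinner H z x - hinner H z y"
  using inner_add_right[of x "- y" z] by (simp add: inner_minus_right uminus_closed)

lemmas inner_linear = inner_add_left inner_add_right inner_diff_left inner_diff_right
  inner_scaleC_left inner_scaleC_right inner_minus_left inner_minus_right

lemma inner_sum_left:
  "\<lbrakk>\<And>i. i \<in> I \<Longrightarrow> f i \<in> hcarrier H; y \<in> hcarrier H\<rbrakk>
    \<Longrightarrow> hinner H (sum f I) y = (\<Sum>i\<in>I. hinner H (f i) y)"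
  by (induction I rule: infinite_finite_induct) (auto simp: inner_add_left sum_closed)

lemma norm_sq: "x \<in> hcarrier H \<Longrightarrow> (hnorm H x)\<^sup>2 = Re (hinner H x x)"
  by (simp add: hnorm_def inner_nonneg)

lemma inner_self: "x \<in> hcarrier H \<Longrightarrow> hinner H x x = of_real ((hnorm H x)\<^sup>2)"
  using arg_cong[OF inner_commute, of x x Im] by (simp add: norm_sq complex_eq_iff)

lemma norm_ge_0 [simp]: "x \<in> hcarrier H \<Longrightarrow> 0 \<le> hnorm H x"
  by (simp add: hnorm_def inner_nonneg)

lemma norm_zero [simp]: "hnorm H 0 = 0"
  by (simp add: hnorm_def zero_closed)

lemma norm_eq_0_iff: "x \<in> hcarrier H \<Longrightarrow> hnorm H x = 0 \<longleftrightarrow> x = 0"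
  using inner_self[of x] inner_definite[of x] by auto

lemma norm_scaleC:
  assumes x: "x \<in> hcarrier H"
  shows "hnorm H (c *\<^sub>C x) = cmod c * hnorm H x"
proof -
  have "hinner H (c *\<^sub>C x) (c *\<^sub>C x) = (c * cnj c) * hinner H x x"
    using x by (simp add: inner_linear scaleC_closed)
  also have "\<dots> = of_real ((cmod c * hnorm H x)\<^sup>2)"
    using x by (simp add: inner_self complex_norm_square[symmetric] power_mult_distrib)
  finally show ?thesis using x by (simp add: hnorm_def[of H "c *\<^sub>C x"])
qed

lemma norm_minus [simp]: "x \<in> hcarrier H \<Longrightarrow> hnorm H (- x) = hnorm H x"
  using norm_scaleC[of x "-1"] by simp

lemma norm_minus_commute:
  "\<lbrakk>x \<in> hcarrier H; y \<in> hcarrier H\<rbrakk> \<Longrightarrow> hnorm H (x - y) = hnorm H (y - x)"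
  using norm_minus[of "x - y"] by (simp add: diff_closed)

lemma norm_add_sq:
  "\<lbrakk>x \<in> hcarrier H; y \<in> hcarrier H\<rbrakk>
    \<Longrightarrow> (hnorm H (x + y))\<^sup>2 = (hnorm H x)\<^sup>2 + 2 * Re (hinner H x y) + (hnorm H y)\<^sup>2"
  using inner_commute[of y x] by (simp add: norm_sq closed_rules inner_linear)

lemma norm_diff_sq:
  "\<lbrakk>x \<in> hcarrier H; y \<in> hcarrier H\<rbrakk>
    \<Longrightarrow> (hnorm H (x - y))\<^sup>2 = (hnorm H x)\<^sup>2 - 2 * Re (hinner H x y) + (hnorm H y)\<^sup>2"
  using inner_commute[of y x] by (simp add: norm_sq closed_rules inner_linear)

lemma parallelogram:
  "\<lbrakk>x \<in> hcarrier H; y \<in> hcarrier H\<rbrakk>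
    \<Longrightarrow> (hnorm H (x + y))\<^sup>2 + (hnorm H (x - y))\<^sup>2 = 2 * (hnorm H x)\<^sup>2 + 2 * (hnorm H y)\<^sup>2"
  by (simp add: norm_add_sq norm_diff_sq)

end

text \<open>
  The hypothesis says that the form \<open>\<parallel>x + t y\<parallel>\<^sup>2\<close> of a semi-inner product is nonnegative, with \<open>a\<close>, \<open>b\<close> and
  \<open>c\<close> in place of \<open>\<parallel>x\<parallel>\<^sup>2\<close>, \<open>\<parallel>y\<parallel>\<^sup>2\<close> and \<open>\<langle>x, y\<rangle>\<close>. Besides inner products it is applied to the form
  \<open>\<langle>A x, y\<rangle>\<close> of a positive operator, which may be degenerate.
\<close>

lemma semi_inner_Cauchy_Schwarz:
  fixes a b :: real and c :: complex
  assumes "\<And>t. 0 \<le> a + 2 * Re (cnj t * c) + (cmod t)\<^sup>2 * b" and "0 \<le> a" "0 \<le> b"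
  shows "(cmod c)\<^sup>2 \<le> a * b"
proof (cases "b = 0")
  case True
  have "c = 0"
  proof (rule ccontr)
    assume "c \<noteq> 0"
    \<comment> \<open>At \<open>t = - r c\<close> the form is \<open>a - 2 r \<bar>c\<bar>\<^sup>2 = - 1\<close>.\<close>
    define r where "r = (a + 1) / (2 * (cmod c)\<^sup>2)"
    have "Re (cnj (of_real (- r) * c) * c) = - r * (cmod c)\<^sup>2"
      unfolding cmod_power2 by (simp add: power2_eq_square algebra_simps)
    then have "0 \<le> a - 2 * r * (cmod c)\<^sup>2" using assms(1)[of "of_real (- r) * c"] True by simp
    then show False using \<open>c \<noteq> 0\<close> by (simp add: r_def field_simps)
  qed
  then show ?thesis using True by simp
next
  case False
  define t where "t = - c / of_real b"
  have "cnj t * c = - of_real ((cmod c)\<^sup>2 / b)"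
    using complex_norm_square[of c] by (simp add: t_def mult.commute)
  moreover have "(cmod t)\<^sup>2 * b = (cmod c)\<^sup>2 / b"
    using False by (simp add: t_def norm_divide power_divide power2_eq_square)
  ultimately have "0 \<le> a - (cmod c)\<^sup>2 / b" using assms(1)[of t] by simp
  then show ?thesis using False assms(3) by (simp add: field_simps)
qed

context hilbert_space
begin

lemma Cauchy_Schwarz:
  assumes x: "x \<in> hcarrier H" and y: "y \<in> hcarrier H"
  shows "cmod (hinner H x y) \<le> hnorm H x * hnorm H y"
proof -
  have "(cmod (hinner H x y))\<^sup>2 \<le> (hnorm H x)\<^sup>2 * (hnorm H y)\<^sup>2"
  proof (rule semi_inner_Cauchy_Schwarz)
    fix t
    show "0 \<le> (hnorm H x)\<^sup>2 + 2 * Re (cnj t * hinner H x y) + (cmod t)\<^sup>2 * (hnorm H y)\<^sup>2"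
      using norm_add_sq[of x "t *\<^sub>C y"] x y zero_le_power2[of "hnorm H (x + t *\<^sub>C y)"]
      by (simp add: closed_rules norm_scaleC inner_scaleC_right power_mult_distrib)
  qed auto
  then show ?thesis using x y by (simp add: power_mult_distrib[symmetric] power2_le_iff_abs_le)
qed

lemma norm_triangle:
  assumes x: "x \<in> hcarrier H" and y: "y \<in> hcarrier H"
  shows "hnorm H (x + y) \<le> hnorm H x + hnorm H y"
proof -
  have "Re (hinner H x y) \<le> hnorm H x * hnorm H y"
    using Cauchy_Schwarz[OF x y] complex_Re_le_cmod order_trans by blast
  then have "(hnorm H (x + y))\<^sup>2 \<le> (hnorm H x + hnorm H y)\<^sup>2"
    using norm_add_sq[OF x y] by (simp add: power2_sum)
  then show ?thesis using x y by (simp add: power2_le_iff_abs_le)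
qed

lemma norm_triangle_diff:
  assumes "x \<in> hcarrier H" "y \<in> hcarrier H" "z \<in> hcarrier H"
  shows "hnorm H (x - z) \<le> hnorm H (x - y) + hnorm H (y - z)"
  using norm_triangle[of "x - y" "y - z"] assms by (simp add: closed_rules)

lemma norm_add_sq_le:
  assumes "x \<in> hcarrier H" "y \<in> hcarrier H"
  shows "(hnorm H (x + y))\<^sup>2 \<le> 2 * (hnorm H x)\<^sup>2 + 2 * (hnorm H y)\<^sup>2"
  using parallelogram[OF assms] zero_le_power2[of "hnorm H (x - y)"] by linarith

lemma norm_reverse_triangle:
  assumes "x \<in> hcarrier H" "y \<in> hcarrier H"
  shows "\<bar>hnorm H x - hnorm H y\<bar> \<le> hnorm H (x - y)"
  using norm_triangle[of "x - y" y] norm_triangle[of "y - x" x] assms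
  by (simp add: closed_rules norm_minus_commute[of x y] abs_le_iff)

lemma eq_if_inner_eq:
  assumes "x \<in> hcarrier H" "y \<in> hcarrier H"
    and "\<And>u. u \<in> hcarrier H \<Longrightarrow> hinner H u x = hinner H u y"
  shows "x = y"
  using assms inner_definite[of "x - y"] assms(3)[of "x - y"]
  by (simp add: closed_rules inner_diff_right)

lemma eq_if_inner_eq':
  assumes "x \<in> hcarrier H" "y \<in> hcarrier H"
    and "\<And>u. u \<in> hcarrier H \<Longrightarrow> hinner H x u = hinner H y u"
  shows "x = y"
  using assms inner_definite[of "x - y"] assms(3)[of "x - y"]
  by (simp add: closed_rules inner_diff_left)

lemma cmod_inner_commute:
  "\<lbrakk>x \<in> hcarrier H; y \<in> hcarrier H\<rbrakk> \<Longrightarrow> cmod (hinner H x y) = cmod (hinner H y x)"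
  by (metis complex_mod_cnj inner_commute)

lemma norm_le_if_inner_le:
  assumes "x \<in> hcarrier H" "0 \<le> C"
    and "\<And>u. u \<in> hcarrier H \<Longrightarrow> cmod (hinner H u x) \<le> C * hnorm H u"
  shows "hnorm H x \<le> C"
proof (cases "hnorm H x = 0")
  case False
  then have "hnorm H x * hnorm H x \<le> C * hnorm H x"
    using assms(3)[OF assms(1)] assms(1)
    by (simp add: inner_self power2_eq_square norm_mult del: of_real_mult)
  with False assms(1) show ?thesis by (simp add: less_le)
qed (use assms in simp)

lemma Cauchy_convergent:
  assumes "\<And>n. X n \<in> hcarrier H" "\<forall>e>0. \<exists>N. \<forall>i\<ge>N. \<forall>j\<ge>N. hnorm H (X i - X j) < e"
  obtains x where "x \<in> hcarrier H" "(\<lambda>i. hnorm H (X i - x)) \<longlonglongrightarrow> 0"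
  using complete[OF _ assms(2)] assms(1) by blast

lemma limit_inner:
  assumes "\<And>n. X n \<in> hcarrier H" "x \<in> hcarrier H" "y \<in> hcarrier H"
    and "(\<lambda>n. hnorm H (X n - x)) \<longlonglongrightarrow> 0"
  shows "(\<lambda>n. hinner H (X n) y) \<longlonglongrightarrow> hinner H x y"
proof (rule Lim_null[THEN iffD2], rule Lim_null_comparison)
  show "\<forall>\<^sub>F n in sequentially. norm (hinner H (X n) y - hinner H x y) \<le> hnorm H (X n - x) * hnorm H y"
    using Cauchy_Schwarz[of "X _ - x" y] assms(1-3) by (simp add: inner_diff_left closed_rules)
  show "(\<lambda>n. hnorm H (X n - x) * hnorm H y) \<longlonglongrightarrow> 0"
    using tendsto_mult_right[OF assms(4), of "hnorm H y"] by simp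
qed

lemma limit_norm:
  assumes "\<And>n. X n \<in> hcarrier H" "x \<in> hcarrier H"
    and "(\<lambda>n. hnorm H (X n - x)) \<longlonglongrightarrow> 0"
  shows "(\<lambda>n. hnorm H (X n)) \<longlonglongrightarrow> hnorm H x"
  by (rule Lim_null[THEN iffD2], rule Lim_null_comparison[OF _ assms(3)])
     (use norm_reverse_triangle assms in simp)

lemma limit_Cauchy:
  assumes "\<And>n. X n \<in> hcarrier H" "x \<in> hcarrier H" "(\<lambda>n. hnorm H (X n - x)) \<longlonglongrightarrow> 0"
  shows "\<forall>e>0. \<exists>N. \<forall>i\<ge>N. \<forall>j\<ge>N. hnorm H (X i - X j) < e"
proof (intro allI impI)
  fix e :: real assume "e > 0"
  then obtain N where N: "\<And>n. n \<ge> N \<Longrightarrow> \<bar>hnorm H (X n - x)\<bar> < e / 2"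
    using LIMSEQ_D[OF assms(3), of "e / 2"] by auto
  have "hnorm H (X i - X j) < e" if "i \<ge> N" "j \<ge> N" for i j
    using N[OF that(1)] N[OF that(2)] norm_triangle_diff[of "X i" x "X j"]
      norm_minus_commute[of x "X j"] assms(1,2) by (simp add: abs_less_iff)
  then show "\<exists>N. \<forall>i\<ge>N. \<forall>j\<ge>N. hnorm H (X i - X j) < e" by blast
qed

text \<open>
  The representing vector is the minimiser of \<open>\<parallel>x\<parallel>\<^sup>2 - 2 Re \<phi>(x)\<close>; by the parallelogram law a
  minimising sequence of this functional is Cauchy.
\<close>

lemma Riesz:
  assumes add: "\<And>x y. \<lbrakk>x \<in> hcarrier H; y \<in> hcarrier H\<rbrakk> \<Longrightarrow> \<phi> (x + y) = \<phi> x + \<phi> y"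
    and scale: "\<And>c x. x \<in> hcarrier H \<Longrightarrow> \<phi> (c *\<^sub>C x) = c * \<phi> x"
    and bound: "\<And>x. x \<in> hcarrier H \<Longrightarrow> cmod (\<phi> x) \<le> C * hnorm H x"
  shows "\<exists>y\<in>hcarrier H. \<forall>x\<in>hcarrier H. \<phi> x = hinner H x y"
proof -
  define q where "q x = (hnorm H x)\<^sup>2 - 2 * Re (\<phi> x)" for x
  have q_ge: "- (C\<^sup>2) \<le> q x" if "x \<in> hcarrier H" for x
  proof -
    have "Re (\<phi> x) \<le> C * hnorm H x" using bound[OF that] complex_Re_le_cmod order_trans by blast
    moreover have "0 \<le> (hnorm H x - C)\<^sup>2" by simp
    ultimately show ?thesis by (simp add: q_def power2_diff algebra_simps)
  qed
  define d where "d = Inf (q ` hcarrier H)"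
  have bdd: "bdd_below (q ` hcarrier H)" by (rule bdd_belowI2, rule q_ge)
  have d_le: "d \<le> q x" if "x \<in> hcarrier H" for x
    unfolding d_def using bdd that by (auto intro: cInf_lower)
  have "\<exists>x\<in>hcarrier H. q x < d + inverse (real (Suc n))" for n
  proof -
    have "q ` hcarrier H \<noteq> {}" using zero_closed by auto
    then show ?thesis using cInf_lessD[of "q ` hcarrier H" "d + inverse (real (Suc n))"]
      unfolding d_def[symmetric] by auto
  qed
  then obtain X where X: "\<And>n. X n \<in> hcarrier H" and qX: "\<And>n. q (X n) < d + inverse (real (Suc n))"
    by metis
  have mid: "(hnorm H (x - y))\<^sup>2 \<le> 2 * (q x - d) + 2 * (q y - d)"
    if x: "x \<in> hcarrier H" and y: "y \<in> hcarrier H" for x y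
  proof -
    define h where "h = (1/2) *\<^sub>C (x + y)"
    have "d \<le> q h" using d_le x y by (simp add: closed_rules h_def)
    moreover have "(hnorm H h)\<^sup>2 = (hnorm H (x + y))\<^sup>2 / 4"
      using x y by (simp add: closed_rules norm_scaleC power_divide h_def)
    moreover have "2 * Re (\<phi> h) = Re (\<phi> x) + Re (\<phi> y)"
      using x y by (simp add: closed_rules scale add h_def)
    ultimately show ?thesis using parallelogram[OF x y] unfolding q_def by argo
  qed
  have "\<forall>e>0. \<exists>N. \<forall>i\<ge>N. \<forall>j\<ge>N. hnorm H (X i - X j) < e"
  proof (intro allI impI)
    fix e :: real assume e: "e > 0"
    then obtain N where N: "inverse (real (Suc N)) < e\<^sup>2 / 4"
      using reals_Archimedean[of "e\<^sup>2 / 4"] by auto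
    have "hnorm H (X i - X j) < e" if "i \<ge> N" "j \<ge> N" for i j
    proof -
      have le: "inverse (real (Suc k)) \<le> inverse (real (Suc N))" if "k \<ge> N" for k
        using that by (simp add: field_simps)
      have "(hnorm H (X i - X j))\<^sup>2 < e\<^sup>2"
        using mid[OF X X, of i j] qX[of i] qX[of j] le[OF that(1)] le[OF that(2)] N by argo
      then show ?thesis using e by (auto intro: power_less_imp_less_base)
    qed
    then show "\<exists>N. \<forall>i\<ge>N. \<forall>j\<ge>N. hnorm H (X i - X j) < e" by blast
  qed
  then obtain y where y: "y \<in> hcarrier H" and lim: "(\<lambda>i. hnorm H (X i - y)) \<longlonglongrightarrow> 0"
    using Cauchy_convergent[of X] X by blast
  have \<phi>_diff: "\<phi> (u - v) = \<phi> u - \<phi> v" if "u \<in> hcarrier H" "v \<in> hcarrier H" for u v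
    using add[of u "- v"] scale[of v "-1"] that by (simp add: closed_rules)
  have "(\<lambda>n. \<phi> (X n)) \<longlonglongrightarrow> \<phi> y"
  proof (rule Lim_null[THEN iffD2], rule Lim_null_comparison)
    show "\<forall>\<^sub>F n in sequentially. norm (\<phi> (X n) - \<phi> y) \<le> C * hnorm H (X n - y)"
      using X y bound by (simp add: \<phi>_diff[symmetric] closed_rules)
    show "(\<lambda>n. C * hnorm H (X n - y)) \<longlonglongrightarrow> 0" using tendsto_mult_left[OF lim, of C] by simp
  qed
  then have "(\<lambda>n. q (X n)) \<longlonglongrightarrow> q y"
    unfolding q_def by (intro tendsto_intros limit_norm[OF X y lim])
  moreover have "(\<lambda>n. d + inverse (real (Suc n))) \<longlonglongrightarrow> d"
    using tendsto_add[OF tendsto_const LIMSEQ_inverse_real_of_nat, of d] by simp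
  ultimately have qy: "q y \<le> d" using qX by (intro LIMSEQ_le) (auto intro: less_imp_le)
  have "\<phi> x = hinner H x y" if x: "x \<in> hcarrier H" for x
  proof -
    define c where "c = hinner H y x - cnj (\<phi> x)"
    have "(cmod c)\<^sup>2 \<le> 0 * (hnorm H x)\<^sup>2"
    proof (rule semi_inner_Cauchy_Schwarz)
      fix t
      have "q y \<le> q (y + t *\<^sub>C x)" using qy d_le[of "y + t *\<^sub>C x"] x y by (simp add: closed_rules)
      moreover have "q (y + t *\<^sub>C x) = q y + 2 * Re (cnj t * c) + (cmod t)\<^sup>2 * (hnorm H x)\<^sup>2"
        using x y by (simp add: q_def norm_add_sq closed_rules inner_scaleC_right add scale
            norm_scaleC power_mult_distrib c_def algebra_simps)
      ultimately show "0 \<le> 0 + 2 * Re (cnj t * c) + (cmod t)\<^sup>2 * (hnorm H x)\<^sup>2" by simp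
    qed auto
    then have "hinner H y x = cnj (\<phi> x)" by (simp add: c_def)
    then show ?thesis using inner_commute[OF x y] by simp
  qed
  then show ?thesis using y by blast
qed

end

section \<open>Closed subspaces and projections\<close>

lemma subspace_of_simps [simp]:
  "hcarrier (subspace_of H S) = S" "hinner (subspace_of H S) = hinner H"
  "hnorm (subspace_of H S) = hnorm H"
  by (auto simp: subspace_of_def hnorm_def)

definition closed_subspace :: "'a::complex_vector hspace \<Rightarrow> 'a set \<Rightarrow> bool" where
  "closed_subspace H S \<longleftrightarrow> S \<subseteq> hcarrier H \<and> 0 \<in> S \<and> (\<forall>x\<in>S. \<forall>y\<in>S. x + y \<in> S) \<and>
    (\<forall>c. \<forall>x\<in>S. c *\<^sub>C x \<in> S) \<and>
    (\<forall>X x. (\<forall>n. X n \<in> S) \<longrightarrow> x \<in> hcarrier H \<longrightarrow> (\<lambda>n. hnorm H (X n - x)) \<longlonglongrightarrow> 0 \<longrightarrow> x \<in> S)"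

lemma closed_subspace_subset: "closed_subspace H S \<Longrightarrow> x \<in> S \<Longrightarrow> x \<in> hcarrier H"
  by (auto simp: closed_subspace_def)

context hilbert_space
begin

lemma hilbert_subspace:
  assumes S: "closed_subspace H S"
  shows "hilbert_space (subspace_of H S)"
proof
  note in_H = closed_subspace_subset[OF S]
  fix X :: "nat \<Rightarrow> 'a"
  assume X: "range X \<subseteq> hcarrier (subspace_of H S)"
    and Cauchy: "\<forall>e>0. \<exists>N. \<forall>i\<ge>N. \<forall>j\<ge>N. hnorm (subspace_of H S) (X i - X j) < e"
  from X have X: "\<And>n. X n \<in> S" by auto
  obtain x where x: "x \<in> hcarrier H" "(\<lambda>i. hnorm H (X i - x)) \<longlonglongrightarrow> 0"
    using Cauchy_convergent[of X] Cauchy in_H[OF X] by auto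
  then have "x \<in> S" using S X unfolding closed_subspace_def by blast
  then show "\<exists>x\<in>hcarrier (subspace_of H S). (\<lambda>i. hnorm (subspace_of H S) (X i - x)) \<longlonglongrightarrow> 0"
    using x by auto
qed (use S in \<open>auto simp: closed_subspace_def subset_iff inner_linear inner_nonneg
       intro: inner_commute inner_definite\<close>)

lemma ominus_closed_subspace:
  assumes "S \<subseteq> hcarrier H"
  shows "closed_subspace H (ominus H S)"
  unfolding closed_subspace_def
proof (intro conjI allI impI ballI)
  fix X :: "nat \<Rightarrow> 'a" and x
  assume X: "\<forall>n. X n \<in> ominus H S" and x: "x \<in> hcarrier H" "(\<lambda>n. hnorm H (X n - x)) \<longlonglongrightarrow> 0"
  have "hinner H x y = 0" if "y \<in> S" for y
  proof -
    have "(\<lambda>n. hinner H (X n) y) \<longlonglongrightarrow> hinner H x y"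
      using X x that assms by (intro limit_inner) (auto simp: ominus_def)
    then show ?thesis using X that by (simp add: ominus_def LIMSEQ_const_iff)
  qed
  then show "x \<in> ominus H S" using x by (simp add: ominus_def)
qed (use assms in \<open>auto simp: ominus_def inner_linear closed_rules subset_iff\<close>)

lemma hclosure_superset: "S \<subseteq> hcarrier H \<Longrightarrow> S \<subseteq> hclosure H S"
  by (force simp: hclosure_def)

lemma hclosure_closed_subspace:
  assumes S: "S \<subseteq> hcarrier H" "0 \<in> S" "\<And>x y. \<lbrakk>x \<in> S; y \<in> S\<rbrakk> \<Longrightarrow> x + y \<in> S"
    "\<And>c x. x \<in> S \<Longrightarrow> c *\<^sub>C x \<in> S"
  shows "closed_subspace H (hclosure H S)"
  unfolding closed_subspace_def
proof (intro conjI allI impI ballI)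
  show "hclosure H S \<subseteq> hcarrier H" by (auto simp: hclosure_def)
  show "0 \<in> hclosure H S" using hclosure_superset[OF S(1)] S(2) by blast
next
  fix x y assume *: "x \<in> hclosure H S" "y \<in> hclosure H S"
  then have xy: "x \<in> hcarrier H" "y \<in> hcarrier H" by (auto simp: hclosure_def)
  have "\<exists>z\<in>S. hnorm H (x + y - z) < e" if e: "e > 0" for e
  proof -
    obtain u v where u: "u \<in> S" "hnorm H (x - u) < e / 2" and v: "v \<in> S" "hnorm H (y - v) < e / 2"
      using * half_gt_zero[OF e] unfolding hclosure_def by blast
    have "hnorm H ((x - u) + (y - v)) < e"
      using norm_triangle[of "x - u" "y - v"] u v xy S(1) by (force simp: closed_rules subset_iff)
    then show ?thesis using S(3)[OF u(1) v(1)] by (intro bexI[of _ "u + v"]) (auto simp: algebra_simps)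
  qed
  then show "x + y \<in> hclosure H S" using xy by (simp add: hclosure_def closed_rules)
next
  fix c x assume *: "x \<in> hclosure H S"
  then have x: "x \<in> hcarrier H" by (auto simp: hclosure_def)
  have "\<exists>z\<in>S. hnorm H (c *\<^sub>C x - z) < e" if e: "e > 0" for e
  proof -
    have "e / (cmod c + 1) > 0" using e by (simp add: add_nonneg_pos)
    then obtain u where u: "u \<in> S" "hnorm H (x - u) < e / (cmod c + 1)"
      using * unfolding hclosure_def by blast
    then have uH: "u \<in> hcarrier H" using S(1) by blast
    have "hnorm H (c *\<^sub>C (x - u)) \<le> (cmod c + 1) * hnorm H (x - u)"
      using x uH by (simp add: norm_scaleC closed_rules mult_right_mono)
    also have "\<dots> < e" using u(2) norm_ge_zero[of c] by (simp add: field_simps)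
    finally show ?thesis using S(4)[OF u(1)] by (intro bexI[of _ "c *\<^sub>C u"]) (auto simp: scaleC_diff_right)
  qed
  then show "c *\<^sub>C x \<in> hclosure H S" using x by (simp add: hclosure_def closed_rules)
next
  fix X :: "nat \<Rightarrow> 'a" and x
  assume X: "\<forall>n. X n \<in> hclosure H S" and x: "x \<in> hcarrier H" "(\<lambda>n. hnorm H (X n - x)) \<longlonglongrightarrow> 0"
  have "\<exists>y\<in>S. hnorm H (x - y) < e" if e: "e > 0" for e
  proof -
    obtain n where n: "\<bar>hnorm H (X n - x)\<bar> < e / 2"
      using LIMSEQ_D[OF x(2), of "e / 2"] e by auto
    obtain y where y: "y \<in> S" "hnorm H (X n - y) < e / 2"
      using X half_gt_zero[OF e] unfolding hclosure_def by blast
    have "X n \<in> hcarrier H" using X by (auto simp: hclosure_def)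
    then have "hnorm H (x - y) < e"
      using norm_triangle_diff[of x "X n" y] norm_minus_commute[of x "X n"] n y x(1) S(1)
      by (auto simp: subset_iff abs_less_iff)
    then show ?thesis using y by blast
  qed
  then show "x \<in> hclosure H S" using x by (simp add: hclosure_def)
qed

text \<open>The projection of \<open>x\<close> represents the functional \<open>\<lambda>u. \<langle>u, x\<rangle>\<close> on \<open>S\<close>.\<close>

lemma projection_exists:
  assumes "S \<subseteq> hcarrier H" "hilbert_space (subspace_of H S)" "x \<in> hcarrier H"
  shows "\<exists>y\<in>S. \<forall>u\<in>S. hinner H (x - y) u = 0"
proof -
  have "\<exists>y\<in>hcarrier (subspace_of H S).
      \<forall>u\<in>hcarrier (subspace_of H S). hinner H u x = hinner (subspace_of H S) u y"
  proof (rule hilbert_space.Riesz[OF assms(2)])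
    show "\<And>u. u \<in> hcarrier (subspace_of H S)
        \<Longrightarrow> cmod (hinner H u x) \<le> hnorm H x * hnorm (subspace_of H S) u"
      using Cauchy_Schwarz[OF _ assms(3)] assms(1) by (auto simp: subset_iff mult.commute)
  qed (use assms in \<open>auto simp: inner_linear subset_iff\<close>)
  then obtain y where y: "y \<in> S" "\<And>u. u \<in> S \<Longrightarrow> hinner H u x = hinner H u y" by auto
  have "hinner H (x - y) u = 0" if u: "u \<in> S" for u
  proof -
    have "u \<in> hcarrier H" "y \<in> hcarrier H" using u y assms by auto
    then show ?thesis
      using y(2)[OF u] assms(3) inner_commute[of x u] inner_commute[of y u] by (simp add: inner_linear)
  qed
  with y show ?thesis by blast
qed

lemma proj_eq:
  assumes "S \<subseteq> hcarrier H" "hilbert_space (subspace_of H S)" "x \<in> hcarrier H"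
    and "y \<in> S" "\<And>u. u \<in> S \<Longrightarrow> hinner H (x - y) u = 0"
  shows "proj H S x = y"
  unfolding proj_def
proof (rule the_equality)
  show "y \<in> S \<and> (\<forall>u\<in>S. hinner H (x - y) u = 0)" using assms by blast
next
  fix y' assume y': "y' \<in> S \<and> (\<forall>u\<in>S. hinner H (x - y') u = 0)"
  have yH: "y \<in> hcarrier H" "y' \<in> hcarrier H" using y' assms by auto
  have d: "y - y' \<in> S" using hilbert_space.diff_closed[OF assms(2), of y y'] y' assms(4) by simp
  have "hinner H (y - y') (y - y') = hinner H (x - y') (y - y') - hinner H (x - y) (y - y')"
    using yH assms(3) by (simp add: inner_linear closed_rules)
  also have "\<dots> = 0" using d y' assms(5) by simp
  finally show "y' = y" using inner_definite[of "y - y'"] yH by (simp add: closed_rules)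
qed

lemma proj_in:
  assumes "S \<subseteq> hcarrier H" "hilbert_space (subspace_of H S)" "x \<in> hcarrier H"
  shows "proj H S x \<in> S"
  using projection_exists[OF assms] proj_eq[OF assms] by auto

lemma proj_inner:
  assumes "S \<subseteq> hcarrier H" "hilbert_space (subspace_of H S)" "x \<in> hcarrier H" "u \<in> S"
  shows "hinner H u (proj H S x) = hinner H u x"
proof -
  obtain y where y: "y \<in> S" "\<And>u. u \<in> S \<Longrightarrow> hinner H (x - y) u = 0"
    using projection_exists[OF assms(1-3)] by blast
  have H: "u \<in> hcarrier H" "y \<in> hcarrier H" using y assms by auto
  have "hinner H u (x - y) = 0"
    using y(2)[OF assms(4)] assms(3) H inner_commute[of u "x - y"] by (simp add: closed_rules)
  then have "hinner H u y = hinner H u x" using assms(3) H by (simp add: inner_linear)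
  then show ?thesis using proj_eq[OF assms(1-3) y] by simp
qed

lemma ominus_ominus:
  assumes "S \<subseteq> hcarrier H" "hilbert_space (subspace_of H S)"
  shows "ominus H (ominus H S) = S"
proof (intro equalityI subsetI)
  fix x assume x: "x \<in> ominus H (ominus H S)"
  then have xH: "x \<in> hcarrier H" by (simp add: ominus_def)
  obtain y where y: "y \<in> S" "\<And>u. u \<in> S \<Longrightarrow> hinner H (x - y) u = 0"
    using projection_exists[OF assms xH] by blast
  have yH: "y \<in> hcarrier H" using y assms by auto
  have d: "x - y \<in> ominus H S" using y xH yH by (simp add: ominus_def closed_rules)
  have "hinner H (x - y) (x - y) = hinner H x (x - y) - cnj (hinner H (x - y) y)"
    using xH yH inner_commute[of y "x - y"] inner_diff_left[of x y "x - y"] by (simp add: closed_rules)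
  also have "\<dots> = 0" using d x y by (auto simp: ominus_def)
  finally show "x \<in> S" using inner_definite[of "x - y"] y(1) xH yH by (simp add: closed_rules)
next
  fix x assume "x \<in> S"
  then show "x \<in> ominus H (ominus H S)"
    using assms(1) inner_commute[of x] by (auto simp: ominus_def)
qed

end

text \<open>
  Completeness is transported along isometries. This makes the function spaces built from sequences
  complete, and also the range of a dilation.
\<close>

lemma hilbert_space_image:
  fixes H :: "'a::complex_vector hspace" and G :: "'b::complex_vector hspace"
  assumes H: "hilbert_space H" and G: "hcarrier G = U ` hcarrier H"
    and add: "\<And>x y. \<lbrakk>x \<in> hcarrier H; y \<in> hcarrier H\<rbrakk> \<Longrightarrow> U (x + y) = U x + U y"
    and scale: "\<And>c x. x \<in> hcarrier H \<Longrightarrow> U (c *\<^sub>C x) = c *\<^sub>C U x"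
    and inner: "\<And>x y. \<lbrakk>x \<in> hcarrier H; y \<in> hcarrier H\<rbrakk> \<Longrightarrow> hinner G (U x) (U y) = hinner H x y"
  shows "hilbert_space G"
proof -
  interpret hilbert_space H by fact
  have U0: "U 0 = 0" using scale[of 0 0] zero_closed by simp
  have Udiff: "U (x - y) = U x - U y" if "x \<in> hcarrier H" "y \<in> hcarrier H" for x y
    using add[of x "- y"] scale[of y "-1"] that by (simp add: closed_rules)
  have norm: "hnorm G (U x) = hnorm H x" if "x \<in> hcarrier H" for x
    using inner that by (simp add: hnorm_def)
  show ?thesis
  proof
    show "0 \<in> hcarrier G" using U0 zero_closed G by force
  next
    fix X :: "nat \<Rightarrow> 'b"
    assume X: "range X \<subseteq> hcarrier G"
      and C: "\<forall>e>0. \<exists>N. \<forall>i\<ge>N. \<forall>j\<ge>N. hnorm G (X i - X j) < e"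
    from X have "\<forall>n. \<exists>y\<in>hcarrier H. X n = U y" unfolding G by blast
    then obtain Y where Y: "\<And>n. Y n \<in> hcarrier H" "\<And>n. X n = U (Y n)" by metis
    have "hnorm G (X i - X j) = hnorm H (Y i - Y j)" for i j
      using Y by (simp add: Udiff[symmetric] norm closed_rules)
    then obtain y where y: "y \<in> hcarrier H" "(\<lambda>i. hnorm H (Y i - y)) \<longlonglongrightarrow> 0"
      using Cauchy_convergent[of Y] Y(1) C by auto
    moreover have "hnorm G (X i - U y) = hnorm H (Y i - y)" for i
      using Y y by (simp add: Udiff[symmetric] norm closed_rules)
    ultimately show "\<exists>x\<in>hcarrier G. (\<lambda>i. hnorm G (X i - x)) \<longlonglongrightarrow> 0"
      unfolding G by (intro bexI[of _ "U y"]) auto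
  next
    fix x assume x: "x \<in> hcarrier G" "hinner G x x = 0"
    then obtain y where y: "y \<in> hcarrier H" "x = U y" unfolding G by blast
    then have "y = 0" using inner_definite[of y] inner[of y y] x by simp
    then show "x = 0" using y U0 by simp
  qed (use G in \<open>auto simp: add[symmetric] scale[symmetric] inner closed_rules inner_linear inner_nonneg
        intro: inner_commute\<close>)
qed

text \<open>Polarisation.\<close>

lemma isometry_preserves_inner:
  assumes H: "hilbert_space H" and K: "hilbert_space K"
    and closed: "\<And>x. x \<in> hcarrier H \<Longrightarrow> U x \<in> hcarrier K"
    and add: "\<And>x y. \<lbrakk>x \<in> hcarrier H; y \<in> hcarrier H\<rbrakk> \<Longrightarrow> U (x + y) = U x + U y"
    and scale: "\<And>c x. x \<in> hcarrier H \<Longrightarrow> U (c *\<^sub>C x) = c *\<^sub>C U x"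
    and norm: "\<And>x. x \<in> hcarrier H \<Longrightarrow> hnorm K (U x) = hnorm H x"
    and xy: "x \<in> hcarrier H" "y \<in> hcarrier H"
  shows "hinner K (U x) (U y) = hinner H x y"
proof -
  interpret H: hilbert_space H by fact
  interpret K: hilbert_space K by fact
  have Re: "Re (hinner K (U x) (U y)) = Re (hinner H x y)" if "x \<in> hcarrier H" "y \<in> hcarrier H" for x y
    using H.norm_add_sq[OF that] K.norm_add_sq[OF closed closed, OF that] that
    by (simp add: norm H.closed_rules flip: add)
  have "Im (hinner K (U x) (U y)) = Im (hinner H x y)"
    using Re[of x "\<i> *\<^sub>C y"] xy closed
    by (simp add: H.closed_rules scale H.inner_scaleC_right K.inner_scaleC_right)
  with Re[OF xy] show ?thesis by (simp add: complex_eq_iff)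
qed

section \<open>Bounded operators and adjoints\<close>

lemma bounded_op_closed: "bounded_op H K A \<Longrightarrow> x \<in> hcarrier H \<Longrightarrow> A x \<in> hcarrier K"
  by (auto simp: bounded_op_def)

lemma bounded_op_add:
  "\<lbrakk>bounded_op H K A; x \<in> hcarrier H; y \<in> hcarrier H\<rbrakk> \<Longrightarrow> A (x + y) = A x + A y"
  by (auto simp: bounded_op_def)

lemma bounded_op_scaleC: "\<lbrakk>bounded_op H K A; x \<in> hcarrier H\<rbrakk> \<Longrightarrow> A (c *\<^sub>C x) = c *\<^sub>C A x"
  by (auto simp: bounded_op_def)

lemma bounded_op_bound:
  assumes "bounded_op H K A" "hilbert_space H"
  obtains C where "C > 0" "\<And>x. x \<in> hcarrier H \<Longrightarrow> hnorm K (A x) \<le> C * hnorm H x"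
proof -
  obtain C where C: "\<And>x. x \<in> hcarrier H \<Longrightarrow> hnorm K (A x) \<le> C * hnorm H x"
    using assms(1) unfolding bounded_op_def by blast
  have "hnorm K (A x) \<le> (\<bar>C\<bar> + 1) * hnorm H x" if "x \<in> hcarrier H" for x
    using order_trans[OF C[OF that] mult_right_mono[of C "\<bar>C\<bar> + 1" "hnorm H x"]]
      hilbert_space.norm_ge_0[OF assms(2) that] by simp
  then show thesis by (intro that[of "\<bar>C\<bar> + 1"]) auto
qed

lemma bounded_opI:
  assumes "\<And>x. x \<in> hcarrier H \<Longrightarrow> A x \<in> hcarrier K"
    and "\<And>x y. \<lbrakk>x \<in> hcarrier H; y \<in> hcarrier H\<rbrakk> \<Longrightarrow> A (x + y) = A x + A y"
    and "\<And>c x. x \<in> hcarrier H \<Longrightarrow> A (c *\<^sub>C x) = c *\<^sub>C A x"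
    and "\<And>x. x \<in> hcarrier H \<Longrightarrow> hnorm K (A x) \<le> C * hnorm H x"
  shows "bounded_op H K A"
  using assms unfolding bounded_op_def by blast

lemma bounded_op_diff:
  assumes "bounded_op H K A" "hilbert_space H" "x \<in> hcarrier H" "y \<in> hcarrier H"
  shows "A (x - y) = A x - A y"
proof -
  interpret hilbert_space H by fact
  show ?thesis
    using bounded_op_add[OF assms(1,3), of "- y"] bounded_op_scaleC[OF assms(1,4), of "-1"] assms(4)
    by (simp add: closed_rules)
qed

lemma bounded_op_zero: "bounded_op H K A \<Longrightarrow> hilbert_space H \<Longrightarrow> A 0 = 0"
  using bounded_op_scaleC[of H K A 0 0] by (simp add: hilbert_space.zero_closed)

lemma bounded_op_comp:
  assumes "hilbert_space H" "hilbert_space K" "bounded_op H K A" "bounded_op K L B"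
  shows "bounded_op H L (\<lambda>x. B (A x))"
proof -
  obtain C1 where C1: "C1 > 0" "\<And>x. x \<in> hcarrier H \<Longrightarrow> hnorm K (A x) \<le> C1 * hnorm H x"
    using bounded_op_bound[OF assms(3,1)] by blast
  obtain C2 where C2: "C2 > 0" "\<And>x. x \<in> hcarrier K \<Longrightarrow> hnorm L (B x) \<le> C2 * hnorm K x"
    using bounded_op_bound[OF assms(4,2)] by blast
  show ?thesis
  proof (rule bounded_opI)
    fix x assume x: "x \<in> hcarrier H"
    have "hnorm L (B (A x)) \<le> C2 * hnorm K (A x)"
      using C2 bounded_op_closed[OF assms(3) x] by blast
    also have "\<dots> \<le> C2 * (C1 * hnorm H x)" using C1 C2 x by (intro mult_left_mono) auto
    finally show "hnorm L (B (A x)) \<le> C2 * C1 * hnorm H x" by (simp add: mult.assoc)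
  qed (use assms in \<open>auto simp: bounded_op_closed bounded_op_add bounded_op_scaleC\<close>)
qed

lemma bounded_op_funpow:
  assumes "hilbert_space H" "bounded_op H H A"
  shows "bounded_op H H (A ^^ k)"
proof (induction k)
  case 0
  show ?case by (rule bounded_opI[where C = 1]) auto
next
  case (Suc k)
  show ?case using bounded_op_comp[OF assms(1,1) Suc assms(2)] by (simp add: comp_def)
qed

text \<open>Adjoints, power series of operators and point evaluations are all obtained from scalar forms
  through this lemma, so that infinite sums are only ever taken of scalars.\<close>

lemma bounded_form_representation:
  assumes H: "hilbert_space H" and K: "hilbert_space K" and C: "0 \<le> C"
    and add_left: "\<And>x y z. \<lbrakk>x \<in> hcarrier H; y \<in> hcarrier H; z \<in> hcarrier K\<rbrakk> \<Longrightarrow> F (x + y) z = F x z + F y z"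
    and scale_left: "\<And>c x z. \<lbrakk>x \<in> hcarrier H; z \<in> hcarrier K\<rbrakk> \<Longrightarrow> F (c *\<^sub>C x) z = c * F x z"
    and add_right: "\<And>x y z. \<lbrakk>x \<in> hcarrier K; y \<in> hcarrier K; z \<in> hcarrier H\<rbrakk> \<Longrightarrow> F z (x + y) = F z x + F z y"
    and scale_right: "\<And>c x z. \<lbrakk>x \<in> hcarrier K; z \<in> hcarrier H\<rbrakk> \<Longrightarrow> F z (c *\<^sub>C x) = cnj c * F z x"
    and bound: "\<And>x y. \<lbrakk>x \<in> hcarrier H; y \<in> hcarrier K\<rbrakk> \<Longrightarrow> cmod (F x y) \<le> C * hnorm H x * hnorm K y"
  shows "\<exists>A. bounded_op K H A \<and> (\<forall>x\<in>hcarrier H. \<forall>y\<in>hcarrier K. hinner H x (A y) = F x y) \<and>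
    (\<forall>y\<in>hcarrier K. hnorm H (A y) \<le> C * hnorm K y)"
proof -
  interpret H: hilbert_space H by fact
  interpret K: hilbert_space K by fact
  have "\<exists>v\<in>hcarrier H. \<forall>x\<in>hcarrier H. F x y = hinner H x v" if y: "y \<in> hcarrier K" for y
  proof (rule H.Riesz)
    show "\<And>x. x \<in> hcarrier H \<Longrightarrow> cmod (F x y) \<le> (C * hnorm K y) * hnorm H x"
      using bound y by (simp add: mult_ac)
  qed (use y in \<open>auto simp: add_left scale_left\<close>)
  then obtain A where A: "\<And>y. y \<in> hcarrier K \<Longrightarrow> A y \<in> hcarrier H"
    and AF: "\<And>x y. \<lbrakk>x \<in> hcarrier H; y \<in> hcarrier K\<rbrakk> \<Longrightarrow> F x y = hinner H x (A y)" by metis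
  have norm: "hnorm H (A y) \<le> C * hnorm K y" if "y \<in> hcarrier K" for y
    using that A C bound[OF _ that]
    by (intro H.norm_le_if_inner_le) (auto simp: AF[symmetric] mult_ac)
  have "bounded_op K H A"
  proof (rule bounded_opI)
    show "A (x + y) = A x + A y" if "x \<in> hcarrier K" "y \<in> hcarrier K" for x y
      by (rule H.eq_if_inner_eq)
         (use A that in \<open>simp_all add: AF[symmetric] add_right H.inner_linear H.closed_rules K.closed_rules\<close>)
    show "A (c *\<^sub>C x) = c *\<^sub>C A x" if "x \<in> hcarrier K" for c x
      by (rule H.eq_if_inner_eq)
         (use A that in \<open>simp_all add: AF[symmetric] scale_right H.inner_linear H.closed_rules K.closed_rules\<close>)
  qed (use A norm in auto)
  then show ?thesis using AF norm by auto
qed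

locale hilbert_op = H: hilbert_space H + K: hilbert_space K
  for H :: "'a::complex_vector hspace" and K :: "'b::complex_vector hspace" +
  fixes A :: "'a \<Rightarrow> 'b"
  assumes bounded: "bounded_op H K A"
begin

lemmas closed = bounded_op_closed[OF bounded]
lemmas add = bounded_op_add[OF bounded]
lemmas scaleC = bounded_op_scaleC[OF bounded]
lemmas diff = bounded_op_diff[OF bounded H.hilbert_space_axioms]

lemma adj_eq:
  assumes "x \<in> hcarrier H" "\<And>u. u \<in> hcarrier H \<Longrightarrow> hinner K (A u) y = hinner H u x"
  shows "adj H K A y = x"
  unfolding adj_def using assms by (intro the_equality) (auto intro: H.eq_if_inner_eq)

lemma adj_exists:
  "\<exists>B. bounded_op K H B \<and> (\<forall>y\<in>hcarrier K. adj H K A y = B y \<and>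
      (\<forall>u\<in>hcarrier H. hinner H u (B y) = hinner K (A u) y))"
proof -
  obtain C where C: "C > 0" "\<And>x. x \<in> hcarrier H \<Longrightarrow> hnorm K (A x) \<le> C * hnorm H x"
    using bounded_op_bound[OF bounded H.hilbert_space_axioms] by blast
  have bd: "cmod (hinner K (A x) y) \<le> C * hnorm H x * hnorm K y"
    if "x \<in> hcarrier H" "y \<in> hcarrier K" for x y
    using order_trans[OF K.Cauchy_Schwarz mult_right_mono[OF C(2)]] that by (simp add: closed)
  have "\<exists>B. bounded_op K H B \<and>
      (\<forall>x\<in>hcarrier H. \<forall>y\<in>hcarrier K. hinner H x (B y) = hinner K (A x) y) \<and>
      (\<forall>y\<in>hcarrier K. hnorm H (B y) \<le> C * hnorm K y)"
    by (rule bounded_form_representation[OF H.hilbert_space_axioms K.hilbert_space_axioms])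
       (use C bd in \<open>auto simp: closed add scaleC K.inner_linear H.closed_rules K.closed_rules\<close>)
  then obtain B where B: "bounded_op K H B"
      "\<And>x y. x \<in> hcarrier H \<Longrightarrow> y \<in> hcarrier K \<Longrightarrow> hinner H x (B y) = hinner K (A x) y" by blast
  then have "adj H K A y = B y" if "y \<in> hcarrier K" for y
    using that by (intro adj_eq) (auto simp: bounded_op_closed)
  with B show ?thesis by blast
qed

lemma adj_bounded: "bounded_op K H (adj H K A)"
proof -
  obtain B where "bounded_op K H B" and "\<And>y. y \<in> hcarrier K \<Longrightarrow> adj H K A y = B y"
    using adj_exists by blast
  then show ?thesis using K.closed_rules unfolding bounded_op_def image_subset_iff by metis
qed

lemma adj_closed: "y \<in> hcarrier K \<Longrightarrow> adj H K A y \<in> hcarrier H"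
  using adj_bounded by (rule bounded_op_closed)

lemma inner_adj: "\<lbrakk>u \<in> hcarrier H; y \<in> hcarrier K\<rbrakk> \<Longrightarrow> hinner H u (adj H K A y) = hinner K (A u) y"
  using adj_exists by auto

lemma inner_adj': "\<lbrakk>u \<in> hcarrier H; y \<in> hcarrier K\<rbrakk> \<Longrightarrow> hinner H (adj H K A y) u = hinner K y (A u)"
  using inner_adj[of u y] H.inner_commute[of "adj H K A y" u] K.inner_commute[of y "A u"]
  by (simp add: adj_closed closed)

lemma adj_norm_le:
  assumes "0 \<le> C" "\<And>x. x \<in> hcarrier H \<Longrightarrow> hnorm K (A x) \<le> C * hnorm H x" and y: "y \<in> hcarrier K"
  shows "hnorm H (adj H K A y) \<le> C * hnorm K y"
proof (rule H.norm_le_if_inner_le)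
  fix u assume u: "u \<in> hcarrier H"
  show "cmod (hinner H u (adj H K A y)) \<le> C * hnorm K y * hnorm H u"
    using order_trans[OF K.Cauchy_Schwarz[of "A u" y] mult_right_mono[OF assms(2)[OF u], of "hnorm K y"]]
      u y by (simp add: inner_adj closed mult_ac)
qed (use assms adj_closed in auto)

end

section \<open>The positive square root\<close>

text \<open>
  The Taylor coefficients of \<open>c(x) = 1 - sqrt (1 - x)\<close>, given by \<open>2 c = x + c\<^sup>2\<close>. In this form they are
  visibly nonnegative, and \<open>2 c(1) \<le> 1 + c(1)\<^sup>2\<close> for partial sums bounds their sum by \<open>1\<close>. The series
  therefore converges absolutely at every contraction.
\<close>

fun sqrt_coeff :: "nat \<Rightarrow> real" where
  "sqrt_coeff n = (if n = 0 then 0 else if n = 1 then 1/2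
     else (\<Sum>j\<in>{1..<n}. sqrt_coeff j * sqrt_coeff (n - j)) / 2)"

declare sqrt_coeff.simps [simp del]

lemma sqrt_coeff_0 [simp]: "sqrt_coeff 0 = 0"
  by (subst sqrt_coeff.simps) simp

lemma sqrt_coeff_nonneg: "0 \<le> sqrt_coeff n"
proof (induction n rule: less_induct)
  case (less n)
  then show ?case
    by (subst sqrt_coeff.simps) (auto intro!: sum_nonneg mult_nonneg_nonneg)
qed

lemma sqrt_coeff_convolution:
  "2 * sqrt_coeff n = (if n = 1 then 1 else 0) + (\<Sum>j\<le>n. sqrt_coeff j * sqrt_coeff (n - j))"
proof (cases "n \<le> 1")
  case True
  then consider "n = 0" | "n = 1" by linarith
  then show ?thesis
  proof cases
    case 2
    then show ?thesis using sqrt_coeff.simps[of 1] by simp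
  qed simp
next
  case False
  have "(\<Sum>j\<le>n. sqrt_coeff j * sqrt_coeff (n - j)) = (\<Sum>j\<in>{1..<n}. sqrt_coeff j * sqrt_coeff (n - j))"
    by (rule sum.mono_neutral_right) (auto simp: not_less Suc_le_eq)
  then show ?thesis using False by (subst sqrt_coeff.simps) simp
qed

lemma sqrt_coeff_sum_le: "(\<Sum>k\<le>n. sqrt_coeff k) \<le> 1"
proof (induction n)
  case (Suc n)
  let ?c = sqrt_coeff
  have "2 * (\<Sum>k\<le>Suc n. ?c k)
      = (\<Sum>k\<le>Suc n. if k = 1 then 1 else 0) + (\<Sum>k\<le>Suc n. \<Sum>j\<le>k. ?c j * ?c (k - j))"
    by (simp add: sum_distrib_left sqrt_coeff_convolution sum.distrib del: sum.atMost_Suc)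
  also have "(\<Sum>k\<le>Suc n. if k = 1 then 1 else 0) = (1::real)"
    by (simp add: sum.delta del: sum.atMost_Suc)
  also have "(\<Sum>k\<le>Suc n. \<Sum>j\<le>k. ?c j * ?c (k - j)) = (\<Sum>(i,j) | i + j \<le> Suc n. ?c i * ?c j)"
    by (rule sum.triangle_reindex_eq[symmetric])
  \<comment> \<open>The pairs with an entry \<open>Suc n\<close> drop out because the other entry is then \<open>0\<close>.\<close>
  also have "\<dots> = (\<Sum>(i,j) \<in> {(i,j). i + j \<le> Suc n} \<inter> {..n} \<times> {..n}. ?c i * ?c j)"
  proof (rule sum.mono_neutral_right)
    show "finite {(i, j). i + j \<le> Suc n}"
      by (rule finite_subset[of _ "{..Suc n} \<times> {..Suc n}"]) auto
    show "\<forall>x\<in>{(i, j). i + j \<le> Suc n} - {(i, j). i + j \<le> Suc n} \<inter> {..n} \<times> {..n}.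
        (case x of (i, j) \<Rightarrow> ?c i * ?c j) = 0"
    proof clarify
      fix i j assume *: "i + j \<le> Suc n" "(i, j) \<notin> {(i, j). i + j \<le> Suc n} \<inter> {..n} \<times> {..n}"
      then have "i = 0 \<or> j = 0" by auto
      then show "?c i * ?c j = 0" by auto
    qed
  qed auto
  also have "\<dots> \<le> (\<Sum>(i,j) \<in> {..n} \<times> {..n}. ?c i * ?c j)"
    by (rule sum_mono2) (auto simp: sqrt_coeff_nonneg)
  also have "\<dots> = (\<Sum>k\<le>n. ?c k) * (\<Sum>k\<le>n. ?c k)"
    by (simp add: sum_product sum.cartesian_product)
  also have "\<dots> \<le> 1 * 1" using Suc by (intro mult_mono) (auto intro: sum_nonneg sqrt_coeff_nonneg)
  finally show ?case by simp
qed simp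

lemma sqrt_coeff_summable: "summable sqrt_coeff" and sqrt_coeff_suminf_le: "suminf sqrt_coeff \<le> 1"
proof -
  have le: "(\<Sum>k<n. sqrt_coeff k) \<le> 1" for n
    using sqrt_coeff_nonneg by (intro order_trans[OF sum_mono2 sqrt_coeff_sum_le[of n]]) auto
  show "summable sqrt_coeff" using sqrt_coeff_nonneg le by (rule summableI_nonneg_bounded)
  then show "suminf sqrt_coeff \<le> 1" using le by (rule suminf_le_const)
qed

lemma infsum_nat_eq_suminf:
  fixes f :: "nat \<Rightarrow> 'a::real_normed_vector"
  shows "f summable_on UNIV \<Longrightarrow> infsum f UNIV = suminf f"
  using has_sum_imp_sums[OF has_sum_infsum] sums_unique by blast

text \<open>
  The product of two power series of an operator \<open>B\<close>, paired with vectors: \<open>g n\<close> stands for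
  \<open>\<langle>u, B\<^sup>n x\<rangle>\<close>.
\<close>

lemma suminf_shifted_convolution:
  fixes a b :: "nat \<Rightarrow> real" and g :: "nat \<Rightarrow> complex"
  assumes a: "summable a" "\<And>n. 0 \<le> a n" and b: "summable b" "\<And>n. 0 \<le> b n" and g: "\<And>n. cmod (g n) \<le> M"
  shows "(\<Sum>j. of_real (a j) * (\<Sum>k. of_real (b k) * g (j + k)))
    = (\<Sum>n. of_real (\<Sum>i\<le>n. a i * b (n - i)) * g n)"
proof -
  define f where "f = (\<lambda>(j,k). of_real (a j * b k) * g (j + k))"
  have M: "0 \<le> M" using g[of 0] norm_ge_zero order_trans by blast
  have sa: "a summable_on UNIV" and sb: "b summable_on UNIV"
    using a b by (auto intro!: norm_summable_imp_summable_on)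
  have "(\<lambda>(j,k). M * (a j * b k)) summable_on UNIV \<times> UNIV"
  proof (rule summable_on_SigmaI)
    show "((\<lambda>k. case (j, k) of (j, k) \<Rightarrow> M * (a j * b k)) has_sum (M * a j * infsum b UNIV)) UNIV" for j
      using has_sum_cmult_right[OF has_sum_infsum[OF sb], of "M * a j"] by (simp add: mult.assoc)
    show "(\<lambda>j. M * a j * infsum b UNIV) summable_on UNIV"
      using summable_on_cmult_left[OF summable_on_cmult_right[OF sa, of M], of "infsum b UNIV"] by simp
  qed (use M a b in auto)
  then have "(\<lambda>x. norm (f x)) summable_on UNIV \<times> UNIV"
  proof (rule Infinite_Sum.abs_summable_on_comparison_test')
    fix x :: "nat \<times> nat"
    show "norm (f x) \<le> (case x of (j, k) \<Rightarrow> M * (a j * b k))"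
      using mult_mono[OF order_refl g, of "a (fst x) * b (snd x)" "fst x + snd x"] a b M
      by (auto simp: f_def case_prod_beta norm_mult mult_ac)
  qed
  then have f: "f summable_on UNIV \<times> UNIV" by (rule abs_summable_summable)
  have row: "(\<lambda>k. f (j, k)) summable_on UNIV" for j
    using summable_on_SigmaD1[of "\<lambda>j k. f (j, k)" UNIV "\<lambda>_. UNIV" j] f by simp
  have inner: "(\<Sum>\<^sub>\<infinity>k. f (j, k)) = of_real (a j) * (\<Sum>k. of_real (b k) * g (j + k))" for j
  proof -
    have "summable (\<lambda>k. of_real (b k) * g (j + k))"
    proof (rule summable_comparison_test'[of "\<lambda>k. b k * M" 0])
      show "norm (of_real (b k) * g (j + k)) \<le> b k * M" for k
        using g b by (auto simp: norm_mult intro: mult_left_mono)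
    qed (use b in \<open>simp add: summable_mult2\<close>)
    then show ?thesis
      using infsum_nat_eq_suminf[OF row, of j] by (simp add: f_def suminf_mult mult.assoc)
  qed
  have "infsum f (UNIV \<times> UNIV) = (\<Sum>\<^sub>\<infinity>j. \<Sum>\<^sub>\<infinity>k. f (j, k))"
    using infsum_Sigma'_banach[of "\<lambda>j k. f (j, k)" UNIV "\<lambda>_. UNIV"] f by simp
  also have "\<dots> = (\<Sum>\<^sub>\<infinity>j. of_real (a j) * (\<Sum>k. of_real (b k) * g (j + k)))"
    by (simp add: inner)
  also have "\<dots> = (\<Sum>j. of_real (a j) * (\<Sum>k. of_real (b k) * g (j + k)))"
  proof (rule infsum_nat_eq_suminf)
    have "(\<lambda>j. \<Sum>\<^sub>\<infinity>k. f (j, k)) summable_on UNIV"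
      using summable_on_Sigma_banach[of "\<lambda>j k. f (j, k)" UNIV "\<lambda>_. UNIV"] f by simp
    then show "(\<lambda>j. of_real (a j) * (\<Sum>k. of_real (b k) * g (j + k))) summable_on UNIV" by (simp add: inner)
  qed
  finally have 1: "infsum f (UNIV \<times> UNIV) = (\<Sum>j. of_real (a j) * (\<Sum>k. of_real (b k) * g (j + k)))" .
  define h where "h = (\<lambda>(n, i). of_real (a i * b (n - i)) * g n)"
  have bij: "infsum f (UNIV \<times> UNIV) = infsum h (SIGMA n:UNIV. {..n})"
    and sum: "f summable_on (UNIV \<times> UNIV) \<longleftrightarrow> h summable_on (SIGMA n:UNIV. {..n})"
    by (rule infsum_reindex_bij_witness[where i = "\<lambda>(n, i). (i, n - i)" and j = "\<lambda>(j, k). (j + k, j)"];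
        auto simp: f_def h_def)
       (rule summable_on_reindex_bij_witness[where i = "\<lambda>(n, i). (i, n - i)" and j = "\<lambda>(j, k). (j + k, j)"];
        auto simp: f_def h_def)
  have h: "h summable_on (SIGMA n:UNIV. {..n})" using sum f by blast
  have inner': "(\<Sum>\<^sub>\<infinity>i\<in>{..n}. h (n, i)) = of_real (\<Sum>i\<le>n. a i * b (n - i)) * g n" for n
    by (simp add: h_def sum_distrib_right)
  have "infsum h (SIGMA n:UNIV. {..n}) = (\<Sum>\<^sub>\<infinity>n. \<Sum>\<^sub>\<infinity>i\<in>{..n}. h (n, i))"
    using infsum_Sigma'_banach[of "\<lambda>n i. h (n, i)" UNIV "\<lambda>n. {..n}"] h by simp
  also have "\<dots> = (\<Sum>\<^sub>\<infinity>n. of_real (\<Sum>i\<le>n. a i * b (n - i)) * g n)"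
    by (simp only: inner')
  also have "\<dots> = (\<Sum>n. of_real (\<Sum>i\<le>n. a i * b (n - i)) * g n)"
  proof (rule infsum_nat_eq_suminf)
    have "(\<lambda>n. \<Sum>\<^sub>\<infinity>i\<in>{..n}. h (n, i)) summable_on UNIV"
      using summable_on_Sigma_banach[of "\<lambda>n i. h (n, i)" UNIV "\<lambda>n. {..n}"] h by simp
    then show "(\<lambda>n. of_real (\<Sum>i\<le>n. a i * b (n - i)) * g n) summable_on UNIV" by (simp only: inner')
  qed
  finally show ?thesis using 1 bij by simp
qed

context hilbert_space
begin

lemma positive_op_closed: "positive_op H A \<Longrightarrow> x \<in> hcarrier H \<Longrightarrow> A x \<in> hcarrier H"
  by (auto simp: positive_op_def intro: bounded_op_closed)

text \<open>
  The form \<open>\<langle>A u, u\<rangle>\<close> is real at \<open>u = x + y\<close> and at \<open>u = x + \<i> y\<close>, which gives the imaginary and the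
  real part of the claim.
\<close>

lemma positive_op_selfadjoint:
  assumes A: "positive_op H A" and x: "x \<in> hcarrier H" and y: "y \<in> hcarrier H"
  shows "hinner H (A x) y = hinner H x (A y)"
proof -
  have b: "bounded_op H H A" and im: "\<And>u. u \<in> hcarrier H \<Longrightarrow> Im (hinner H (A u) u) = 0"
    using A by (auto simp: positive_op_def)
  note cl = bounded_op_closed[OF b]
  have "Im (hinner H (A x) y) + Im (hinner H (A y) x) = 0"
    using im[of "x + y"] im[OF x] im[OF y] x y by (simp add: bounded_op_add[OF b] cl inner_linear closed_rules)
  moreover have "Re (hinner H (A x) y) = Re (hinner H (A y) x)"
    using im[of "x + \<i> *\<^sub>C y"] im[OF x] im[OF y] x y
    by (simp add: bounded_op_add[OF b] bounded_op_scaleC[OF b] cl inner_linear closed_rules)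
  ultimately show ?thesis
    using inner_commute[of x "A y"] x y cl by (simp add: complex_eq_iff eq_neg_iff_add_eq_0)
qed

text \<open>Cauchy--Schwarz for the form \<open>\<langle>A x, y\<rangle>\<close> at \<open>y = A x\<close>.\<close>

lemma positive_op_norm_le:
  assumes A: "positive_op H A" and le: "\<And>x. x \<in> hcarrier H \<Longrightarrow> Re (hinner H (A x) x) \<le> (hnorm H x)\<^sup>2"
    and x: "x \<in> hcarrier H"
  shows "hnorm H (A x) \<le> hnorm H x"
proof -
  have b: "bounded_op H H A" and pos: "\<And>u. u \<in> hcarrier H \<Longrightarrow> 0 \<le> Re (hinner H (A u) u)"
    using A by (auto simp: positive_op_def)
  note cl = bounded_op_closed[OF b]
  have gen: "(cmod (hinner H (A x) y))\<^sup>2 \<le> Re (hinner H (A x) x) * Re (hinner H (A y) y)"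
    if y: "y \<in> hcarrier H" for y
  proof (rule semi_inner_Cauchy_Schwarz)
    fix t
    have "hinner H (A (t *\<^sub>C y)) x = cnj (hinner H (A x) (t *\<^sub>C y))"
      using positive_op_selfadjoint[OF A, of "t *\<^sub>C y" x] inner_commute[of "t *\<^sub>C y" "A x"] x y cl
      by (simp add: closed_rules)
    then have "Re (hinner H (A (x + t *\<^sub>C y)) (x + t *\<^sub>C y))
      = Re (hinner H (A x) x) + 2 * Re (hinner H (A x) (t *\<^sub>C y)) + Re (hinner H (A (t *\<^sub>C y)) (t *\<^sub>C y))"
      using x y by (simp add: bounded_op_add[OF b] cl inner_add_left inner_add_right closed_rules)
    moreover have "Re (hinner H (A (t *\<^sub>C y)) (t *\<^sub>C y)) = (cmod t)\<^sup>2 * Re (hinner H (A y) y)"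
    proof -
      have "hinner H (A (t *\<^sub>C y)) (t *\<^sub>C y) = (t * cnj t) * hinner H (A y) y"
        using y by (simp add: bounded_op_scaleC[OF b] cl inner_linear closed_rules)
      then show ?thesis by (simp add: complex_norm_square[symmetric] flip: of_real_power)
    qed
    ultimately show "0 \<le> Re (hinner H (A x) x) + 2 * Re (cnj t * hinner H (A x) y)
        + (cmod t)\<^sup>2 * Re (hinner H (A y) y)"
      using pos[of "x + t *\<^sub>C y"] x y by (simp add: closed_rules cl inner_scaleC_right)
  qed (use pos x y in auto)
  have "(cmod (hinner H (A x) (A x)))\<^sup>2 = ((hnorm H (A x))\<^sup>2)\<^sup>2"
    using x cl by (simp add: inner_self norm_power)
  then have "((hnorm H (A x))\<^sup>2)\<^sup>2 \<le> Re (hinner H (A x) x) * Re (hinner H (A (A x)) (A x))"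
    using gen[OF cl[OF x]] by simp
  also have "\<dots> \<le> (hnorm H x)\<^sup>2 * (hnorm H (A x))\<^sup>2"
    using le pos x cl by (intro mult_mono) auto
  finally have "(hnorm H (A x))\<^sup>2 * (hnorm H (A x))\<^sup>2 \<le> (hnorm H x)\<^sup>2 * (hnorm H (A x))\<^sup>2"
    by (simp add: power2_eq_square[of "(hnorm H (A x))\<^sup>2"])
  then have "(hnorm H (A x))\<^sup>2 \<le> (hnorm H x)\<^sup>2 \<or> (hnorm H (A x))\<^sup>2 = 0"
    by (metis mult_right_le_imp_le zero_le_power2 less_eq_real_def)
  then show ?thesis using x cl by (auto simp: power2_le_iff_abs_le)
qed

end

context hilbert_space
begin

text \<open>
  The operator \<open>X = \<Sum>\<^sub>k c\<^sub>k B\<^sup>k\<close>, with the coefficients \<open>sqrt_coeff\<close>, satisfies \<open>2 X = B + X\<^sup>2\<close>, so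
  \<open>(1 - X)\<^sup>2 = 1 - B\<close>. As \<open>X\<close> is a self-adjoint contraction, \<open>1 - X\<close> is positive.
\<close>

lemma sqrt_of_id_minus:
  assumes B: "positive_op H B" and le: "\<And>x. x \<in> hcarrier H \<Longrightarrow> Re (hinner H (B x) x) \<le> (hnorm H x)\<^sup>2"
  shows "\<exists>S. positive_op H S \<and> (\<forall>x\<in>hcarrier H. S (S x) = x - B x)"
proof -
  let ?c = "\<lambda>k. complex_of_real (sqrt_coeff k)"
  have b: "bounded_op H H B" using B by (simp add: positive_op_def)
  note bk = bounded_op_funpow[OF hilbert_space_axioms b]
  note cl = bounded_op_closed[OF bk]
  have Bk_norm: "hnorm H ((B ^^ k) x) \<le> hnorm H x" if x: "x \<in> hcarrier H" for k x
  proof (induction k)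
    case (Suc k)
    show ?case using order_trans[OF positive_op_norm_le[OF B le cl[OF x, of k]] Suc] by simp
  qed simp
  have Bk_inner: "cmod (hinner H u ((B ^^ k) x)) \<le> hnorm H u * hnorm H x"
    if "u \<in> hcarrier H" "x \<in> hcarrier H" for k u x
    using order_trans[OF Cauchy_Schwarz mult_left_mono[OF Bk_norm]] that cl by simp
  have Bk_adj: "hinner H ((B ^^ k) u) x = hinner H u ((B ^^ k) x)"
    if "u \<in> hcarrier H" "x \<in> hcarrier H" for k u x
    using that
  proof (induction k arbitrary: x)
    case (Suc k)
    have "hinner H ((B ^^ Suc k) u) x = hinner H ((B ^^ k) u) (B x)"
      using positive_op_selfadjoint[OF B cl[OF Suc.prems(1)] Suc.prems(2), of k] by simp
    also have "\<dots> = hinner H u ((B ^^ k) (B x))"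
      using Suc bounded_op_closed[OF b] by simp
    finally show ?case by (simp add: funpow_swap1)
  qed simp
  have norm_summable: "summable (\<lambda>k. norm (?c k * hinner H u ((B ^^ k) x)))"
    and norm_suminf: "(\<Sum>k. norm (?c k * hinner H u ((B ^^ k) x))) \<le> hnorm H u * hnorm H x"
    if ux: "u \<in> hcarrier H" "x \<in> hcarrier H" for u x
  proof -
    let ?g = "\<lambda>k. sqrt_coeff k * (hnorm H u * hnorm H x)"
    have g: "summable ?g" using sqrt_coeff_summable by (rule summable_mult2)
    have le': "norm (?c k * hinner H u ((B ^^ k) x)) \<le> ?g k" for k
      using Bk_inner[OF ux] sqrt_coeff_nonneg[of k] by (simp add: norm_mult mult_left_mono)
    show s: "summable (\<lambda>k. norm (?c k * hinner H u ((B ^^ k) x)))"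
      using le' by (intro summable_comparison_test'[OF g, of 0]) simp
    have "(\<Sum>k. norm (?c k * hinner H u ((B ^^ k) x))) \<le> suminf ?g"
      using le' s g by (rule suminf_le)
    also have "\<dots> = suminf sqrt_coeff * (hnorm H u * hnorm H x)"
      using suminf_mult2[OF sqrt_coeff_summable] by simp
    also have "\<dots> \<le> 1 * (hnorm H u * hnorm H x)"
      using sqrt_coeff_suminf_le ux by (intro mult_right_mono) auto
    finally show "(\<Sum>k. norm (?c k * hinner H u ((B ^^ k) x))) \<le> hnorm H u * hnorm H x" by simp
  qed
  note summ = summable_norm_cancel[OF norm_summable]
  define F where "F u x = (\<Sum>k. ?c k * hinner H u ((B ^^ k) x))" for u x
  have "\<exists>X. bounded_op H H X \<and> (\<forall>u\<in>hcarrier H. \<forall>x\<in>hcarrier H. hinner H u (X x) = F u x) \<and>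
      (\<forall>x\<in>hcarrier H. hnorm H (X x) \<le> 1 * hnorm H x)"
  proof (rule bounded_form_representation[OF hilbert_space_axioms hilbert_space_axioms])
    fix x y z assume "x \<in> hcarrier H" "y \<in> hcarrier H" "z \<in> hcarrier H"
    then show "F (x + y) z = F x z + F y z" "F z (x + y) = F z x + F z y"
      by (auto simp: F_def suminf_add summ closed_rules inner_linear cl bounded_op_add[OF bk] algebra_simps
          intro!: arg_cong[where f = suminf])
  next
    fix c x z assume *: "x \<in> hcarrier H" "z \<in> hcarrier H"
    have "F (c *\<^sub>C x) z = (\<Sum>k. c * (?c k * hinner H x ((B ^^ k) z)))"
      using * by (simp add: F_def closed_rules inner_linear cl mult_ac)
    then show "F (c *\<^sub>C x) z = c * F x z" using * by (simp add: F_def suminf_mult summ)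
    have "F z (c *\<^sub>C x) = (\<Sum>k. cnj c * (?c k * hinner H z ((B ^^ k) x)))"
      using * by (simp add: F_def closed_rules inner_linear cl bounded_op_scaleC[OF bk] mult_ac)
    then show "F z (c *\<^sub>C x) = cnj c * F z x" using * by (simp add: F_def suminf_mult summ)
  next
    fix x y assume xy: "x \<in> hcarrier H" "y \<in> hcarrier H"
    show "cmod (F x y) \<le> 1 * hnorm H x * hnorm H y"
      using order_trans[OF summable_norm[OF norm_summable[OF xy]] norm_suminf[OF xy]] by (simp add: F_def)
  qed simp
  then obtain X where X: "bounded_op H H X"
    and XF: "\<And>u x. \<lbrakk>u \<in> hcarrier H; x \<in> hcarrier H\<rbrakk> \<Longrightarrow> hinner H u (X x) = F u x"
    and Xn: "\<And>x. x \<in> hcarrier H \<Longrightarrow> hnorm H (X x) \<le> hnorm H x" by auto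
  note Xc = bounded_op_closed[OF X]
  have X_adj: "hinner H (X u) x = hinner H u (X x)" if ux: "u \<in> hcarrier H" "x \<in> hcarrier H" for u x
  proof -
    have "hinner H (X u) x = cnj (F x u)"
      using inner_commute[of "X u" x] ux Xc by (simp add: XF)
    also have "\<dots> = (\<Sum>k. cnj (?c k * hinner H x ((B ^^ k) u)))"
      unfolding F_def using bounded_linear.suminf[OF bounded_linear_cnj summ] ux by simp
    also have "\<dots> = F u x"
      unfolding F_def using ux inner_commute[of _ x] cl Bk_adj
      by (intro arg_cong[where f = suminf] ext) (simp add: inner_commute[of u] flip: Bk_adj)
    finally show ?thesis using ux by (simp add: XF)
  qed
  define S where "S x = x - X x" for x
  have "bounded_op H H S"
  proof (rule bounded_opI)
    fix x assume x: "x \<in> hcarrier H"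
    show "S x \<in> hcarrier H" using x Xc by (simp add: S_def closed_rules)
    show "hnorm H (S x) \<le> 2 * hnorm H x"
      using norm_triangle[of x "- X x"] Xn[OF x] x Xc by (simp add: S_def closed_rules)
  qed (auto simp: S_def bounded_op_add[OF X] bounded_op_scaleC[OF X] scaleC_diff_right)
  moreover have "Im (hinner H (S x) x) = 0 \<and> Re (hinner H (S x) x) \<ge> 0" if x: "x \<in> hcarrier H" for x
  proof
    have "hinner H (X x) x = cnj (hinner H (X x) x)"
      using inner_commute[of "X x" x] X_adj[OF x x] x Xc by simp
    from arg_cong[OF this, of Im] show "Im (hinner H (S x) x) = 0"
      using x Xc by (simp add: S_def inner_linear inner_self)
    have "Re (hinner H (X x) x) \<le> hnorm H (X x) * hnorm H x"
      using Cauchy_Schwarz[OF Xc[OF x] x] complex_Re_le_cmod order_trans by blast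
    also have "\<dots> \<le> hnorm H x * hnorm H x" using Xn x by (intro mult_right_mono) auto
    finally show "Re (hinner H (S x) x) \<ge> 0"
      using x Xc by (simp add: S_def inner_linear inner_self power2_eq_square)
  qed
  moreover have "S (S x) = x - B x" if x: "x \<in> hcarrier H" for x
  proof (rule eq_if_inner_eq)
    show "S (S x) \<in> hcarrier H" "x - B x \<in> hcarrier H"
      using x Xc bounded_op_closed[OF b] by (simp_all add: S_def closed_rules)
    fix u assume u: "u \<in> hcarrier H"
    let ?\<gamma> = "\<lambda>n. hinner H u ((B ^^ n) x)"
    have 1: "hinner H u (X (X x)) = (\<Sum>j. ?c j * (\<Sum>k. ?c k * ?\<gamma> (j + k)))"
    proof -
      have "hinner H u (X (X x)) = (\<Sum>j. ?c j * hinner H (X u) ((B ^^ j) x))"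
        using x u Xc X_adj[of u "X x"] by (simp add: XF F_def)
      also have "\<dots> = (\<Sum>j. ?c j * (\<Sum>k. ?c k * ?\<gamma> (j + k)))"
      proof (intro arg_cong[where f = suminf] ext arg_cong2[where f = "(*)"] refl)
        fix j
        have "hinner H (X u) ((B ^^ j) x) = F u ((B ^^ j) x)"
          using X_adj[OF u cl[OF x]] u x cl by (simp add: XF)
        also have "(B ^^ k) ((B ^^ j) x) = (B ^^ (j + k)) x" for k
          by (metis add.commute comp_apply funpow_add)
        then have "F u ((B ^^ j) x) = (\<Sum>k. ?c k * ?\<gamma> (j + k))" by (simp add: F_def)
        finally show "hinner H (X u) ((B ^^ j) x) = (\<Sum>k. ?c k * ?\<gamma> (j + k))" .
      qed
      finally show ?thesis .
    qed
    also have "\<dots> = (\<Sum>n. of_real (\<Sum>i\<le>n. sqrt_coeff i * sqrt_coeff (n - i)) * ?\<gamma> n)"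
      using Bk_inner[OF u x] by (intro suminf_shifted_convolution sqrt_coeff_summable sqrt_coeff_nonneg)
    also have "\<dots> = (\<Sum>n. 2 * (?c n * ?\<gamma> n) - (if n = 1 then ?\<gamma> n else 0))"
    proof (intro arg_cong[where f = suminf] ext)
      fix n
      have *: "(\<Sum>i\<le>n. sqrt_coeff i * sqrt_coeff (n - i)) = 2 * sqrt_coeff n - (if n = 1 then 1 else 0)"
        using sqrt_coeff_convolution[of n] by simp
      show "of_real (\<Sum>i\<le>n. sqrt_coeff i * sqrt_coeff (n - i)) * ?\<gamma> n
          = 2 * (?c n * ?\<gamma> n) - (if n = 1 then ?\<gamma> n else 0)"
        unfolding * by (cases "n = 1") (simp_all add: algebra_simps)
    qed
    also have "\<dots> = 2 * F u x - hinner H u (B x)"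
    proof -
      have 1: "(\<lambda>n. if n = 1 then ?\<gamma> n else 0) sums ?\<gamma> 1" by (rule sums_single)
      have 2: "(\<lambda>n. 2 * (?c n * ?\<gamma> n)) sums (2 * F u x)"
        unfolding F_def by (intro sums_mult summable_sums summ u x)
      show ?thesis using sums_unique[OF sums_diff[OF 2 1]] by simp
    qed
    finally have "hinner H u (X (X x)) = 2 * hinner H u (X x) - hinner H u (B x)"
      using u x by (simp add: XF)
    then show "hinner H u (S (S x)) = hinner H u (x - B x)"
      using u x Xc bounded_op_closed[OF b]
      by (simp add: S_def bounded_op_diff[OF X hilbert_space_axioms] closed_rules inner_linear)
  qed
  ultimately show ?thesis unfolding positive_op_def by blast
qed

text \<open>
  With \<open>C\<close> a bound of \<open>A\<close>, the operator \<open>B = 1 - A / C\<close> lies between \<open>0\<close> and \<open>1\<close>, and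
  \<open>A = C (1 - B)\<close>.
\<close>

lemma positive_sqrt_exists:
  assumes A: "positive_op H A"
  shows "\<exists>S. positive_op H S \<and> (\<forall>x\<in>hcarrier H. S (S x) = A x)"
proof -
  have b: "bounded_op H H A" and pos: "\<And>u. u \<in> hcarrier H \<Longrightarrow> 0 \<le> Re (hinner H (A u) u)"
    and im: "\<And>u. u \<in> hcarrier H \<Longrightarrow> Im (hinner H (A u) u) = 0"
    using A by (auto simp: positive_op_def)
  note cl = bounded_op_closed[OF b]
  obtain C where C: "C > 0" "\<And>x. x \<in> hcarrier H \<Longrightarrow> hnorm H (A x) \<le> C * hnorm H x"
    using bounded_op_bound[OF b hilbert_space_axioms] by blast
  define B where "B x = x - complex_of_real (1 / C) *\<^sub>C A x" for x
  have Bx: "hinner H (B x) x = of_real ((hnorm H x)\<^sup>2 - Re (hinner H (A x) x) / C)"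
    if x: "x \<in> hcarrier H" for x
    using x cl im[OF x] by (simp add: B_def inner_linear closed_rules inner_self complex_eq_iff)
  have "positive_op H B"
    unfolding positive_op_def
  proof (intro conjI ballI)
    show "bounded_op H H B"
    proof (rule bounded_opI)
      fix x assume x: "x \<in> hcarrier H"
      show "B x \<in> hcarrier H" using x cl by (simp add: B_def closed_rules)
      have "hnorm H (A x) / C \<le> hnorm H x" using C x by (simp add: field_simps)
      then show "hnorm H (B x) \<le> 2 * hnorm H x"
        using norm_triangle[of x "- (complex_of_real (1 / C) *\<^sub>C A x)"] x cl C(1)
        by (simp add: B_def closed_rules norm_scaleC norm_divide)
    qed (auto simp: B_def bounded_op_add[OF b] bounded_op_scaleC[OF b] scaleC_diff_right scaleC_add_right
        mult.commute)
    fix x assume x: "x \<in> hcarrier H"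
    have "Re (hinner H (A x) x) \<le> hnorm H (A x) * hnorm H x"
      using Cauchy_Schwarz[OF cl[OF x] x] complex_Re_le_cmod order_trans by blast
    also have "\<dots> \<le> (C * hnorm H x) * hnorm H x" using C x by (intro mult_right_mono) auto
    finally have "Re (hinner H (A x) x) / C \<le> (hnorm H x)\<^sup>2"
      using C(1) by (simp add: field_simps power2_eq_square)
    then show "Re (hinner H (B x) x) \<ge> 0" by (simp add: Bx x)
    show "Im (hinner H (B x) x) = 0" by (simp add: Bx x)
  qed
  moreover have "Re (hinner H (B x) x) \<le> (hnorm H x)\<^sup>2" if "x \<in> hcarrier H" for x
    using pos[OF that] C(1) by (simp add: Bx that)
  ultimately obtain S where S: "positive_op H S" "\<And>x. x \<in> hcarrier H \<Longrightarrow> S (S x) = x - B x"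
    using sqrt_of_id_minus by blast
  have Sb: "bounded_op H H S" using S(1) by (simp add: positive_op_def)
  define r where "r = complex_of_real (sqrt C)"
  have rr: "r * r = of_real C" using C(1) by (simp add: r_def flip: of_real_mult)
  have "positive_op H (\<lambda>x. r *\<^sub>C S x)"
    unfolding positive_op_def
  proof (intro conjI ballI)
    obtain D where D: "D > 0" "\<And>x. x \<in> hcarrier H \<Longrightarrow> hnorm H (S x) \<le> D * hnorm H x"
      using bounded_op_bound[OF Sb hilbert_space_axioms] by blast
    show "bounded_op H H (\<lambda>x. r *\<^sub>C S x)"
    proof (rule bounded_opI)
      fix x assume x: "x \<in> hcarrier H"
      show "hnorm H (r *\<^sub>C S x) \<le> (cmod r * D) * hnorm H x"
        using mult_left_mono[OF D(2)[OF x], of "cmod r"] x bounded_op_closed[OF Sb]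
        by (simp add: norm_scaleC mult.assoc)
    qed (auto simp: bounded_op_add[OF Sb] bounded_op_scaleC[OF Sb] bounded_op_closed[OF Sb]
        scaleC_add_right mult.commute closed_rules)
    fix x assume x: "x \<in> hcarrier H"
    then show "Im (hinner H (r *\<^sub>C S x) x) = 0" "Re (hinner H (r *\<^sub>C S x) x) \<ge> 0"
      using S(1) C(1) bounded_op_closed[OF Sb]
      by (auto simp: positive_op_def inner_linear r_def)
  qed
  moreover have "r *\<^sub>C S (r *\<^sub>C S x) = A x" if x: "x \<in> hcarrier H" for x
    using x S(2)[OF x] C(1)
    by (simp add: bounded_op_scaleC[OF Sb] bounded_op_closed[OF Sb] rr B_def flip: of_real_mult)
  ultimately show ?thesis by (intro exI[of _ "\<lambda>x. r *\<^sub>C S x"]) auto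
qed

lemma op_sqrt_properties:
  assumes "positive_op H A"
  shows "positive_op H (op_sqrt H A)" "\<And>x. x \<in> hcarrier H \<Longrightarrow> op_sqrt H A (op_sqrt H A x) = A x"
  using someI_ex[OF positive_sqrt_exists[OF assms]] unfolding op_sqrt_def by auto

end

section \<open>The coefficients of the Bergman kernels\<close>

text \<open>The coefficients of \<open>(1 - x)\<^bsup>-m\<^esup>\<close>.\<close>

definition bergman_coeff :: "nat \<Rightarrow> nat \<Rightarrow> real" where
  "bergman_coeff m k = real ((m + k - 1) choose k)"

lemma bergman_coeff_0: "bergman_coeff 0 k = (if k = 0 then 1 else 0)"
  by (cases k) (simp_all add: bergman_coeff_def)

lemma bergman_coeff_at_0 [simp]: "bergman_coeff m 0 = 1"
  by (simp add: bergman_coeff_def)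

lemma bergman_coeff_nonneg [simp]: "0 \<le> bergman_coeff m k"
  by (simp add: bergman_coeff_def)

lemma bergman_coeff_pos: "m \<ge> 1 \<Longrightarrow> 0 < bergman_coeff m k"
  by (simp add: bergman_coeff_def)

lemma bergman_coeff_1: "bergman_coeff 1 k = 1"
  by (simp add: bergman_coeff_def)

text \<open>A factor \<open>1 / (1 - x)\<close> turns coefficients into their partial sums.\<close>

lemma bergman_coeff_Suc: "bergman_coeff (Suc m) k = (\<Sum>i\<le>k. bergman_coeff m i)"
proof (induction k)
  case (Suc k)
  have "(m + Suc k) choose Suc k = ((m + k) choose k) + ((m + k) choose Suc k)" by simp
  then have "bergman_coeff (Suc m) (Suc k) = bergman_coeff (Suc m) k + bergman_coeff m (Suc k)"
    by (simp add: bergman_coeff_def)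
  with Suc show ?case by simp
qed simp

lemma bergman_coeff_mono: "m \<ge> 1 \<Longrightarrow> j \<le> k \<Longrightarrow> bergman_coeff m j \<le> bergman_coeff m k"
  by (cases m) (auto simp: bergman_coeff_Suc intro!: sum_mono2)

lemma bergman_coeff_summable:
  assumes "0 \<le> x" "x < (1::real)"
  shows "summable (\<lambda>k. bergman_coeff m k * x ^ k)"
proof (induction m)
  case 0
  show ?case by (rule summable_finite[of "{0}"]) (auto simp: bergman_coeff_0)
next
  case (Suc m)
  have "summable (\<lambda>k. \<Sum>i\<le>k. (bergman_coeff m i * x ^ i) * x ^ (k - i))"
    using assms Suc by (intro summable_Cauchy_product) (auto intro: summable_geometric)
  also have "(\<lambda>k. \<Sum>i\<le>k. (bergman_coeff m i * x ^ i) * x ^ (k - i)) = (\<lambda>k. bergman_coeff (Suc m) k * x ^ k)"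
    by (auto simp: bergman_coeff_Suc sum_distrib_right mult.assoc intro!: sum.cong simp flip: power_add)
  finally show ?case .
qed

lemma bergman_coeff_sums:
  assumes "cmod x < 1"
  shows "(\<lambda>k. of_real (bergman_coeff m k) * x ^ k) sums (1 / (1 - x) ^ m)"
proof (induction m)
  case 0
  have "(\<lambda>k. of_real (bergman_coeff 0 k) * x ^ k) = (\<lambda>k. if k = 0 then 1 else 0)"
    by (auto simp: bergman_coeff_0)
  then show ?case using sums_single[of 0 "\<lambda>_. 1::complex"] by simp
next
  case (Suc m)
  have "(\<lambda>k. \<Sum>i\<le>k. (of_real (bergman_coeff m i) * x ^ i) * x ^ (k - i)) sums
      ((\<Sum>k. of_real (bergman_coeff m k) * x ^ k) * (\<Sum>k. x ^ k))"
    using assms bergman_coeff_summable[of "cmod x" m]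
    by (intro Cauchy_product_sums) (auto simp: norm_mult norm_power intro: summable_geometric)
  moreover have "(\<lambda>k. \<Sum>i\<le>k. (of_real (bergman_coeff m i) * x ^ i) * x ^ (k - i))
      = (\<lambda>k. of_real (bergman_coeff (Suc m) k) * x ^ k)"
    by (auto simp: bergman_coeff_Suc sum_distrib_right mult.assoc intro!: sum.cong simp flip: power_add)
  moreover have "(\<Sum>k. of_real (bergman_coeff m k) * x ^ k) = 1 / (1 - x) ^ m"
    using sums_unique[OF Suc] by simp
  ultimately show ?case using suminf_geometric[OF assms] by (simp add: mult.commute)
qed

text \<open>The partial sums are \<open>\<Sum>i<N. w i * (t i - t N)\<close>. They are at most \<open>S\<close>, and at least
  \<open>\<Sum>i<M. w i * (t i - t N)\<close> for every \<open>M \<le> N\<close>, which tends to \<open>\<Sum>i<M. w i * t i\<close> as \<open>N\<close> grows.\<close>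

lemma sums_by_parts:
  fixes w t :: "nat \<Rightarrow> real"
  assumes w: "\<And>i. 0 \<le> w i" and t: "decseq t" "t \<longlonglongrightarrow> 0" and S: "(\<lambda>i. w i * t i) sums S"
  shows "(\<lambda>k. (\<Sum>i\<le>k. w i) * (t k - t (Suc k))) sums S"
proof -
  let ?u = "\<lambda>k. (\<Sum>i\<le>k. w i) * (t k - t (Suc k))"
  have t0: "0 \<le> t k" for k using decseq_ge[OF t] .
  have u0: "0 \<le> ?u k" for k
    using decseqD[OF t(1), of k "Suc k"] w by (simp add: sum_nonneg)
  have partial: "(\<Sum>k<N. ?u k) = (\<Sum>i<N. w i * (t i - t N))" for N
  proof (induction N)
    case (Suc N)
    have "(\<Sum>i<Suc N. w i * (t i - t (Suc N)))
        = (\<Sum>i<N. w i * (t i - t N) + w i * (t N - t (Suc N))) + w N * (t N - t (Suc N))"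
      by (simp add: algebra_simps)
    also have "\<dots> = (\<Sum>i<N. w i * (t i - t N)) + (\<Sum>i\<le>N. w i) * (t N - t (Suc N))"
      by (simp add: sum.distrib sum_distrib_right distrib_right flip: lessThan_Suc_atMost)
    finally show ?case using Suc by simp
  qed simp
  have le_S: "(\<Sum>i<N. w i * t i) \<le> S" for N
    using sum_le_suminf[OF sums_summable[OF S], of "{..<N}"] sums_unique[OF S] w t0 by simp
  have "(\<Sum>k<N. ?u k) \<le> S" for N
  proof -
    have "(\<Sum>i<N. w i * (t i - t N)) \<le> (\<Sum>i<N. w i * t i)"
      using w t0 by (intro sum_mono mult_left_mono) auto
    then show ?thesis using partial le_S[of N] by simp
  qed
  then have u: "summable ?u" and "suminf ?u \<le> S"
    using summableI_nonneg_bounded[of ?u, OF u0] suminf_le_const by blast+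
  moreover have "S \<le> suminf ?u"
  proof (rule LIMSEQ_le_const2[OF S[unfolded sums_def]], intro exI allI impI)
    fix M :: nat
    show "(\<Sum>i<M. w i * t i) \<le> suminf ?u"
    proof (rule LIMSEQ_le_const2)
      show "(\<lambda>N. \<Sum>i<M. w i * (t i - t N)) \<longlonglongrightarrow> (\<Sum>i<M. w i * t i)"
        using t(2) by (auto intro!: tendsto_eq_intros)
      have "(\<Sum>i<M. w i * (t i - t N)) \<le> suminf ?u" if "M \<le> N" for N
      proof -
        have "(\<Sum>i<M. w i * (t i - t N)) \<le> (\<Sum>i<N. w i * (t i - t N))"
          using that w decseqD[OF t(1)] by (intro sum_mono2) (auto intro!: mult_nonneg_nonneg)
        also have "\<dots> \<le> suminf ?u" using sum_le_suminf[OF u, of "{..<N}"] u0 partial[of N] by simp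
        finally show ?thesis .
      qed
      then show "\<exists>N. \<forall>n\<ge>N. (\<Sum>i<M. w i * (t i - t n)) \<le> suminf ?u" by blast
    qed
  qed
  ultimately show ?thesis by (simp add: sums_iff)
qed

fun backward_diff :: "nat \<Rightarrow> (nat \<Rightarrow> real) \<Rightarrow> nat \<Rightarrow> real" where
  "backward_diff 0 s = s"
| "backward_diff (Suc m) s = (\<lambda>k. backward_diff m s k - backward_diff m s (Suc k))"

lemma backward_diff_eq:
  "backward_diff m s k = (\<Sum>j\<le>m. (-1) ^ j * real (m choose j) * s (k + j))"
proof (induction m arbitrary: k)
  case (Suc m)
  let ?f = "\<lambda>m k j. (-1) ^ j * real (m choose j) * s (k + j)"
  have "(\<Sum>j\<le>Suc m. ?f (Suc m) k j) = s k + (\<Sum>j\<le>m. ?f (Suc m) k (Suc j))"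
    by (simp add: sum.atMost_Suc_shift del: sum.atMost_Suc)
  also have "(\<Sum>j\<le>m. ?f (Suc m) k (Suc j)) = (\<Sum>j\<le>m. ?f m k (Suc j)) - (\<Sum>j\<le>m. ?f m (Suc k) j)"
    unfolding sum_subtractf[symmetric] by (intro sum.cong refl) (simp add: algebra_simps)
  also have "s k + ((\<Sum>j\<le>m. ?f m k (Suc j)) - (\<Sum>j\<le>m. ?f m (Suc k) j))
      = (\<Sum>j\<le>Suc m. ?f m k j) - (\<Sum>j\<le>m. ?f m (Suc k) j)"
    by (simp add: sum.atMost_Suc_shift del: sum.atMost_Suc)
  also have "\<dots> = (\<Sum>j\<le>m. ?f m k j) - (\<Sum>j\<le>m. ?f m (Suc k) j)" by simp
  finally show ?case using Suc by simp
qed simp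

lemma backward_diff_tendsto_0: "s \<longlonglongrightarrow> 0 \<Longrightarrow> backward_diff m s \<longlonglongrightarrow> 0"
proof (induction m)
  case (Suc m)
  then have "backward_diff m s \<longlonglongrightarrow> 0" by simp
  from tendsto_diff[OF this LIMSEQ_Suc[OF this]] show ?case by simp
qed simp

text \<open>
  If the difference of order \<open>m + 1\<close> is nonnegative then the difference \<open>t\<close> of order \<open>m\<close> decreases to
  \<open>0\<close>, hence is nonnegative itself. So positivity passes down to all lower orders, and summation by
  parts reduces the claim for \<open>m + 1\<close> to the claim for \<open>m\<close>.
\<close>

lemma backward_diff_sums:
  assumes "s \<longlonglongrightarrow> 0" "\<And>k. 0 \<le> backward_diff m s k"
  shows "(\<lambda>k. bergman_coeff m k * backward_diff m s k) sums s 0"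
  using assms(2)
proof (induction m)
  case 0
  have "(\<lambda>k. bergman_coeff 0 k * backward_diff 0 s k) = (\<lambda>k. if k = 0 then s k else 0)"
    by (auto simp: bergman_coeff_0)
  then show ?case using sums_single[of 0 s] by simp
next
  case (Suc m)
  let ?t = "backward_diff m s"
  have dec: "decseq ?t" using Suc.prems by (intro decseq_SucI) simp
  have lim: "?t \<longlonglongrightarrow> 0" using assms(1) by (rule backward_diff_tendsto_0)
  have "(\<lambda>k. bergman_coeff m k * ?t k) sums s 0" using decseq_ge[OF dec lim] by (rule Suc.IH)
  from sums_by_parts[OF bergman_coeff_nonneg dec lim this] show ?case
    by (simp add: bergman_coeff_Suc)
qed

section \<open>Weighted spaces of square-summable sequences\<close>

definition wseq :: "(nat \<Rightarrow> real) \<Rightarrow> 'a::complex_vector hspace \<Rightarrow> (nat \<Rightarrow> 'a) hspace" where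
  "wseq v E = \<lparr>hcarrier = {a. (\<forall>k. a k \<in> hcarrier E) \<and> summable (\<lambda>k. v k * (hnorm E (a k))\<^sup>2)},
    hinner = (\<lambda>a b. \<Sum>k. of_real (v k) * hinner E (a k) (b k))\<rparr>"

locale weighted_seq = E: hilbert_space E for E :: "'a::complex_vector hspace" +
  fixes v :: "nat \<Rightarrow> real"
  assumes v_pos: "\<And>k. 0 < v k"
begin

abbreviation "W \<equiv> wseq v E"

lemma wseq_closed: "a \<in> hcarrier W \<Longrightarrow> a k \<in> hcarrier E"
  by (simp add: wseq_def)

lemma wseq_summable: "a \<in> hcarrier W \<Longrightarrow> summable (\<lambda>k. v k * (hnorm E (a k))\<^sup>2)"
  by (simp add: wseq_def)

lemma wseq_memI:
  "\<lbrakk>\<And>k. a k \<in> hcarrier E; summable (\<lambda>k. v k * (hnorm E (a k))\<^sup>2)\<rbrakk> \<Longrightarrow> a \<in> hcarrier W"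
  by (simp add: wseq_def)

lemma wseq_inner: "hinner W a b = (\<Sum>k. of_real (v k) * hinner E (a k) (b k))"
  by (simp add: wseq_def)

lemma v_nonneg: "0 \<le> v k"
  using v_pos[of k] by simp

lemma inner_term_le:
  assumes "x \<in> hcarrier E" "y \<in> hcarrier E"
  shows "cmod (of_real (v k) * hinner E x y) \<le> v k * (hnorm E x)\<^sup>2 + v k * (hnorm E y)\<^sup>2"
proof -
  have "0 \<le> (hnorm E x - hnorm E y)\<^sup>2" by simp
  then have "2 * (hnorm E x * hnorm E y) \<le> (hnorm E x)\<^sup>2 + (hnorm E y)\<^sup>2"
    by (simp add: power2_diff algebra_simps)
  moreover have "0 \<le> hnorm E x * hnorm E y" using assms by simp
  ultimately have "cmod (hinner E x y) \<le> (hnorm E x)\<^sup>2 + (hnorm E y)\<^sup>2"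
    using E.Cauchy_Schwarz[OF assms] by linarith
  then show ?thesis using v_pos[of k] by (simp add: norm_mult flip: distrib_left)
qed

lemma inner_norm_summable:
  assumes "a \<in> hcarrier W" "b \<in> hcarrier W"
  shows "summable (\<lambda>k. cmod (of_real (v k) * hinner E (a k) (b k)))"
  by (rule summable_comparison_test'[OF summable_add[OF wseq_summable[OF assms(1)] wseq_summable[OF assms(2)]], of 0])
     (use inner_term_le assms wseq_closed in simp)

lemmas inner_summable = summable_norm_cancel[OF inner_norm_summable]

lemma inner_sums:
  "\<lbrakk>a \<in> hcarrier W; b \<in> hcarrier W\<rbrakk>
    \<Longrightarrow> (\<lambda>k. of_real (v k) * hinner E (a k) (b k)) sums hinner W a b"
  using summable_sums[OF inner_summable] by (simp add: wseq_inner)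

lemma inner_self_sums:
  assumes "a \<in> hcarrier W"
  shows "hinner W a a = of_real (\<Sum>k. v k * (hnorm E (a k))\<^sup>2)"
proof -
  have "hinner W a a = (\<Sum>k. of_real (v k * (hnorm E (a k))\<^sup>2))"
    using assms wseq_closed by (simp add: wseq_inner E.inner_self)
  then show ?thesis using suminf_of_real[OF wseq_summable[OF assms], where 'a = complex] by simp
qed

lemma wseq_norm:
  assumes "a \<in> hcarrier W"
  shows "hnorm W a = sqrt (\<Sum>k. v k * (hnorm E (a k))\<^sup>2)"
  using inner_self_sums[OF assms] by (simp add: hnorm_def)

lemma wseq_norm_sq:
  assumes "a \<in> hcarrier W"
  shows "(hnorm W a)\<^sup>2 = (\<Sum>k. v k * (hnorm E (a k))\<^sup>2)"
  using wseq_norm[OF assms] suminf_nonneg[OF wseq_summable[OF assms]] v_nonneg by simp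

lemma wseq_partial_le:
  assumes "a \<in> hcarrier W" "finite K"
  shows "(\<Sum>k\<in>K. v k * (hnorm E (a k))\<^sup>2) \<le> (hnorm W a)\<^sup>2"
  unfolding wseq_norm_sq[OF assms(1)]
  using v_nonneg by (intro sum_le_suminf wseq_summable assms) auto

lemma wseq_component_le:
  assumes "a \<in> hcarrier W"
  shows "hnorm E (a k) \<le> hnorm W a / sqrt (v k)"
proof -
  have "v k * (hnorm E (a k))\<^sup>2 \<le> (hnorm W a)\<^sup>2" using wseq_partial_le[OF assms, of "{k}"] by simp
  then have "sqrt (v k * (hnorm E (a k))\<^sup>2) \<le> sqrt ((hnorm W a)\<^sup>2)" by (rule real_sqrt_le_mono)
  moreover have "0 \<le> hnorm W a"
    using wseq_norm[OF assms] suminf_nonneg[OF wseq_summable[OF assms]] v_nonneg by simp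
  ultimately show ?thesis
    using v_pos[of k] E.norm_ge_0[OF wseq_closed[OF assms, of k]]
    by (simp add: real_sqrt_mult field_simps)
qed

lemma wseq_add_closed:
  assumes "a \<in> hcarrier W" "b \<in> hcarrier W"
  shows "a + b \<in> hcarrier W"
proof (rule wseq_memI)
  fix k
  show "(a + b) k \<in> hcarrier E" using assms wseq_closed by (simp add: E.closed_rules)
next
  show "summable (\<lambda>k. v k * (hnorm E ((a + b) k))\<^sup>2)"
  proof (rule summable_comparison_test'[OF summable_mult[OF summable_add[OF wseq_summable[OF assms(1)]
          wseq_summable[OF assms(2)]], of 2], of 0])
    fix k
    have "v k * (hnorm E (a k + b k))\<^sup>2 \<le> v k * (2 * (hnorm E (a k))\<^sup>2 + 2 * (hnorm E (b k))\<^sup>2)"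
      using E.norm_add_sq_le assms wseq_closed v_nonneg by (intro mult_left_mono) auto
    then show "norm (v k * (hnorm E ((a + b) k))\<^sup>2)
        \<le> 2 * (v k * (hnorm E (a k))\<^sup>2 + v k * (hnorm E (b k))\<^sup>2)"
      using v_nonneg[of k] by (simp add: algebra_simps)
  qed
qed

lemma wseq_scaleC_closed:
  assumes "a \<in> hcarrier W"
  shows "c *\<^sub>C a \<in> hcarrier W"
proof (rule wseq_memI)
  fix k
  show "(c *\<^sub>C a) k \<in> hcarrier E" using assms wseq_closed by (simp add: scaleC_fun_def E.closed_rules)
next
  show "summable (\<lambda>k. v k * (hnorm E ((c *\<^sub>C a) k))\<^sup>2)"
    using summable_mult[OF wseq_summable[OF assms], of "(cmod c)\<^sup>2"] wseq_closed[OF assms]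
    by (simp add: scaleC_fun_def E.norm_scaleC power_mult_distrib mult_ac)
qed

lemma wseq_diff_closed:
  assumes "a \<in> hcarrier W" "b \<in> hcarrier W"
  shows "a - b \<in> hcarrier W"
  using wseq_add_closed[OF assms(1) wseq_scaleC_closed[OF assms(2), of "-1"]] by simp

lemma wseq_hilbert: "hilbert_space W"
proof
  show "0 \<in> hcarrier W" by (simp add: wseq_def E.zero_closed)
next
  fix a b c assume abc: "a \<in> hcarrier W" "b \<in> hcarrier W" "c \<in> hcarrier W"
  have "of_real (v k) * hinner E (a k) (c k) + of_real (v k) * hinner E (b k) (c k)
      = of_real (v k) * hinner E ((a + b) k) (c k)" for k
    using abc wseq_closed by (simp add: E.inner_add_left distrib_left)
  then show "hinner W (a + b) c = hinner W a c + hinner W b c"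
    using suminf_add[OF inner_summable[OF abc(1,3)] inner_summable[OF abc(2,3)]] by (simp only: wseq_inner)
next
  fix a b c assume ab: "a \<in> hcarrier W" "b \<in> hcarrier W"
  have "c * (of_real (v k) * hinner E (a k) (b k)) = of_real (v k) * hinner E ((c *\<^sub>C a) k) (b k)" for k
    using ab wseq_closed by (simp add: scaleC_fun_def E.inner_scaleC_left mult.left_commute)
  then show "hinner W (c *\<^sub>C a) b = c * hinner W a b"
    using suminf_mult[OF inner_summable[OF ab], of c] by (simp only: wseq_inner)
next
  fix a b assume ab: "a \<in> hcarrier W" "b \<in> hcarrier W"
  have "cnj (hinner W b a) = (\<Sum>k. cnj (of_real (v k) * hinner E (b k) (a k)))"
    using bounded_linear.suminf[OF bounded_linear_cnj inner_summable[OF ab(2,1)]] by (simp add: wseq_inner)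
  also have "\<dots> = hinner W a b"
    unfolding wseq_inner using E.inner_commute[OF wseq_closed[OF ab(1)] wseq_closed[OF ab(2)]]
    by (intro arg_cong[where f = suminf] ext) simp
  finally show "hinner W a b = cnj (hinner W b a)" by simp
next
  fix a assume a: "a \<in> hcarrier W"
  show "0 \<le> Re (hinner W a a)"
    using suminf_nonneg[OF wseq_summable[OF a]] v_nonneg by (simp add: inner_self_sums[OF a])
  assume "hinner W a a = 0"
  then have "hnorm W a = 0" by (simp add: hnorm_def)
  then have "hnorm E (a k) = 0" for k
    using wseq_component_le[OF a, of k] E.norm_ge_0[OF wseq_closed[OF a, of k]] by simp
  then show "a = 0" using E.norm_eq_0_iff wseq_closed[OF a] by (auto simp: fun_eq_iff)
next
  fix X :: "nat \<Rightarrow> nat \<Rightarrow> 'a"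
  assume X': "range X \<subseteq> hcarrier W" and C: "\<forall>e>0. \<exists>N. \<forall>i\<ge>N. \<forall>j\<ge>N. hnorm W (X i - X j) < e"
  have X: "X n \<in> hcarrier W" for n using X' by auto
  note d = wseq_diff_closed[OF X X]
  have "\<exists>x\<in>hcarrier E. (\<lambda>n. hnorm E (X n k - x)) \<longlonglongrightarrow> 0" for k
  proof (rule E.complete)
    show "range (\<lambda>n. X n k) \<subseteq> hcarrier E" using wseq_closed[OF X] by auto
    show "\<forall>e>0. \<exists>N. \<forall>i\<ge>N. \<forall>j\<ge>N. hnorm E (X i k - X j k) < e"
    proof (intro allI impI)
      fix e :: real assume "e > 0"
      then have "e * sqrt (v k) > 0" using v_pos[of k] by simp
      with C obtain N where N: "\<And>i j. \<lbrakk>i \<ge> N; j \<ge> N\<rbrakk> \<Longrightarrow> hnorm W (X i - X j) < e * sqrt (v k)" by blast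
      have "hnorm E (X i k - X j k) < e" if "i \<ge> N" "j \<ge> N" for i j
      proof -
        have "hnorm E (X i k - X j k) \<le> hnorm W (X i - X j) / sqrt (v k)"
          using wseq_component_le[OF d, of i j k] by simp
        also have "\<dots> < e" using N[OF that] v_pos[of k] by (simp add: field_simps)
        finally show ?thesis .
      qed
      then show "\<exists>N. \<forall>i\<ge>N. \<forall>j\<ge>N. hnorm E (X i k - X j k) < e" by blast
    qed
  qed
  then obtain x where x: "\<And>k. x k \<in> hcarrier E" "\<And>k. (\<lambda>n. hnorm E (X n k - x k)) \<longlonglongrightarrow> 0"
    by metis
  \<comment> \<open>Bounds for finite sections of \<open>X i - X j\<close> survive the limit in \<open>j\<close>.\<close>
  have close: "X i - x \<in> hcarrier W \<and> hnorm W (X i - x) \<le> e"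
    if e: "e > 0" and N: "\<And>j. j \<ge> N \<Longrightarrow> hnorm W (X i - X j) < e" for e N i
  proof -
    have part: "(\<Sum>k<K. v k * (hnorm E (X i k - x k))\<^sup>2) \<le> e\<^sup>2" for K
    proof (rule LIMSEQ_le_const2)
      have "(\<lambda>j. hnorm E (X i k - X j k)) \<longlonglongrightarrow> hnorm E (X i k - x k)" for k
      proof (rule E.limit_norm)
        have "hnorm E (X i k - X j k - (X i k - x k)) = hnorm E (X j k - x k)" for j
          using E.norm_minus_commute[of "x k" "X j k"] x(1) wseq_closed[OF X] by simp
        then show "(\<lambda>n. hnorm E (X i k - X n k - (X i k - x k))) \<longlonglongrightarrow> 0" using x(2) by simp
      qed (use x(1) wseq_closed[OF X] in \<open>auto intro: E.closed_rules\<close>)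
      then show "(\<lambda>j. \<Sum>k<K. v k * (hnorm E (X i k - X j k))\<^sup>2) \<longlonglongrightarrow> (\<Sum>k<K. v k * (hnorm E (X i k - x k))\<^sup>2)"
        by (intro tendsto_intros)
      have "(\<Sum>k<K. v k * (hnorm E (X i k - X j k))\<^sup>2) \<le> e\<^sup>2" if "j \<ge> N" for j
      proof -
        have "(hnorm W (X i - X j))\<^sup>2 \<le> e\<^sup>2"
          using N[OF that] wseq_norm[OF d, of i j] suminf_nonneg[OF wseq_summable[OF d, of i j]] v_nonneg
          by (intro power_mono) auto
        then show ?thesis using wseq_partial_le[OF d, of "{..<K}" i j] by simp
      qed
      then show "\<exists>N. \<forall>j\<ge>N. (\<Sum>k<K. v k * (hnorm E (X i k - X j k))\<^sup>2) \<le> e\<^sup>2" by blast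
    qed
    have s: "summable (\<lambda>k. v k * (hnorm E (X i k - x k))\<^sup>2)"
      using part v_nonneg by (intro summableI_nonneg_bounded) auto
    then have m: "X i - x \<in> hcarrier W"
      using x(1) wseq_closed[OF X] by (intro wseq_memI) (auto intro: E.closed_rules)
    moreover have "hnorm W (X i - x) \<le> e"
      unfolding wseq_norm[OF m] using suminf_le_const[OF s part] e by (simp add: real_le_lsqrt)
    ultimately show ?thesis by blast
  qed
  obtain N where N: "\<And>i j. \<lbrakk>i \<ge> N; j \<ge> N\<rbrakk> \<Longrightarrow> hnorm W (X i - X j) < 1" using C zero_less_one by blast
  have "X N - x \<in> hcarrier W" using close[of 1 N N] N by simp
  from wseq_diff_closed[OF X[of N] this] have xW: "x \<in> hcarrier W" by simp
  moreover have "(\<lambda>i. hnorm W (X i - x)) \<longlonglongrightarrow> 0"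
  proof (rule LIMSEQ_I)
    fix e :: real assume e: "e > 0"
    then obtain N where N: "\<And>i j. \<lbrakk>i \<ge> N; j \<ge> N\<rbrakk> \<Longrightarrow> hnorm W (X i - X j) < e / 2"
      using C half_gt_zero[OF e] by blast
    have "norm (hnorm W (X i - x) - 0) < e" if "i \<ge> N" for i
    proof -
      have "hnorm W (X i - x) \<le> e / 2" using close[of "e/2" N i] N[OF that] e by simp
      moreover have "0 \<le> hnorm W (X i - x)"
        using wseq_norm[OF wseq_diff_closed[OF X xW]] suminf_nonneg[OF wseq_summable[OF wseq_diff_closed[OF X xW]]]
          v_nonneg by simp
      ultimately show ?thesis using e by simp
    qed
    then show "\<exists>N. \<forall>i\<ge>N. norm (hnorm W (X i - x) - 0) < e" by blast
  qed
  ultimately show "\<exists>x\<in>hcarrier W. (\<lambda>i. hnorm W (X i - x)) \<longlonglongrightarrow> 0" by blast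
qed (fact wseq_add_closed wseq_scaleC_closed)+

sublocale W: hilbert_space W
  by (rule wseq_hilbert)

end

section \<open>Uniqueness of the reproducing kernel Hilbert space\<close>

inductive_set finite_sums :: "'a::comm_monoid_add set \<Rightarrow> 'a set" for S where
  zero: "0 \<in> finite_sums S"
| add: "\<lbrakk>x \<in> S; y \<in> finite_sums S\<rbrakk> \<Longrightarrow> x + y \<in> finite_sums S"

definition kernel_span ::
    "(complex \<Rightarrow> complex \<Rightarrow> complex) \<Rightarrow> 'a::complex_vector hspace \<Rightarrow> (complex \<Rightarrow> 'a) set" where
  "kernel_span k E = finite_sums {kernel_section k w \<eta> | w \<eta>. w \<in> \<D> \<and> \<eta> \<in> hcarrier E}"

lemma kernel_span_zero: "0 \<in> kernel_span k E"
  unfolding kernel_span_def by (rule finite_sums.zero)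

lemma kernel_span_add_section:
  "\<lbrakk>w \<in> \<D>; \<eta> \<in> hcarrier E; f \<in> kernel_span k E\<rbrakk> \<Longrightarrow> kernel_section k w \<eta> + f \<in> kernel_span k E"
  unfolding kernel_span_def by (rule finite_sums.add) auto

lemma kernel_span_induct [consumes 1, case_names zero add]:
  assumes "f \<in> kernel_span k E" "P 0"
    and "\<And>w \<eta> f. \<lbrakk>w \<in> \<D>; \<eta> \<in> hcarrier E; f \<in> kernel_span k E; P f\<rbrakk> \<Longrightarrow> P (kernel_section k w \<eta> + f)"
  shows "P f"
  using assms(1) unfolding kernel_span_def
proof (rule finite_sums.induct)
  fix x y
  assume "x \<in> {kernel_section k w \<eta> |w \<eta>. w \<in> \<D> \<and> \<eta> \<in> hcarrier E}"
    and "y \<in> finite_sums {kernel_section k w \<eta> |w \<eta>. w \<in> \<D> \<and> \<eta> \<in> hcarrier E}" "P y"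
  then show "P (x + y)" using assms(3) unfolding kernel_span_def by blast
qed (fact assms(2))

lemma kernel_span_add:
  "\<lbrakk>f \<in> kernel_span k E; g \<in> kernel_span k E\<rbrakk> \<Longrightarrow> f + g \<in> kernel_span k E"
  by (erule kernel_span_induct) (simp_all only: add_0 add.assoc kernel_span_add_section)

lemma scaleC_kernel_section: "c *\<^sub>C kernel_section k w \<eta> = kernel_section k w (c *\<^sub>C \<eta>)"
  by (auto simp: kernel_section_def scaleC_fun_def fun_eq_iff mult.commute)

lemma kernel_span_scaleC:
  assumes "hilbert_space E" "f \<in> kernel_span k E"
  shows "c *\<^sub>C f \<in> kernel_span k E"
  using assms(2)
  by (rule kernel_span_induct) (simp_all only: scaleC_zero_right scaleC_add_right scaleC_kernel_section
      kernel_span_zero kernel_span_add_section hilbert_space.scaleC_closed[OF assms(1)])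

lemma rkhs_value_closed: "\<lbrakk>is_rkhs k E F; f \<in> hcarrier F; w \<in> \<D>\<rbrakk> \<Longrightarrow> f w \<in> hcarrier E"
  by (simp add: is_rkhs_def vec_holomorphic_def)

lemma rkhs_eqI:
  assumes E: "hilbert_space E" and F: "is_rkhs k E F" "f \<in> hcarrier F" and G: "is_rkhs k E G" "g \<in> hcarrier G"
    and eq: "\<And>w \<eta>. \<lbrakk>w \<in> \<D>; \<eta> \<in> hcarrier E\<rbrakk> \<Longrightarrow> hinner E (f w) \<eta> = hinner E (g w) \<eta>"
  shows "f = g"
proof
  fix w
  show "f w = g w"
  proof (cases "w \<in> \<D>")
    case True
    show ?thesis
      by (rule hilbert_space.eq_if_inner_eq'[OF E rkhs_value_closed[OF F True] rkhs_value_closed[OF G True]])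
        (rule eq[OF True])
  next
    case False
    then show ?thesis using F G unfolding is_rkhs_def by auto
  qed
qed

lemma rkhs_kernel_span_closed:
  assumes F: "is_rkhs k E F" and f: "f \<in> kernel_span k E"
  shows "f \<in> hcarrier F"
proof -
  interpret F: hilbert_space F using F by (simp add: is_rkhs_def)
  show ?thesis using f
    by (rule kernel_span_induct) (use F in \<open>unfold is_rkhs_def, blast intro: F.zero_closed F.add_closed\<close>)+
qed

lemma rkhs_kernel_span_inner:
  assumes F: "is_rkhs k E F" and G: "is_rkhs k E G" and f: "f \<in> kernel_span k E" and g: "g \<in> kernel_span k E"
  shows "hinner F f g = hinner G f g"
proof -
  interpret F: hilbert_space F using F by (simp add: is_rkhs_def)
  interpret G: hilbert_space G using G by (simp add: is_rkhs_def)
  have fF: "f \<in> hcarrier F" and fG: "f \<in> hcarrier G"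
    using rkhs_kernel_span_closed F G f by blast+
  show ?thesis using g
  proof (rule kernel_span_induct)
    show "hinner F f 0 = hinner G f 0" using fF fG by simp
  next
    fix w \<eta> g
    assume add: "w \<in> \<D>" "\<eta> \<in> hcarrier E" "g \<in> kernel_span k E" "hinner F f g = hinner G f g"
    have "g \<in> hcarrier F" "g \<in> hcarrier G" using rkhs_kernel_span_closed F G add by blast+
    then show "hinner F f (kernel_section k w \<eta> + g) = hinner G f (kernel_section k w \<eta> + g)"
      using F G add fF fG unfolding is_rkhs_def by (simp add: F.inner_add_right G.inner_add_right)
  qed
qed

text \<open>A function orthogonal to all kernel sections vanishes at every point.\<close>

lemma rkhs_kernel_span_dense:
  assumes E: "hilbert_space E" and F: "is_rkhs k E F"
  shows "hclosure F (kernel_span k E) = hcarrier F"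
proof -
  interpret F: hilbert_space F using F by (simp add: is_rkhs_def)
  let ?S = "hclosure F (kernel_span k E)"
  have sub: "kernel_span k E \<subseteq> hcarrier F" using rkhs_kernel_span_closed[OF F] by blast
  have S: "closed_subspace F ?S"
    using sub kernel_span_zero kernel_span_add kernel_span_scaleC[OF E]
    by (intro F.hclosure_closed_subspace) auto
  have SF: "?S \<subseteq> hcarrier F" by (auto simp: hclosure_def)
  have "f \<in> ?S" if f: "f \<in> hcarrier F" for f
  proof -
    obtain g where g: "g \<in> ?S" "\<And>u. u \<in> ?S \<Longrightarrow> hinner F (f - g) u = 0"
      using F.projection_exists[OF SF F.hilbert_subspace[OF S] f] by blast
    have gF: "g \<in> hcarrier F" using g SF by blast
    have "f - g = 0"
    proof (rule rkhs_eqI[OF E F _ F])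
      fix w \<eta> assume w: "w \<in> \<D>" "\<eta> \<in> hcarrier E"
      have "kernel_section k w \<eta> \<in> kernel_span k E"
        using kernel_span_add_section[OF w kernel_span_zero] by simp
      then have "hinner F (f - g) (kernel_section k w \<eta>) = 0" using g(2) F.hclosure_superset[OF sub] by blast
      then have "hinner E ((f - g) w) \<eta> = 0"
        using F F.diff_closed[OF f gF] w unfolding is_rkhs_def by simp
      then show "hinner E ((f - g) w) \<eta> = hinner E (0 w) \<eta>"
        using w hilbert_space.inner_zero_left[OF E] by simp
    qed (use f gF in \<open>auto intro: F.closed_rules\<close>)
    then show ?thesis using g by simp
  qed
  then show ?thesis using SF by blast
qed

text \<open>A function of the one space is a limit of combinations of kernel sections, on which both norms
  agree. Such a sequence also converges in the other space, and to the same function because the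
  values at the points of the disc are continuous in both norms.\<close>

lemma rkhs_unique:
  fixes F G :: "(complex \<Rightarrow> 'a::complex_vector) hspace"
  assumes E: "hilbert_space E" and F: "is_rkhs k E F" and G: "is_rkhs k E G" and f: "f \<in> hcarrier F"
  shows "f \<in> hcarrier G" "hnorm G f = hnorm F f"
proof -
  interpret E: hilbert_space E by fact
  interpret F: hilbert_space F using F by (simp add: is_rkhs_def)
  interpret G: hilbert_space G using G by (simp add: is_rkhs_def)
  have "\<exists>s. s \<in> kernel_span k E \<and> hnorm F (f - s) < inverse (real (Suc n))" for n
  proof -
    have "inverse (real (Suc n)) > 0" by simp
    moreover have "f \<in> hclosure F (kernel_span k E)" using f rkhs_kernel_span_dense[OF E F] by simp
    ultimately show ?thesis unfolding hclosure_def by blast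
  qed
  then obtain s where s: "\<And>n. s n \<in> kernel_span k E" "\<And>n. hnorm F (f - s n) < inverse (real (Suc n))"
    by metis
  have sF: "s n \<in> hcarrier F" and sG: "s n \<in> hcarrier G" for n
    using rkhs_kernel_span_closed F G s(1) by blast+
  have limF: "(\<lambda>n. hnorm F (s n - f)) \<longlonglongrightarrow> 0"
  proof (rule tendsto_sandwich[OF _ _ tendsto_const LIMSEQ_inverse_real_of_nat])
    show "\<forall>\<^sub>F n in sequentially. 0 \<le> hnorm F (s n - f)" using sF f by (simp add: F.closed_rules)
    show "\<forall>\<^sub>F n in sequentially. hnorm F (s n - f) \<le> inverse (real (Suc n))"
      using s(2) F.norm_minus_commute[OF sF f] by (simp add: less_imp_le)
  qed
  have diff: "s i - s j \<in> kernel_span k E" for i j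
    using kernel_span_add[OF s(1) kernel_span_scaleC[OF E s(1), of "-1"], of i j] by simp
  have "hnorm G (s i - s j) = hnorm F (s i - s j)" for i j
    unfolding hnorm_def using rkhs_kernel_span_inner[OF F G diff diff] by simp
  then have "\<forall>e>0. \<exists>N. \<forall>i\<ge>N. \<forall>j\<ge>N. hnorm G (s i - s j) < e"
    using F.limit_Cauchy[OF sF f limF] by simp
  then obtain g where g: "g \<in> hcarrier G" and limG: "(\<lambda>n. hnorm G (s n - g)) \<longlonglongrightarrow> 0"
    using G.Cauchy_convergent[of s] sG by blast
  have "f = g"
  proof (rule rkhs_eqI[OF E F f G g])
    fix w \<eta> assume w: "w \<in> \<D>" "\<eta> \<in> hcarrier E"
    then have K: "kernel_section k w \<eta> \<in> hcarrier F" "kernel_section k w \<eta> \<in> hcarrier G"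
      and KF: "\<And>f. f \<in> hcarrier F \<Longrightarrow> hinner F f (kernel_section k w \<eta>) = hinner E (f w) \<eta>"
      and KG: "\<And>f. f \<in> hcarrier G \<Longrightarrow> hinner G f (kernel_section k w \<eta>) = hinner E (f w) \<eta>"
      using F G by (auto simp: is_rkhs_def)
    have "(\<lambda>n. hinner E (s n w) \<eta>) \<longlonglongrightarrow> hinner E (f w) \<eta>"
      using F.limit_inner[OF sF f K(1) limF] by (simp add: KF[OF sF] KF[OF f])
    moreover have "(\<lambda>n. hinner E (s n w) \<eta>) \<longlonglongrightarrow> hinner E (g w) \<eta>"
      using G.limit_inner[OF sG g K(2) limG] by (simp add: KG[OF sG] KG[OF g])
    ultimately show "hinner E (f w) \<eta> = hinner E (g w) \<eta>" by (rule LIMSEQ_unique)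
  qed
  with g show "f \<in> hcarrier G" by simp
  have "hnorm G (s n) = hnorm F (s n)" for n
    unfolding hnorm_def using rkhs_kernel_span_inner[OF F G s(1) s(1)] by simp
  then show "hnorm G f = hnorm F f"
    using F.limit_norm[OF sF f limF] G.limit_norm[OF sG g limG] \<open>f = g\<close> LIMSEQ_unique by auto
qed

lemma rkhs_unique_inner:
  fixes F G :: "(complex \<Rightarrow> 'a::complex_vector) hspace"
  assumes E: "hilbert_space E" and F: "is_rkhs k E F" and G: "is_rkhs k E G"
  shows "hcarrier F = hcarrier G" "\<And>f g. \<lbrakk>f \<in> hcarrier F; g \<in> hcarrier F\<rbrakk> \<Longrightarrow> hinner F f g = hinner G f g"
proof -
  show "hcarrier F = hcarrier G" using rkhs_unique(1)[OF E F G] rkhs_unique(1)[OF E G F] by blast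
  fix f g assume fg: "f \<in> hcarrier F" "g \<in> hcarrier F"
  have "hilbert_space F" "hilbert_space G" using F G by (auto simp: is_rkhs_def)
  from isometry_preserves_inner[OF this, of "\<lambda>x. x"] rkhs_unique[OF E F G] fg
  show "hinner F f g = hinner G f g" by simp
qed

section \<open>The Bergman spaces as spaces of Taylor coefficients\<close>

text \<open>Uniqueness of Taylor coefficients; it makes the map from coefficients to functions injective.\<close>

lemma power_series_coeffs_0:
  fixes c :: "nat \<Rightarrow> complex"
  assumes "\<And>z. cmod z < 1 \<Longrightarrow> (\<lambda>k. c k * z ^ k) sums 0"
  shows "c k = 0"
proof -
  have "conv_radius c \<ge> norm (1/2 :: complex)"
    using assms[of "1/2"] by (intro conv_radius_geI) (auto simp: sums_iff)
  then have "fps_conv_radius (Abs_fps c) > 0"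
    unfolding fps_conv_radius_def using less_le_trans[of 0 "ereal (1/2)"] by simp
  moreover have "\<forall>\<^sub>F z in nhds 0. eval_fps (Abs_fps c) z = eval_fps 0 z"
  proof (rule eventually_nhds_in_open[THEN eventually_mono])
    show "open (ball (0::complex) 1)" "(0::complex) \<in> ball 0 1" by auto
    fix z :: complex assume "z \<in> ball 0 1"
    then show "eval_fps (Abs_fps c) z = eval_fps 0 z"
      using sums_unique[OF assms[of z]] by (simp add: eval_fps_def)
  qed
  ultimately have "Abs_fps c = 0" by (intro eval_fps_eqD) auto
  then show ?thesis by (metis fps_nth_Abs_fps fps_zero_nth)
qed

lemma power_derivative_bounds:
  assumes "0 < K" "K < (s::real)"
  obtains M where "0 \<le> M" "\<And>k. real k * K ^ (k - 1) \<le> M * s ^ k"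
    "\<And>k. real k * real (k - 1) * K ^ (k - 2) \<le> M * s ^ k"
proof -
  \<comment> \<open>\<open>k\<^sup>2 (K / s)\<^sup>k\<close> is bounded, being the square of the null sequence \<open>k y\<^sup>k\<close>.\<close>
  define y where "y = sqrt (K / s)"
  have y: "0 < y" "y < 1" "y\<^sup>2 = K / s" using assms by (auto simp: y_def)
  have "(\<lambda>n. of_nat n * y ^ n) \<longlonglongrightarrow> 0" using y by (intro powser_times_n_limit_0) auto
  then have "Bseq (\<lambda>n. of_nat n * y ^ n)" by (rule convergentI[THEN convergent_imp_Bseq])
  then obtain B where B: "0 < B" "\<And>n. norm (of_nat n * y ^ n) \<le> B" by (auto elim: BseqE)
  have k2: "(real k)\<^sup>2 * K ^ k \<le> B\<^sup>2 * s ^ k" for k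
  proof -
    have "(real k * y ^ k)\<^sup>2 \<le> B\<^sup>2" using B(2)[of k] y by (intro power_mono) auto
    then have "(real k)\<^sup>2 * (K / s) ^ k \<le> B\<^sup>2"
      using y by (simp add: power_mult_distrib power_mult[symmetric] mult.commute flip: y(3))
    then show ?thesis using assms by (simp add: power_divide field_simps)
  qed
  define M where "M = B\<^sup>2 / K + B\<^sup>2 / K\<^sup>2"
  show thesis
  proof (rule that)
    show "0 \<le> M" using assms by (simp add: M_def)
    have s: "0 \<le> B\<^sup>2 / K * s ^ k" "0 \<le> B\<^sup>2 / K\<^sup>2 * s ^ k" for k using assms by auto
    show "real k * K ^ (k - 1) \<le> M * s ^ k" for k
    proof (cases k)
      case (Suc j)
      have "real k * K ^ k \<le> (real k)\<^sup>2 * K ^ k"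
        using assms Suc by (intro mult_right_mono) (auto simp: power2_eq_square)
      also have "\<dots> \<le> B\<^sup>2 * s ^ k" by (rule k2)
      finally have "real k * K ^ (k - 1) \<le> B\<^sup>2 / K * s ^ k" using assms Suc by (simp add: field_simps)
      then show ?thesis using s[of k] by (simp add: M_def distrib_right)
    qed (use s[of k] in \<open>simp add: M_def\<close>)
    show "real k * real (k - 1) * K ^ (k - 2) \<le> M * s ^ k" for k
    proof (cases "k < 2")
      case False
      then have Kk: "K ^ k = K ^ (k - 2) * K\<^sup>2" by (simp only: not_less le_add_diff_inverse2 flip: power_add)
      have "real k * real (k - 1) * K ^ k \<le> (real k)\<^sup>2 * K ^ k"
        using assms by (intro mult_right_mono) (auto simp: power2_eq_square mult_left_mono)
      also have "\<dots> \<le> B\<^sup>2 * s ^ k" by (rule k2)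
      finally have "real k * real (k - 1) * K ^ (k - 2) \<le> B\<^sup>2 / K\<^sup>2 * s ^ k"
        using assms unfolding Kk by (simp add: field_simps)
      then show ?thesis using s[of k] by (simp add: M_def distrib_right)
    next
      case True
      then have "k = 0 \<or> k = 1" by auto
      then show ?thesis using s[of k] by (auto simp: M_def distrib_right)
    qed
  qed
qed

locale bergman = E: hilbert_space E for E :: "'a::complex_vector hspace" +
  fixes m :: nat
  assumes m_ge_1: "m \<ge> 1"
begin

abbreviation "w \<equiv> bergman_coeff m"

lemmas w_pos = bergman_coeff_pos[OF m_ge_1]

sublocale weighted_seq E "\<lambda>k. 1 / bergman_coeff m k"
  by unfold_locales (simp add: w_pos)

text \<open>
  The vector for which \<open>\<langle>a, kvec p \<eta>\<rangle> = \<Sum>\<^sub>k p\<^sub>k \<langle>a\<^sub>k, \<eta>\<rangle>\<close>. For \<open>p\<^sub>k = \<zeta>\<^sup>k\<close> it consists of the Taylor coefficients of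
  the kernel section at \<open>\<zeta>\<close>.
\<close>

definition kvec :: "(nat \<Rightarrow> complex) \<Rightarrow> 'a \<Rightarrow> nat \<Rightarrow> 'a" where
  "kvec p \<eta> = (\<lambda>k. (of_real (w k) * cnj (p k)) *\<^sub>C \<eta>)"

abbreviation "square_sum p \<equiv> summable (\<lambda>k. w k * (cmod (p k))\<^sup>2)"

lemma kvec_term:
  assumes "\<eta> \<in> hcarrier E"
  shows "1 / w k * (hnorm E (kvec p \<eta> k))\<^sup>2 = (w k * (cmod (p k))\<^sup>2) * (hnorm E \<eta>)\<^sup>2"
  using assms w_pos[of k]
  by (simp add: kvec_def E.norm_scaleC norm_mult power_mult_distrib power2_eq_square[of "w k"])

lemma kvec_closed: "\<lbrakk>square_sum p; \<eta> \<in> hcarrier E\<rbrakk> \<Longrightarrow> kvec p \<eta> \<in> hcarrier W"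
  by (rule wseq_memI) (auto simp: kvec_term summable_mult2 simp del: times_divide_eq_left, simp add: kvec_def E.closed_rules)

lemma kvec_norm:
  assumes "square_sum p" "\<eta> \<in> hcarrier E"
  shows "hnorm W (kvec p \<eta>) = sqrt (\<Sum>k. w k * (cmod (p k))\<^sup>2) * hnorm E \<eta>"
  unfolding wseq_norm[OF kvec_closed[OF assms]] kvec_term[OF assms(2)] suminf_mult2[OF assms(1), symmetric]
  using assms by (simp add: real_sqrt_mult)

lemma kvec_bounded: "square_sum p \<Longrightarrow> bounded_op E W (kvec p)"
  by (rule bounded_opI[where C = "sqrt (\<Sum>k. w k * (cmod (p k))\<^sup>2)"])
     (auto simp: kvec_closed kvec_norm, auto simp: kvec_def fun_eq_iff scaleC_add_right scaleC_fun_def mult_ac)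

lemma inner_kvec_sums:
  assumes "a \<in> hcarrier W" "square_sum p" "\<eta> \<in> hcarrier E"
  shows "(\<lambda>k. p k * hinner E (a k) \<eta>) sums hinner W a (kvec p \<eta>)"
proof -
  have "of_real (1 / w k) * hinner E (a k) (kvec p \<eta> k) = p k * hinner E (a k) \<eta>" for k
    using w_pos[of k] assms wseq_closed by (simp add: kvec_def E.inner_scaleC_right)
  then show ?thesis using inner_sums[OF assms(1) kvec_closed[OF assms(2,3)]] by simp
qed

text \<open>The vector \<open>\<Sum>\<^sub>k p\<^sub>k a\<^sub>k\<close>.\<close>

definition ev :: "(nat \<Rightarrow> complex) \<Rightarrow> (nat \<Rightarrow> 'a) \<Rightarrow> 'a" where
  "ev p = adj E W (kvec p)"

lemma ev_op: "square_sum p \<Longrightarrow> hilbert_op E W (kvec p)"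
  by unfold_locales (rule kvec_bounded)

lemma ev_bounded: "square_sum p \<Longrightarrow> bounded_op W E (ev p)"
  unfolding ev_def by (rule hilbert_op.adj_bounded[OF ev_op])

lemma ev_closed: "\<lbrakk>square_sum p; a \<in> hcarrier W\<rbrakk> \<Longrightarrow> ev p a \<in> hcarrier E"
  using ev_bounded by (rule bounded_op_closed)

lemma ev_inner:
  "\<lbrakk>square_sum p; a \<in> hcarrier W; \<eta> \<in> hcarrier E\<rbrakk> \<Longrightarrow> hinner E (ev p a) \<eta> = hinner W a (kvec p \<eta>)"
  unfolding ev_def by (rule hilbert_op.inner_adj'[OF ev_op])

lemma ev_inner_sums:
  "\<lbrakk>square_sum p; a \<in> hcarrier W; \<eta> \<in> hcarrier E\<rbrakk> \<Longrightarrow> (\<lambda>k. p k * hinner E (a k) \<eta>) sums hinner E (ev p a) \<eta>"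
  using inner_kvec_sums by (simp add: ev_inner)

lemma ev_eqI:
  assumes "square_sum p" "a \<in> hcarrier W" "x \<in> hcarrier E"
    and "\<And>\<eta>. \<eta> \<in> hcarrier E \<Longrightarrow> (\<lambda>k. p k * hinner E (a k) \<eta>) sums hinner E x \<eta>"
  shows "ev p a = x"
  using assms ev_inner_sums[OF assms(1,2)] ev_closed[OF assms(1,2)] sums_unique2
  by (intro E.eq_if_inner_eq') blast+

lemma ev_norm_le:
  assumes "square_sum p" "a \<in> hcarrier W"
  shows "hnorm E (ev p a) \<le> sqrt (\<Sum>k. w k * (cmod (p k))\<^sup>2) * hnorm W a"
  unfolding ev_def
proof (rule hilbert_op.adj_norm_le[OF ev_op[OF assms(1)]])
  show "0 \<le> sqrt (\<Sum>k. w k * (cmod (p k))\<^sup>2)" by (simp add: suminf_nonneg assms(1))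
qed (use assms in \<open>simp_all add: kvec_norm\<close>)

lemma square_sum_geometric_bound:
  assumes "\<And>k. cmod (p k) \<le> M * s ^ k" "0 \<le> s" "s < 1" "0 \<le> M"
  shows "square_sum p" "(\<Sum>k. w k * (cmod (p k))\<^sup>2) \<le> M\<^sup>2 * (\<Sum>k. w k * (s\<^sup>2) ^ k)"
proof -
  have g: "summable (\<lambda>k. w k * (s\<^sup>2) ^ k)"
    using assms by (intro bergman_coeff_summable) (auto simp: power_less_one_iff)
  have le: "w k * (cmod (p k))\<^sup>2 \<le> M\<^sup>2 * (w k * (s\<^sup>2) ^ k)" for k
  proof -
    have "(cmod (p k))\<^sup>2 \<le> (M * s ^ k)\<^sup>2" using assms by (intro power_mono) auto
    also have "\<dots> = M\<^sup>2 * (s\<^sup>2) ^ k" by (simp add: power_mult_distrib mult.commute flip: power_mult)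
    finally show ?thesis using mult_left_mono[of _ _ "w k"] by (simp add: mult.left_commute)
  qed
  show sq: "square_sum p"
    using le by (intro summable_comparison_test'[OF summable_mult[OF g, of "M\<^sup>2"], of 0]) simp
  have "(\<Sum>k. w k * (cmod (p k))\<^sup>2) \<le> (\<Sum>k. M\<^sup>2 * (w k * (s\<^sup>2) ^ k))"
    by (rule suminf_le[OF le sq summable_mult[OF g]])
  then show "(\<Sum>k. w k * (cmod (p k))\<^sup>2) \<le> M\<^sup>2 * (\<Sum>k. w k * (s\<^sup>2) ^ k)"
    by (simp add: suminf_mult[OF g])
qed

lemma square_sum_power: "cmod z < 1 \<Longrightarrow> square_sum (\<lambda>k. z ^ k)"
  by (rule square_sum_geometric_bound[where M = 1 and s = "cmod z"]) (auto simp: norm_power)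

text \<open>The function with the Taylor coefficients \<open>a\<close>, extended by \<open>0\<close> outside the disc.\<close>

definition J :: "(nat \<Rightarrow> 'a) \<Rightarrow> complex \<Rightarrow> 'a" where
  "J a = (\<lambda>z. if z \<in> \<D> then ev (\<lambda>k. z ^ k) a else 0)"

lemma J_add: "\<lbrakk>a \<in> hcarrier W; b \<in> hcarrier W\<rbrakk> \<Longrightarrow> J (a + b) = J a + J b"
  by (auto simp: J_def fun_eq_iff bounded_op_add[OF ev_bounded] square_sum_power)

lemma J_scaleC: "a \<in> hcarrier W \<Longrightarrow> J (c *\<^sub>C a) = c *\<^sub>C J a"
  by (auto simp: J_def fun_eq_iff scaleC_fun_apply bounded_op_scaleC[OF ev_bounded] square_sum_power)

lemma J_closed: "\<lbrakk>a \<in> hcarrier W; z \<in> \<D>\<rbrakk> \<Longrightarrow> J a z \<in> hcarrier E"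
  by (simp add: J_def ev_closed square_sum_power)

lemma J_inner_sums:
  "\<lbrakk>a \<in> hcarrier W; z \<in> \<D>; \<eta> \<in> hcarrier E\<rbrakk> \<Longrightarrow> (\<lambda>k. z ^ k * hinner E (a k) \<eta>) sums hinner E (J a z) \<eta>"
  using ev_inner_sums[OF square_sum_power] by (simp add: J_def)

lemma J_inj: "inj_on J (hcarrier W)"
proof (rule inj_onI)
  fix a b assume a: "a \<in> hcarrier W" and b: "b \<in> hcarrier W" and eq: "J a = J b"
  show "a = b"
  proof
    fix k
    show "a k = b k"
    proof (rule E.eq_if_inner_eq'[OF wseq_closed[OF a] wseq_closed[OF b]])
      fix \<eta> assume \<eta>: "\<eta> \<in> hcarrier E"
      have "(\<lambda>k. (hinner E (a k) \<eta> - hinner E (b k) \<eta>) * z ^ k) sums 0" if "cmod z < 1" for z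
        using sums_diff[OF J_inner_sums[OF a _ \<eta>, of z] J_inner_sums[OF b _ \<eta>, of z]] that eq
        by (simp add: algebra_simps)
      from power_series_coeffs_0[OF this] show "hinner E (a k) \<eta> = hinner E (b k) \<eta>" by simp
    qed
  qed
qed

text \<open>The remainder of the difference quotient is a point evaluation with the coefficients
  \<open>((z + h)\<^sup>k - z\<^sup>k) / h - k z\<^sup>k\<^sup>-\<^sup>1 = O(h)\<close>. The bound is uniform in \<open>a\<close>, which makes
  operator-valued functions built from evaluations holomorphic in the operator norm.\<close>

lemma J_difference_quotient:
  assumes z: "z \<in> \<D>"
  obtains L C \<delta> where "bounded_op W E L" "\<delta> > 0" "C \<ge> 0" "\<And>h. cmod h < \<delta> \<Longrightarrow> z + h \<in> \<D>"
    "\<And>h a. \<lbrakk>h \<noteq> 0; cmod h < \<delta>; a \<in> hcarrier W\<rbrakk>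
      \<Longrightarrow> hnorm E ((1 / h) *\<^sub>C (J a (z + h) - J a z) - L a) \<le> C * cmod h * hnorm W a"
proof -
  define \<delta> where "\<delta> = (1 - cmod z) / 2"
  define K where "K = cmod z + \<delta>"
  define s where "s = (K + 1) / 2"
  have \<delta>: "\<delta> > 0" using z by (simp add: \<delta>_def)
  have K: "0 < K" "K < s" "s < 1" "cmod z \<le> K"
    using z \<delta> by (auto simp: K_def s_def \<delta>_def field_simps add_pos_nonneg intro: add_nonneg_pos)
  obtain M where M: "0 \<le> M" "\<And>k. real k * K ^ (k - 1) \<le> M * s ^ k"
      "\<And>k. real k * real (k - 1) * K ^ (k - 2) \<le> M * s ^ k"
    using power_derivative_bounds[OF K(1,2)] by blast
  define G where "G = (\<Sum>k. w k * (s\<^sup>2) ^ k)"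
  define p' where "p' k = of_nat k * z ^ (k - 1)" for k
  have sq': "square_sum p'"
  proof (rule square_sum_geometric_bound)
    show "cmod (p' k) \<le> M * s ^ k" for k
      using order_trans[OF mult_left_mono[OF power_mono[OF K(4)]] M(2)[of k]]
      by (simp add: p'_def norm_mult norm_power)
  qed (use K M in auto)
  have disc: "z + h \<in> \<D>" if "cmod h < \<delta>" for h
    using norm_triangle_ineq[of z h] that K by (simp add: K_def)
  have est: "hnorm E ((1 / h) *\<^sub>C (J a (z + h) - J a z) - ev p' a) \<le> (M * sqrt G) * cmod h * hnorm W a"
    if h: "h \<noteq> 0" "cmod h < \<delta>" and a: "a \<in> hcarrier W" for h a
  proof -
    define q where "q k = ((z + h) ^ k - z ^ k) / h - p' k" for k
    have q: "cmod (q k) \<le> (M * cmod h) * s ^ k" for k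
    proof -
      have "cmod (q k) \<le> real k * real (k - 1) * K ^ (k - 2) * cmod h"
        unfolding q_def p'_def using lemma_termdiff3[of h z K k] h K norm_triangle_ineq[of z h]
        by (simp add: K_def)
      also have "\<dots> \<le> M * s ^ k * cmod h" using M(3)[of k] by (intro mult_right_mono) auto
      finally show ?thesis by (simp add: mult_ac)
    qed
    have sq: "square_sum q" and le: "(\<Sum>k. w k * (cmod (q k))\<^sup>2) \<le> (M * cmod h)\<^sup>2 * G"
      unfolding G_def by (rule square_sum_geometric_bound[OF q]; use K M in auto)+
    have "ev q a = (1 / h) *\<^sub>C (J a (z + h) - J a z) - ev p' a"
    proof (rule ev_eqI[OF sq a])
      show "(1 / h) *\<^sub>C (J a (z + h) - J a z) - ev p' a \<in> hcarrier E"
        using J_closed[OF a] z disc[OF h(2)] ev_closed[OF sq' a] by (intro E.closed_rules)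
      fix \<eta> assume \<eta>: "\<eta> \<in> hcarrier E"
      have "(\<lambda>k. (1 / h) * ((z + h) ^ k * hinner E (a k) \<eta> - z ^ k * hinner E (a k) \<eta>) - p' k * hinner E (a k) \<eta>)
          sums ((1 / h) * (hinner E (J a (z + h)) \<eta> - hinner E (J a z) \<eta>) - hinner E (ev p' a) \<eta>)"
        by (intro sums_diff sums_mult J_inner_sums ev_inner_sums sq' a \<eta> z disc h)
      then show "(\<lambda>k. q k * hinner E (a k) \<eta>) sums hinner E ((1 / h) *\<^sub>C (J a (z + h) - J a z) - ev p' a) \<eta>"
        using J_closed[OF a] z disc[OF h(2)] ev_closed[OF sq' a] \<eta>
        by (simp add: E.inner_linear E.closed_rules q_def left_diff_distrib diff_divide_distrib)
    qed
    then have "hnorm E ((1 / h) *\<^sub>C (J a (z + h) - J a z) - ev p' a)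
        \<le> sqrt (\<Sum>k. w k * (cmod (q k))\<^sup>2) * hnorm W a"
      using ev_norm_le[OF sq a] by simp
    also have "\<dots> \<le> sqrt ((M * cmod h)\<^sup>2 * G) * hnorm W a"
      using le a by (intro mult_right_mono real_sqrt_le_mono) auto
    also have "sqrt ((M * cmod h)\<^sup>2 * G) = (M * sqrt G) * cmod h"
      using M by (simp add: real_sqrt_mult)
    finally show ?thesis .
  qed
  have "0 \<le> G"
    unfolding G_def using K by (intro suminf_nonneg bergman_coeff_summable) (auto simp: power_less_one_iff)
  then show thesis using that[OF ev_bounded[OF sq'] \<delta> _ disc est] M by simp
qed

lemma J_holomorphic:
  assumes a: "a \<in> hcarrier W"
  shows "vec_holomorphic E (J a)"
  unfolding vec_holomorphic_def
proof (intro ballI conjI)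
  fix z assume z: "z \<in> \<D>"
  show "J a z \<in> hcarrier E" using J_closed[OF a z] .
  obtain L C \<delta> where L: "bounded_op W E L" "\<delta> > 0" "C \<ge> 0" "\<And>h. cmod h < \<delta> \<Longrightarrow> z + h \<in> \<D>"
    "\<And>h a. \<lbrakk>h \<noteq> 0; cmod h < \<delta>; a \<in> hcarrier W\<rbrakk>
      \<Longrightarrow> hnorm E ((1 / h) *\<^sub>C (J a (z + h) - J a z) - L a) \<le> C * cmod h * hnorm W a"
    by (rule J_difference_quotient[OF z], rule that)
  show "\<exists>d\<in>hcarrier E. ((\<lambda>h. hnorm E ((1 / h) *\<^sub>C (J a (z + h) - J a z) - d)) \<longlongrightarrow> 0) (at 0)"
  proof (rule bexI[of _ "L a"], rule tendsto_sandwich[OF _ _ tendsto_const])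
    show "L a \<in> hcarrier E" using bounded_op_closed[OF L(1) a] .
    have near: "\<forall>\<^sub>F h in at 0. h \<noteq> 0 \<and> cmod h < \<delta>"
      unfolding eventually_at using L(2) by (intro exI[of _ \<delta>]) simp
    then show "\<forall>\<^sub>F h in at 0. 0 \<le> hnorm E ((1 / h) *\<^sub>C (J a (z + h) - J a z) - L a)"
    proof (rule eventually_mono)
      fix h assume "h \<noteq> 0 \<and> cmod h < \<delta>"
      then have "J a (z + h) \<in> hcarrier E" using J_closed[OF a] L(4) by blast
      then show "0 \<le> hnorm E ((1 / h) *\<^sub>C (J a (z + h) - J a z) - L a)"
        using J_closed[OF a z] bounded_op_closed[OF L(1) a] by (simp add: E.closed_rules)
    qed
    show "\<forall>\<^sub>F h in at 0. hnorm E ((1 / h) *\<^sub>C (J a (z + h) - J a z) - L a) \<le> C * cmod h * hnorm W a"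
      using near by (rule eventually_mono) (use L(5) a in blast)
    show "((\<lambda>h. C * cmod h * hnorm W a) \<longlongrightarrow> 0) (at 0)"
      by (auto intro!: tendsto_eq_intros)
  qed
qed

lemma J_kvec:
  assumes \<zeta>: "\<zeta> \<in> \<D>" and \<eta>: "\<eta> \<in> hcarrier E"
  shows "J (kvec (\<lambda>k. \<zeta> ^ k) \<eta>) = kernel_section (bergman_kernel m) \<zeta> \<eta>"
proof
  fix z
  show "J (kvec (\<lambda>k. \<zeta> ^ k) \<eta>) z = kernel_section (bergman_kernel m) \<zeta> \<eta> z"
  proof (cases "z \<in> \<D>")
    case True
    have "ev (\<lambda>k. z ^ k) (kvec (\<lambda>k. \<zeta> ^ k) \<eta>) = bergman_kernel m z \<zeta> *\<^sub>C \<eta>"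
    proof (rule ev_eqI)
      fix \<xi> assume \<xi>: "\<xi> \<in> hcarrier E"
      have "cmod z * cmod \<zeta> < 1 * 1" using True \<zeta> by (intro mult_strict_mono') auto
      then have "cmod (z * cnj \<zeta>) < 1" by (simp add: norm_mult)
      from sums_mult2[OF bergman_coeff_sums[OF this, of m], of "hinner E \<eta> \<xi>"]
      show "(\<lambda>k. z ^ k * hinner E (kvec (\<lambda>k. \<zeta> ^ k) \<eta> k) \<xi>) sums hinner E (bergman_kernel m z \<zeta> *\<^sub>C \<eta>) \<xi>"
        using \<eta> \<xi> by (simp add: kvec_def E.inner_scaleC_left bergman_kernel_def power_mult_distrib mult_ac)
    qed (use True \<zeta> \<eta> in \<open>auto intro!: square_sum_power kvec_closed E.closed_rules\<close>)
    then show ?thesis using True by (simp add: J_def kernel_section_def)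
  qed (simp add: J_def kernel_section_def)
qed

lemma bergman_rkhs_exists: "\<exists>F. is_rkhs (bergman_kernel m) E F \<and> hcarrier F = J ` hcarrier W \<and>
    (\<forall>a\<in>hcarrier W. \<forall>b\<in>hcarrier W. hinner F (J a) (J b) = hinner W a b)"
proof -
  define F where "F = \<lparr>hcarrier = J ` hcarrier W,
    hinner = \<lambda>f g. hinner W (inv_into (hcarrier W) J f) (inv_into (hcarrier W) J g)\<rparr>"
  have carrier: "hcarrier F = J ` hcarrier W" by (simp add: F_def)
  have inner: "hinner F (J a) (J b) = hinner W a b" if "a \<in> hcarrier W" "b \<in> hcarrier W" for a b
    using that by (simp add: F_def inv_into_f_f[OF J_inj])
  have "hilbert_space F"
    by (rule hilbert_space_image[OF W.hilbert_space_axioms carrier J_add J_scaleC inner])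
  moreover have "kernel_section (bergman_kernel m) \<zeta> \<eta> \<in> hcarrier F \<and>
      (\<forall>f\<in>hcarrier F. hinner F f (kernel_section (bergman_kernel m) \<zeta> \<eta>) = hinner E (f \<zeta>) \<eta>)"
    if \<zeta>: "\<zeta> \<in> \<D>" "\<eta> \<in> hcarrier E" for \<zeta> \<eta>
  proof -
    have k: "kvec (\<lambda>k. \<zeta> ^ k) \<eta> \<in> hcarrier W" using \<zeta> by (auto intro: kvec_closed square_sum_power)
    have "hinner F (J a) (J (kvec (\<lambda>k. \<zeta> ^ k) \<eta>)) = hinner E (J a \<zeta>) \<eta>" if a: "a \<in> hcarrier W" for a
      using inner[OF a k] ev_inner[OF square_sum_power a] \<zeta> by (simp add: J_def)
    then show ?thesis unfolding J_kvec[OF \<zeta>, symmetric] carrier using k by auto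
  qed
  moreover have "vec_holomorphic E f \<and> (\<forall>z. z \<notin> \<D> \<longrightarrow> f z = 0)" if "f \<in> hcarrier F" for f
    using that J_holomorphic unfolding carrier by (auto simp: J_def)
  ultimately have "is_rkhs (bergman_kernel m) E F" unfolding is_rkhs_def by blast
  then show ?thesis using carrier inner by blast
qed

lemma A2_rkhs: "is_rkhs (bergman_kernel m) E (A2 m E)"
  unfolding A2_def using bergman_rkhs_exists someI_ex[of "is_rkhs (bergman_kernel m) E"] by blast

lemma A2_carrier: "hcarrier (A2 m E) = J ` hcarrier W"
  and J_inner: "\<lbrakk>a \<in> hcarrier W; b \<in> hcarrier W\<rbrakk> \<Longrightarrow> hinner (A2 m E) (J a) (J b) = hinner W a b"
proof -
  obtain F where F: "is_rkhs (bergman_kernel m) E F" "hcarrier F = J ` hcarrier W"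
      "\<forall>a\<in>hcarrier W. \<forall>b\<in>hcarrier W. hinner F (J a) (J b) = hinner W a b"
    using bergman_rkhs_exists by blast
  note u = rkhs_unique_inner[OF E.hilbert_space_axioms F(1) A2_rkhs]
  show "hcarrier (A2 m E) = J ` hcarrier W" using u(1) F(2) by simp
  show "hinner (A2 m E) (J a) (J b) = hinner W a b" if "a \<in> hcarrier W" "b \<in> hcarrier W"
    using u(2)[of "J a" "J b"] F(2,3) that by auto
qed

end

section \<open>The shift\<close>

lemma sums_Suc_0: "\<lbrakk>(\<lambda>k. f (Suc k)) sums s; f 0 = 0\<rbrakk> \<Longrightarrow> f sums s"
  for f :: "nat \<Rightarrow> 'a::real_normed_vector"
  using sums_Suc[of f s] by simp

definition shift :: "(nat \<Rightarrow> 'a) \<Rightarrow> nat \<Rightarrow> 'a::zero" where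
  "shift a = case_nat 0 a"

lemma shift_simps [simp]: "shift a 0 = 0" "shift a (Suc k) = a k"
  by (simp_all add: shift_def)

lemma shift_funpow_below: "k < n \<Longrightarrow> (shift ^^ n) a k = 0"
proof (induction n arbitrary: k)
  case (Suc n)
  then show ?case by (cases k) auto
qed simp

context bergman
begin

lemma weight_Suc_le: "1 / w (Suc k) \<le> 1 / w k"
  using bergman_coeff_mono[OF m_ge_1, of k "Suc k"] w_pos[of k] by (simp add: frac_le)

lemma shift_closed_norm:
  assumes a: "a \<in> hcarrier W"
  shows "shift a \<in> hcarrier W \<and> hnorm W (shift a) \<le> hnorm W a"
proof -
  have le: "1 / w (Suc k) * (hnorm E (a k))\<^sup>2 \<le> 1 / w k * (hnorm E (a k))\<^sup>2" for k
    by (intro mult_right_mono weight_Suc_le) simp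
  have s: "summable (\<lambda>k. 1 / w (Suc k) * (hnorm E (a k))\<^sup>2)"
    using le w_pos by (intro summable_comparison_test'[OF wseq_summable[OF a], of 0]) (simp add: less_imp_le)
  have sums: "(\<lambda>k. 1 / w k * (hnorm E (shift a k))\<^sup>2) sums (\<Sum>k. 1 / w (Suc k) * (hnorm E (a k))\<^sup>2)"
    by (rule sums_Suc_0) (use s in \<open>simp_all add: summable_sums\<close>)
  have "shift a k \<in> hcarrier E" for k
    by (cases k) (simp_all add: E.zero_closed wseq_closed[OF a])
  then have mem: "shift a \<in> hcarrier W" using sums_summable[OF sums] by (rule wseq_memI)
  have "hnorm W (shift a) \<le> hnorm W a"
    unfolding wseq_norm[OF mem] wseq_norm[OF a] sums_unique[OF sums, symmetric]
    by (intro real_sqrt_le_mono suminf_le le s wseq_summable a)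
  with mem show ?thesis by blast
qed

lemma shift_closed: "a \<in> hcarrier W \<Longrightarrow> shift a \<in> hcarrier W"
  using shift_closed_norm by blast

lemma shift_funpow_closed_norm:
  assumes a: "a \<in> hcarrier W"
  shows "(shift ^^ n) a \<in> hcarrier W \<and> hnorm W ((shift ^^ n) a) \<le> hnorm W a"
proof (induction n)
  case (Suc n)
  then show ?case using shift_closed_norm[of "(shift ^^ n) a"] by auto
qed (use a in simp)

text \<open>Only the coordinates of \<open>b\<close> from \<open>n\<close> on meet \<open>shift\<^sup>n a\<close>, and the tails of \<open>b\<close> tend to \<open>0\<close>.\<close>

lemma shift_funpow_weakly_null:
  assumes b: "b \<in> hcarrier W" and e: "e > 0"
  shows "\<exists>N. \<forall>n\<ge>N. \<forall>a\<in>hcarrier W. cmod (hinner W ((shift ^^ n) a) b) \<le> e * hnorm W a"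
proof -
  let ?f = "\<lambda>k. 1 / w k * (hnorm E (b k))\<^sup>2"
  have f: "summable ?f" using wseq_summable[OF b] .
  obtain N where N: "\<And>n. n \<ge> N \<Longrightarrow> norm (\<Sum>i. ?f (i + n)) < e\<^sup>2"
    using suminf_exist_split[OF _ f, of "e\<^sup>2"] e by auto
  have "cmod (hinner W ((shift ^^ n) a) b) \<le> e * hnorm W a" if n: "n \<ge> N" and a: "a \<in> hcarrier W" for n a
  proof -
    define b' where "b' k = (if k < n then 0 else b k)" for k
    have tail: "(\<lambda>k. if k < n then 0 else ?f k) sums (\<Sum>i. ?f (i + n))"
    proof -
      have "(\<lambda>i. if i + n < n then 0 else ?f (i + n)) sums (\<Sum>i. ?f (i + n))"
        using summable_sums[OF summable_ignore_initial_segment[OF f, of n]] by simp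
      then show ?thesis using sums_iff_shift'[of "\<lambda>k. if k < n then 0 else ?f k" n] by simp
    qed
    have eq: "(\<lambda>k. 1 / w k * (hnorm E (b' k))\<^sup>2) = (\<lambda>k. if k < n then 0 else ?f k)"
      by (auto simp: b'_def)
    have "b' k \<in> hcarrier E" for k using wseq_closed[OF b] E.zero_closed by (simp add: b'_def)
    then have b': "b' \<in> hcarrier W"
      by (rule wseq_memI) (simp only: eq sums_summable[OF tail])
    have "(\<Sum>i. ?f (i + n)) \<le> e\<^sup>2" using N[OF n] by (simp add: abs_less_iff)
    then have norm_b': "hnorm W b' \<le> e"
      using e unfolding wseq_norm[OF b'] eq sums_unique[OF tail, symmetric] by (intro real_le_lsqrt) auto
    note sh = shift_funpow_closed_norm[OF a, of n]
    have "hinner W ((shift ^^ n) a) b = hinner W ((shift ^^ n) a) b'"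
      unfolding wseq_inner
    proof (intro arg_cong[where f = suminf] ext)
      fix k
      show "of_real (1 / w k) * hinner E ((shift ^^ n) a k) (b k)
          = of_real (1 / w k) * hinner E ((shift ^^ n) a k) (b' k)"
        using wseq_closed[OF b] E.zero_closed by (simp add: b'_def shift_funpow_below)
    qed
    then have "cmod (hinner W ((shift ^^ n) a) b) \<le> hnorm W ((shift ^^ n) a) * hnorm W b'"
      using W.Cauchy_Schwarz[of "(shift ^^ n) a" b'] sh b' by simp
    also have "\<dots> \<le> hnorm W a * e"
      by (rule mult_mono) (use sh norm_b' W.norm_ge_0[OF a] W.norm_ge_0[OF b'] in blast)+
    finally show ?thesis by (simp add: mult.commute)
  qed
  then show ?thesis by blast
qed

lemma Mz_J: "a \<in> hcarrier W \<Longrightarrow> Mz (J a) = J (shift a)"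
proof
  fix z assume a: "a \<in> hcarrier W"
  show "Mz (J a) z = J (shift a) z"
  proof (cases "z \<in> \<D>")
    case True
    have "ev (\<lambda>k. z ^ k) (shift a) = z *\<^sub>C J a z"
    proof (rule ev_eqI)
      fix \<eta> assume \<eta>: "\<eta> \<in> hcarrier E"
      show "(\<lambda>k. z ^ k * hinner E (shift a k) \<eta>) sums hinner E (z *\<^sub>C J a z) \<eta>"
      proof (rule sums_Suc_0)
        show "(\<lambda>k. z ^ Suc k * hinner E (shift a (Suc k)) \<eta>) sums hinner E (z *\<^sub>C J a z) \<eta>"
          using sums_mult[OF J_inner_sums[OF a True \<eta>], of z] J_closed[OF a True] \<eta>
          by (simp add: E.inner_scaleC_left mult.assoc)
        show "z ^ 0 * hinner E (shift a 0) \<eta> = 0" using \<eta> by simp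
      qed
    next
      show "square_sum (\<lambda>k. z ^ k)" using True by (intro square_sum_power) simp
    qed (fact shift_closed[OF a] E.scaleC_closed[OF J_closed[OF a True]])+
    then show ?thesis using True by (simp add: J_def Mz_def)
  qed (simp add: J_def Mz_def)
qed

abbreviation "A \<equiv> A2 m E"

lemma A2_hilbert: "hilbert_space A"
  using A2_rkhs by (simp add: is_rkhs_def)

lemma J_norm: "a \<in> hcarrier W \<Longrightarrow> hnorm A (J a) = hnorm W a"
  by (simp add: hnorm_def J_inner)

lemma J_A2: "a \<in> hcarrier W \<Longrightarrow> J a \<in> hcarrier A"
  by (simp add: A2_carrier)

lemma A2_E: "f \<in> hcarrier A \<Longrightarrow> (\<And>a. \<lbrakk>a \<in> hcarrier W; f = J a\<rbrakk> \<Longrightarrow> thesis) \<Longrightarrow> thesis"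
  using A2_carrier by auto

lemma Mz_closed_norm:
  assumes "f \<in> hcarrier A"
  shows "Mz f \<in> hcarrier A \<and> hnorm A (Mz f) \<le> hnorm A f"
  using assms
proof (rule A2_E)
  fix a assume "a \<in> hcarrier W" "f = J a"
  then show ?thesis using shift_closed_norm[of a] by (simp add: Mz_J J_norm J_A2)
qed

text \<open>
  Uniformly in \<open>f\<close>, hence a statement about the norms of the powers of the adjoint of \<open>Mz\<close> that
  also restricts to invariant subspaces.
\<close>

lemma Mz_funpow_weakly_null:
  assumes g: "g \<in> hcarrier A" and e: "e > 0"
  shows "\<exists>N. \<forall>n\<ge>N. \<forall>f\<in>hcarrier A. cmod (hinner A ((Mz ^^ n) f) g) \<le> e * hnorm A f"
proof -
  obtain b where b: "b \<in> hcarrier W" "g = J b" using g by (rule A2_E)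
  obtain N where N: "\<And>n a. \<lbrakk>n \<ge> N; a \<in> hcarrier W\<rbrakk>
      \<Longrightarrow> cmod (hinner W ((shift ^^ n) a) b) \<le> e * hnorm W a"
    using shift_funpow_weakly_null[OF b(1) e] by blast
  have pow: "(Mz ^^ n) (J a) = J ((shift ^^ n) a)" if "a \<in> hcarrier W" for n a
    using that by (induction n) (simp_all add: Mz_J shift_funpow_closed_norm)
  have "cmod (hinner A ((Mz ^^ n) f) g) \<le> e * hnorm A f" if "n \<ge> N" "f \<in> hcarrier A" for n f
    using that(2)
  proof (rule A2_E)
    fix a assume a: "a \<in> hcarrier W" "f = J a"
    then show ?thesis
      using N[OF that(1) a(1)] shift_funpow_closed_norm[OF a(1)] b by (simp add: pow J_inner J_norm)
  qed
  then show ?thesis by blast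
qed

lemma A2_inner_kernel:
  assumes "\<zeta> \<in> \<D>" "\<eta> \<in> hcarrier E"
  shows "kernel_section (bergman_kernel m) \<zeta> \<eta> \<in> hcarrier A"
    "\<And>f. f \<in> hcarrier A \<Longrightarrow> hinner A f (kernel_section (bergman_kernel m) \<zeta> \<eta>) = hinner E (f \<zeta>) \<eta>"
  using A2_rkhs assms by (auto simp: is_rkhs_def)

lemma A2_value_closed: "\<lbrakk>f \<in> hcarrier A; \<zeta> \<in> \<D>\<rbrakk> \<Longrightarrow> f \<zeta> \<in> hcarrier E"
  using rkhs_value_closed[OF A2_rkhs] .

end

lemma Mz_add: "Mz (f + g) = Mz f + Mz g"
  by (simp add: Mz_def fun_eq_iff scaleC_add_right)

lemma Mz_scaleC: "Mz (c *\<^sub>C f) = c *\<^sub>C Mz f"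
  by (simp add: Mz_def fun_eq_iff scaleC_fun_apply mult.commute)

section \<open>The dilation of a contraction of Bergman type\<close>

locale bm_contraction = hilbert_op H H T for H :: "'a::complex_vector hspace" and T +
  fixes m :: nat
  assumes m_ge_1: "m \<ge> 1" and Bm: "Bm_contraction m H T"
begin

abbreviation "Ts \<equiv> adj H H T"
abbreviation "D \<equiv> defect_op m H T"
abbreviation "DS \<equiv> defect_space m H T"

lemma D_positive: "positive_op H D" and D_D: "x \<in> hcarrier H \<Longrightarrow> D (D x) = Bm_inv m H T x"
  using H.op_sqrt_properties[of "Bm_inv m H T"] Bm by (auto simp: defect_op_def Bm_contraction_def)

lemmas D_closed = H.positive_op_closed[OF D_positive]
lemmas D_selfadjoint = H.positive_op_selfadjoint[OF D_positive]

lemma D_bounded: "bounded_op H H D"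
  using D_positive by (simp add: positive_op_def)

lemmas D_add = bounded_op_add[OF D_bounded]
lemmas D_scaleC = bounded_op_scaleC[OF D_bounded]

lemma DS_closed_subspace: "closed_subspace H (hcarrier DS)"
  unfolding defect_space_def subspace_of_simps
proof (rule H.hclosure_closed_subspace)
  show "0 \<in> D ` hcarrier H"
    using bounded_op_zero[OF D_bounded H.hilbert_space_axioms] H.zero_closed by force
  fix x y assume "x \<in> D ` hcarrier H" "y \<in> D ` hcarrier H"
  then show "x + y \<in> D ` hcarrier H" using D_add[symmetric] H.add_closed by auto
next
  fix c x assume "x \<in> D ` hcarrier H"
  then show "c *\<^sub>C x \<in> D ` hcarrier H" using D_scaleC[symmetric] H.scaleC_closed by auto
qed (use D_closed in auto)

lemma DS_inner [simp]: "hinner DS = hinner H" and DS_norm [simp]: "hnorm DS = hnorm H"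
  by (simp_all add: defect_space_def)

lemma DS_hilbert: "hilbert_space DS"
  using H.hilbert_subspace[OF DS_closed_subspace] by (simp add: defect_space_def)

lemma D_in_DS: "x \<in> hcarrier H \<Longrightarrow> D x \<in> hcarrier DS"
  using H.hclosure_superset[of "D ` hcarrier H"] D_closed by (auto simp: defect_space_def)

lemma DS_subset: "x \<in> hcarrier DS \<Longrightarrow> x \<in> hcarrier H"
  using closed_subspace_subset[OF DS_closed_subspace] .

sublocale M: bergman DS m
  by (intro bergman.intro bergman_axioms.intro DS_hilbert m_ge_1)

lemmas Ts_pow_bounded = bounded_op_funpow[OF H.hilbert_space_axioms adj_bounded]
lemmas Ts_pow_closed = bounded_op_closed[OF Ts_pow_bounded]

lemma T_pow_inner:
  "\<lbrakk>u \<in> hcarrier H; x \<in> hcarrier H\<rbrakk> \<Longrightarrow> hinner H ((T ^^ j) u) x = hinner H u ((Ts ^^ j) x)"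
proof (induction j arbitrary: x)
  case (Suc j)
  have "(T ^^ j) u \<in> hcarrier H"
    using bounded_op_closed[OF bounded_op_funpow[OF H.hilbert_space_axioms bounded]] Suc.prems by blast
  then show ?case using Suc inner_adj[of "(T ^^ j) u" x] by (simp add: adj_closed funpow_swap1)
qed simp

text \<open>
  \<open>\<parallel>D y\<parallel>\<^sup>2 = \<langle>D\<^sup>2 y, y\<rangle>\<close>, and \<open>D\<^sup>2\<close> is the alternating sum of \<open>T\<^sup>j T\<^sup>*\<^sup>j\<close>. This is where
  operator positivity becomes positivity of differences of the real sequence \<open>\<parallel>T\<^sup>*\<^sup>j x\<parallel>\<^sup>2\<close>.
\<close>

lemma defect_norm:
  assumes x: "x \<in> hcarrier H"
  shows "(hnorm H (D ((Ts ^^ k) x)))\<^sup>2 = backward_diff m (\<lambda>j. (hnorm H ((Ts ^^ j) x))\<^sup>2) k"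
proof -
  define y where "y = (Ts ^^ k) x"
  have y: "y \<in> hcarrier H" using Ts_pow_closed[OF x] by (simp add: y_def)
  have Tpow: "(T ^^ j) ((Ts ^^ j) y) \<in> hcarrier H" for j
    using bounded_op_closed[OF bounded_op_funpow[OF H.hilbert_space_axioms bounded]] Ts_pow_closed[OF y] by blast
  have "hinner H (Bm_inv m H T y) y
      = (\<Sum>j\<le>m. ((-1) ^ j * of_nat (m choose j)) * hinner H ((T ^^ j) ((Ts ^^ j) y)) y)"
    unfolding Bm_inv_def using y Tpow by (simp add: H.inner_sum_left H.scaleC_closed H.inner_scaleC_left)
  also have "\<dots> = (\<Sum>j\<le>m. of_real ((-1) ^ j * real (m choose j) * (hnorm H ((Ts ^^ j) y))\<^sup>2))"
    using y Ts_pow_closed[OF y] by (simp add: T_pow_inner H.inner_self)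
  also have "\<dots> = of_real (backward_diff m (\<lambda>j. (hnorm H ((Ts ^^ j) x))\<^sup>2) k)"
    unfolding backward_diff_eq of_real_sum[symmetric] y_def
    by (simp add: funpow_add add.commute[of k])
  finally have "hinner H (D y) (D y) = of_real (backward_diff m (\<lambda>j. (hnorm H ((Ts ^^ j) x))\<^sup>2) k)"
    using D_selfadjoint[OF D_closed[OF y] y] D_D[OF y] by simp
  then show ?thesis using D_closed[OF y] unfolding y_def[symmetric] by (simp add: H.norm_sq)
qed

text \<open>The Taylor coefficients of \<open>D (1 - z T\<^sup>*)\<^bsup>-m\<^esup> x\<close>.\<close>

definition dil :: "'a \<Rightarrow> nat \<Rightarrow> 'a" where
  "dil x = (\<lambda>k. of_real (bergman_coeff m k) *\<^sub>C D ((Ts ^^ k) x))"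

lemma dil_sums:
  assumes x: "x \<in> hcarrier H"
  shows "(\<lambda>k. 1 / bergman_coeff m k * (hnorm H (dil x k))\<^sup>2) sums (hnorm H x)\<^sup>2"
proof -
  let ?s = "\<lambda>j. (hnorm H ((Ts ^^ j) x))\<^sup>2"
  have "(\<lambda>j. hnorm H ((Ts ^^ j) x)) \<longlonglongrightarrow> 0"
    using Bm x by (auto simp: Bm_contraction_def class_C_dot_0_def)
  from tendsto_power[OF this, of 2] have "?s \<longlonglongrightarrow> 0" by simp
  moreover have "0 \<le> backward_diff m ?s k" for k
    using defect_norm[OF x, of k, symmetric] by simp
  ultimately have "(\<lambda>k. bergman_coeff m k * backward_diff m ?s k) sums ?s 0"
    by (rule backward_diff_sums)
  moreover have "1 / bergman_coeff m k * (hnorm H (dil x k))\<^sup>2 = bergman_coeff m k * backward_diff m ?s k" for k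
    using bergman_coeff_pos[OF m_ge_1, of k] D_closed[OF Ts_pow_closed[OF x]]
    by (simp add: dil_def H.norm_scaleC power_mult_distrib power2_eq_square[of "bergman_coeff m k"]
        defect_norm[OF x])
  ultimately show ?thesis by simp
qed

lemma dil_closed:
  assumes x: "x \<in> hcarrier H"
  shows "dil x \<in> hcarrier M.W"
proof (rule M.wseq_memI)
  show "dil x k \<in> hcarrier DS" for k
    unfolding dil_def using D_in_DS[OF Ts_pow_closed[OF x]] by (rule M.E.scaleC_closed)
qed (use sums_summable[OF dil_sums[OF x]] in simp)

lemma dil_norm: "x \<in> hcarrier H \<Longrightarrow> hnorm M.W (dil x) = hnorm H x"
  by (simp only: M.wseq_norm[OF dil_closed] DS_norm sums_unique[OF dil_sums, symmetric]
      real_sqrt_abs H.norm_ge_0 abs_of_nonneg)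

lemma dil_add: "\<lbrakk>x \<in> hcarrier H; y \<in> hcarrier H\<rbrakk> \<Longrightarrow> dil (x + y) = dil x + dil y"
  by (simp add: dil_def fun_eq_iff bounded_op_add[OF Ts_pow_bounded] Ts_pow_closed D_add scaleC_add_right)

lemma dil_scaleC: "x \<in> hcarrier H \<Longrightarrow> dil (c *\<^sub>C x) = c *\<^sub>C dil x"
  by (simp add: dil_def fun_eq_iff bounded_op_scaleC[OF Ts_pow_bounded] Ts_pow_closed D_scaleC
      scaleC_fun_apply mult.commute)

lemma dil_inner: "\<lbrakk>x \<in> hcarrier H; y \<in> hcarrier H\<rbrakk> \<Longrightarrow> hinner M.W (dil x) (dil y) = hinner H x y"
  by (rule isometry_preserves_inner[OF H.hilbert_space_axioms M.W.hilbert_space_axioms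
      dil_closed dil_add dil_scaleC dil_norm])

lemma dil_bounded: "bounded_op H M.W dil"
  by (rule bounded_opI[where C = 1]) (simp_all add: dil_closed dil_add dil_scaleC dil_norm)

text \<open>
  The factor \<open>bergman_coeff m k\<close> in the dilation cancels the weight \<open>1 / bergman_coeff m k\<close> of the sequence
  space, so that only an index shift remains.
\<close>

lemma shift_inner_dil:
  assumes a: "a \<in> hcarrier M.W" and x: "x \<in> hcarrier H"
  shows "hinner M.W (shift a) (dil x) = hinner M.W a (dil (Ts x))"
proof -
  have "(\<lambda>k. of_real (1 / bergman_coeff m k) * hinner H (shift a k) (dil x k)) sums hinner M.W a (dil (Ts x))"
  proof (rule sums_Suc_0)
    have "of_real (1 / bergman_coeff m (Suc k)) * hinner H (shift a (Suc k)) (dil x (Suc k))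
        = of_real (1 / bergman_coeff m k) * hinner H (a k) (dil (Ts x) k)" for k
    proof -
      have "hinner H (a k) (dil y j) = of_real (bergman_coeff m j) * hinner H (a k) (D ((Ts ^^ j) y))"
        if "y \<in> hcarrier H" for y j
        using D_closed[OF Ts_pow_closed[OF that]] DS_subset[OF M.wseq_closed[OF a]]
        by (simp add: dil_def H.inner_scaleC_right)
      then show ?thesis
        using x adj_closed[OF x] bergman_coeff_pos[OF m_ge_1, of k] bergman_coeff_pos[OF m_ge_1, of "Suc k"]
        by (simp add: funpow_swap1)
    qed
    then show "(\<lambda>k. of_real (1 / bergman_coeff m (Suc k)) * hinner H (shift a (Suc k)) (dil x (Suc k)))
        sums hinner M.W a (dil (Ts x))"
      using M.inner_sums[OF a dil_closed[OF adj_closed[OF x]]] by simp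
    show "of_real (1 / bergman_coeff m 0) * hinner H (shift a 0) (dil x 0) = 0"
      using DS_subset[OF M.wseq_closed[OF dil_closed[OF x]]] by simp
  qed
  then show ?thesis
    using M.inner_sums[OF M.shift_closed[OF a] dil_closed[OF x]] sums_unique2 by simp
qed

end

section \<open>Invariant subspaces of the Bergman spaces\<close>

lemma opnorm_bounds:
  assumes C: "0 \<le> C" "\<And>x. x \<in> hcarrier H \<Longrightarrow> hnorm K (X x) \<le> C * hnorm H x"
  shows "0 \<le> opnorm H K X" "opnorm H K X \<le> C"
proof -
  let ?B = "{C. C \<ge> 0 \<and> (\<forall>x\<in>hcarrier H. hnorm K (X x) \<le> C * hnorm H x)}"
  have C': "C \<in> ?B" using C by blast
  show "0 \<le> opnorm H K X" unfolding opnorm_def using C' by (intro cInf_greatest) auto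
  show "opnorm H K X \<le> C" unfolding opnorm_def using C' by (intro cInf_lower bdd_belowI[of _ 0]) auto
qed

(* The Hardy space is the case m = 1, which must not be rewritten to Suc 0. *)
declare One_nat_def [simp del]

locale invariant_subspace = bergman E m for E :: "'a::complex_vector hspace" and m +
  fixes S :: "(complex \<Rightarrow> 'a) set"
  assumes S: "closed_subspace A S" and invariant: "f \<in> S \<Longrightarrow> Mz f \<in> S"
begin

sublocale A: hilbert_space A
  by (rule A2_hilbert)

abbreviation "SS \<equiv> subspace_of A S"

sublocale S: hilbert_space SS
  by (rule A.hilbert_subspace[OF S])

lemma S_sub: "f \<in> S \<Longrightarrow> f \<in> hcarrier A"
  by (rule closed_subspace_subset[OF S])

lemma S_subset: "S \<subseteq> hcarrier A"
  using S_sub by blast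

sublocale R: hilbert_op SS SS Mz
proof
  show "bounded_op SS SS Mz"
    by (rule bounded_opI[where C = 1]) (auto simp: invariant Mz_add Mz_scaleC Mz_closed_norm[OF S_sub])
qed

abbreviation "Rs \<equiv> adj SS SS Mz"

lemma Rs_norm_le: "f \<in> S \<Longrightarrow> hnorm A (Rs f) \<le> hnorm A f"
  using R.adj_norm_le[of 1 f] Mz_closed_norm[OF S_sub] by simp

lemma Rs_closed: "f \<in> S \<Longrightarrow> Rs f \<in> S"
  using R.adj_closed[of f] by simp

lemma Rs_pow_inner:
  "\<lbrakk>u \<in> S; f \<in> S\<rbrakk> \<Longrightarrow> (Rs ^^ l) f \<in> S \<and> hinner A u ((Rs ^^ l) f) = hinner A ((Mz ^^ l) u) f"
proof (induction l arbitrary: u)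
  case (Suc l)
  have l: "(Rs ^^ l) f \<in> S" using Suc by blast
  show ?case
    using Suc.IH[of "Mz u"] R.inner_adj[of u "(Rs ^^ l) f"] Rs_closed[OF l] Suc.prems
    by (simp add: invariant l funpow_swap1[of Mz])
qed simp

lemma Rs_pow_tendsto_0:
  assumes g: "g \<in> S"
  shows "(\<lambda>l. hnorm A ((Rs ^^ l) g)) \<longlonglongrightarrow> 0"
proof (rule LIMSEQ_I)
  fix e :: real assume "e > 0"
  then have e: "e / 2 > 0" by simp
  obtain N where N: "\<And>n f. \<lbrakk>n \<ge> N; f \<in> hcarrier A\<rbrakk>
      \<Longrightarrow> cmod (hinner A ((Mz ^^ n) f) g) \<le> e / 2 * hnorm A f"
    using Mz_funpow_weakly_null[OF S_sub[OF g] e] by blast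
  have "norm (hnorm A ((Rs ^^ l) g) - 0) < e" if l: "l \<ge> N" for l
  proof -
    have mem: "(Rs ^^ l) g \<in> S" using Rs_pow_inner[OF g g] by blast
    have "hnorm SS ((Rs ^^ l) g) \<le> e / 2"
    proof (rule S.norm_le_if_inner_le)
      fix u assume "u \<in> hcarrier SS"
      then show "cmod (hinner SS u ((Rs ^^ l) g)) \<le> e / 2 * hnorm SS u"
        using N[OF l S_sub[of u]] Rs_pow_inner[of u g l] g by simp
    qed (use mem e in auto)
    then show ?thesis using A.norm_ge_0[OF S_sub[OF mem]] e by simp
  qed
  then show "\<exists>N. \<forall>l\<ge>N. norm (hnorm A ((Rs ^^ l) g) - 0) < e" by blast
qed

text \<open>
  \<open>Mz\<close> is a contraction on every Bergman space, so \<open>1 - R R\<^sup>*\<close> is positive for its restriction \<open>R\<close> to \<open>S\<close>.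
  Hence \<open>R\<close> has a dilation of its own, into a Hardy space.
\<close>

lemma R_contraction: "Bm_contraction 1 SS Mz"
  unfolding Bm_contraction_def
proof (intro conjI)
  show "bounded_op SS SS Mz" by (rule R.bounded)
  show "class_C_dot_0 SS Mz" using Rs_pow_tendsto_0 by (simp add: class_C_dot_0_def)
  have B: "Bm_inv 1 SS Mz f = f - Mz (Rs f)" for f
    by (simp add: Bm_inv_def One_nat_def)
  show "positive_op SS (Bm_inv 1 SS Mz)"
    unfolding positive_op_def B
  proof (intro conjI ballI)
    have norm: "hnorm A (Mz (Rs f)) \<le> hnorm A f" if "f \<in> S" for f
      using order_trans[OF conjunct2[OF Mz_closed_norm[OF S_sub[OF Rs_closed[OF that]]]] Rs_norm_le[OF that]] .
    show "bounded_op SS SS (\<lambda>f. f - Mz (Rs f))"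
    proof (rule bounded_opI[where C = 2])
      fix f assume f: "f \<in> hcarrier SS"
      then show "f - Mz (Rs f) \<in> hcarrier SS"
        using S.diff_closed[of f "Mz (Rs f)"] by (simp add: invariant Rs_closed)
      show "hnorm SS (f - Mz (Rs f)) \<le> 2 * hnorm SS f"
        using A.norm_triangle[of f "- Mz (Rs f)"] norm[of f] f S_sub Rs_closed invariant
        by (simp add: A.closed_rules)
    qed (simp_all add: bounded_op_add[OF R.adj_bounded] bounded_op_scaleC[OF R.adj_bounded] Mz_add Mz_scaleC
        scaleC_diff_right)
    fix f assume f: "f \<in> hcarrier SS"
    then have fS: "f \<in> S" by simp
    have "hinner SS (Mz (Rs f)) f = of_real ((hnorm A (Rs f))\<^sup>2)"
      using R.inner_adj[of "Rs f" f] fS Rs_closed[OF fS] A.inner_self[OF S_sub[OF Rs_closed[OF fS]]] by simp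
    then have eq: "hinner SS (f - Mz (Rs f)) f = of_real ((hnorm A f)\<^sup>2 - (hnorm A (Rs f))\<^sup>2)"
      using f fS Rs_closed invariant A.inner_self[OF S_sub[OF fS]] S.inner_diff_left[of f "Mz (Rs f)" f] by simp
    have "(hnorm A (Rs f))\<^sup>2 \<le> (hnorm A f)\<^sup>2"
      using Rs_norm_le[OF fS] A.norm_ge_0[OF S_sub[OF Rs_closed[OF fS]]] by (intro power_mono)
    then show "Im (hinner SS (f - Mz (Rs f)) f) = 0" "0 \<le> Re (hinner SS (f - Mz (Rs f)) f)"
      unfolding eq by simp_all
  qed
qed

sublocale R: bm_contraction SS Mz 1
  by unfold_locales (simp_all add: R_contraction)

text \<open>
  The coefficient space is the defect space of \<open>R\<close>. Its elements are functions in \<open>S\<close>, so the defect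
  operator of \<open>R\<close> can be followed by the evaluation at \<open>z\<close>.
\<close>

definition \<theta> :: "complex \<Rightarrow> (complex \<Rightarrow> 'a) \<Rightarrow> 'a" where
  "\<theta> z \<eta> = R.D \<eta> z"

lemma D_S: "\<eta> \<in> hcarrier R.DS \<Longrightarrow> R.D \<eta> \<in> S"
  using R.D_closed[of \<eta>] R.DS_subset[of \<eta>] by simp

sublocale V: hilbert_op SS R.M.W R.dil
  by unfold_locales (rule R.dil_bounded)

abbreviation "Vs \<equiv> adj SS R.M.W R.dil"

lemma Vs_dil: "f \<in> S \<Longrightarrow> Vs (R.dil f) = f"
  using R.dil_inner by (intro V.adj_eq) auto

lemma Vs_closed: "a \<in> hcarrier R.M.W \<Longrightarrow> Vs a \<in> S"
  using V.adj_closed[of a] by simp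

lemma Vs_norm_le: "a \<in> hcarrier R.M.W \<Longrightarrow> hnorm A (Vs a) \<le> hnorm R.M.W a"
  using V.adj_norm_le[of 1 a] R.dil_norm by simp

text \<open>Both sides are compared through their inner products with the values \<open>\<eta>\<close>. The projection onto
  \<open>S\<close> of the kernel section at \<open>z\<close> is an eigenvector of the adjoint of \<open>Mz\<close> on \<open>S\<close> with eigenvalue
  \<open>cnj z\<close>, so its dilation is a kernel section of the Hardy space.\<close>

lemma Mult_theta:
  assumes a: "a \<in> hcarrier R.M.W"
  shows "Mult \<theta> (R.M.J a) = Vs a"
proof
  fix z
  show "Mult \<theta> (R.M.J a) z = Vs a z"
  proof (cases "z \<in> \<D>")
    case z: True
    define x where "x = R.M.J a z"
    have x: "x \<in> hcarrier R.DS" using R.M.J_closed[OF a z] by (simp add: x_def)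
    have xS: "x \<in> S" using R.DS_subset[OF x] by simp
    have "R.D x z = Vs a z"
    proof (rule E.eq_if_inner_eq')
      show "R.D x z \<in> hcarrier E" "Vs a z \<in> hcarrier E"
        using A2_value_closed[OF S_sub z] D_S[OF x] Vs_closed[OF a] by blast+
      fix \<eta> assume \<eta>: "\<eta> \<in> hcarrier E"
      define k where "k = proj A S (kernel_section (bergman_kernel m) z \<eta>)"
      note K = A2_inner_kernel[OF z \<eta>]
      have kS: "k \<in> S"
        unfolding k_def by (rule A.proj_in[OF S_subset S.hilbert_space_axioms K(1)])
      have k: "hinner A u k = hinner E (u z) \<eta>" if "u \<in> S" for u
        unfolding k_def using A.proj_inner[OF S_subset S.hilbert_space_axioms K(1) that] K(2)[OF S_sub[OF that]] by simp
      have "Rs k = cnj z *\<^sub>C k"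
      proof (rule R.adj_eq)
        show "cnj z *\<^sub>C k \<in> hcarrier SS" using S.scaleC_closed[of k] kS by simp
        fix u assume "u \<in> hcarrier SS"
        then have u: "u \<in> S" by simp
        show "hinner SS (Mz u) k = hinner SS u (cnj z *\<^sub>C k)"
          using k[OF u] k[OF invariant[OF u]] S_sub[OF u] S_sub[OF kS] A2_value_closed[OF S_sub[OF u] z] \<eta>
          by (simp add: Mz_def A.inner_scaleC_right E.inner_scaleC_left)
      qed
      then have pow: "(Rs ^^ j) k = cnj z ^ j *\<^sub>C k" for j
      proof (induction j)
        case (Suc j)
        then show ?case
          using bounded_op_scaleC[OF R.adj_bounded, of k "cnj z ^ j"] kS by (simp add: mult.commute)
      qed simp
      have dil: "R.dil k j = cnj z ^ j *\<^sub>C R.D k" for j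
        using R.D_scaleC[of k "cnj z ^ j"] kS by (simp add: R.dil_def pow bergman_coeff_1)
      have Dk: "R.D k \<in> hcarrier R.DS" using R.D_in_DS[of k] kS by simp
      have "of_real (1 / bergman_coeff 1 j) * hinner R.DS (a j) (R.dil k j) = z ^ j * hinner A (a j) (R.D k)" for j
        using R.DS_subset[OF R.M.wseq_closed[OF a]] R.DS_subset[OF Dk] S_sub
        by (simp add: dil A.inner_scaleC_right bergman_coeff_1)
      then have "(\<lambda>j. z ^ j * hinner A (a j) (R.D k)) sums hinner R.M.W a (R.dil k)"
        using R.M.inner_sums[OF a R.dil_closed[of k]] kS by (simp only: subspace_of_simps)
      moreover have "(\<lambda>j. z ^ j * hinner A (a j) (R.D k)) sums hinner A x (R.D k)"
        using R.M.J_inner_sums[OF a z Dk] by (simp add: x_def)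
      ultimately have "hinner A x (R.D k) = hinner R.M.W a (R.dil k)" using sums_unique2 by blast
      also have "\<dots> = hinner A (Vs a) k" using V.inner_adj'[of k a] a kS by simp
      finally have "hinner A (R.D x) k = hinner A (Vs a) k"
        using R.D_selfadjoint[of x k] xS kS by simp
      then show "hinner E (R.D x z) \<eta> = hinner E (Vs a z) \<eta>"
        using k D_S[OF x] Vs_closed[OF a] by simp
    qed
    then show ?thesis using z by (simp add: Mult_def \<theta>_def x_def)
  next
    case False
    then show ?thesis using A2_rkhs S_sub[OF Vs_closed[OF a]] unfolding is_rkhs_def Mult_def by simp
  qed
qed

text \<open>\<open>Vs\<close> maps onto \<open>S\<close> because it is a left inverse of the dilation.\<close>

lemma theta_range: "Mult \<theta> ` hcarrier (A2 1 R.DS) = S"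
proof -
  have "Mult \<theta> ` hcarrier (A2 1 R.DS) = Vs ` hcarrier R.M.W"
    unfolding R.M.A2_carrier image_image using Mult_theta by (rule image_cong[OF refl])
  also have "\<dots> = S" using Vs_closed Vs_dil R.dil_closed by force
  finally show ?thesis .
qed

text \<open>
  \<open>Vs\<close> is the adjoint of an isometry \<open>V\<close>. If \<open>a\<close> is orthogonal to its kernel then it is orthogonal to
  \<open>a - V Vs a\<close>, and so \<open>\<parallel>a\<parallel>\<^sup>2 = \<langle>a, V Vs a\<rangle> = \<parallel>Vs a\<parallel>\<^sup>2\<close>.
\<close>

lemma theta_partial_isometry: "partial_isometry (A2 1 R.DS) A (Mult \<theta>)"
  unfolding partial_isometry_def
proof (intro conjI ballI)
  note J = R.M.J_add[symmetric] R.M.J_scaleC[symmetric]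
  show "bounded_op (A2 1 R.DS) A (Mult \<theta>)"
  proof (rule bounded_opI[where C = 1])
    fix f assume "f \<in> hcarrier (A2 1 R.DS)"
    then obtain a where a: "a \<in> hcarrier R.M.W" "f = R.M.J a" by (rule R.M.A2_E)
    show "Mult \<theta> f \<in> hcarrier A" using a by (simp add: Mult_theta S_sub Vs_closed)
    show "hnorm A (Mult \<theta> f) \<le> 1 * hnorm (A2 1 R.DS) f"
      using a Vs_norm_le by (simp add: Mult_theta R.M.J_norm)
    show "Mult \<theta> (c *\<^sub>C f) = c *\<^sub>C Mult \<theta> f" for c
      using a R.M.wseq_scaleC_closed by (simp add: J Mult_theta bounded_op_scaleC[OF V.adj_bounded])
    fix g assume "g \<in> hcarrier (A2 1 R.DS)"
    then obtain b where b: "b \<in> hcarrier R.M.W" "g = R.M.J b" by (rule R.M.A2_E)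
    show "Mult \<theta> (f + g) = Mult \<theta> f + Mult \<theta> g"
      using a b R.M.wseq_add_closed by (simp add: J Mult_theta bounded_op_add[OF V.adj_bounded])
  qed
  fix f assume f: "f \<in> ominus (A2 1 R.DS) {u \<in> hcarrier (A2 1 R.DS). Mult \<theta> u = 0}"
  then have "f \<in> hcarrier (A2 1 R.DS)" by (simp add: ominus_def)
  then obtain a where a: "a \<in> hcarrier R.M.W" "f = R.M.J a" by (rule R.M.A2_E)
  define b where "b = a - R.dil (Vs a)"
  have VVs: "R.dil (Vs a) \<in> hcarrier R.M.W" using R.dil_closed[of "Vs a"] Vs_closed[OF a(1)] by simp
  then have b: "b \<in> hcarrier R.M.W" using R.M.wseq_diff_closed[OF a(1)] by (simp add: b_def)
  have "Vs b = 0"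
    using bounded_op_diff[OF V.adj_bounded R.M.W.hilbert_space_axioms a(1) VVs] Vs_dil[OF Vs_closed[OF a(1)]]
    by (simp add: b_def)
  then have "hinner (A2 1 R.DS) f (R.M.J b) = 0"
    using f b by (simp add: ominus_def Mult_theta R.M.J_A2)
  then have "hinner R.M.W a b = 0" using a b by (simp add: R.M.J_inner)
  then have "hinner R.M.W a a = hinner R.M.W a (R.dil (Vs a))"
    using R.M.W.inner_diff_right[OF a(1) VVs a(1)] by (simp add: b_def)
  also have "\<dots> = hinner A (Vs a) (Vs a)" using V.inner_adj'[of "Vs a" a] Vs_closed[OF a(1)] a(1) by simp
  finally show "hnorm A (Mult \<theta> f) = hnorm (A2 1 R.DS) f"
    using a by (simp add: Mult_theta R.M.J_norm) (simp add: hnorm_def)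
qed

text \<open>
  \<open>\<theta> z\<close> is the evaluation at \<open>z\<close> of functions whose Taylor coefficients \<open>c \<eta>\<close> depend boundedly on \<open>\<eta>\<close>. The
  estimate of \<open>J_difference_quotient\<close> is uniform on bounded sets of coefficients.
\<close>

lemma theta_holomorphic: "op_holomorphic R.DS E \<theta>"
  unfolding op_holomorphic_def
proof (intro ballI conjI)
  define c where "c \<eta> = inv_into (hcarrier W) J (R.D \<eta>)" for \<eta>
  have c: "c \<eta> \<in> hcarrier W" "J (c \<eta>) = R.D \<eta>" if "\<eta> \<in> hcarrier R.DS" for \<eta>
    using S_sub[OF D_S[OF that]] unfolding A2_carrier c_def
    by (simp_all add: inv_into_into f_inv_into_f)
  obtain B where B: "B > 0" "\<And>\<eta>. \<eta> \<in> S \<Longrightarrow> hnorm A (R.D \<eta>) \<le> B * hnorm A \<eta>"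
    using bounded_op_bound[OF R.D_bounded S.hilbert_space_axioms] by auto
  have c_norm: "hnorm W (c \<eta>) \<le> B * hnorm A \<eta>" if "\<eta> \<in> hcarrier R.DS" for \<eta>
    using J_norm[OF c(1)[OF that]] c(2)[OF that] B(2)[of \<eta>] R.DS_subset[OF that] by simp
  have c_bounded: "bounded_op R.DS W c"
  proof (rule bounded_opI)
    fix x assume x: "x \<in> hcarrier R.DS"
    show "c x \<in> hcarrier W" by (rule c(1)[OF x])
    show "hnorm W (c x) \<le> B * hnorm R.DS x" using c_norm[OF x] by simp
    show "c (k *\<^sub>C x) = k *\<^sub>C c x" for k
      using x c R.D_scaleC[of x k] R.DS_subset[OF x] W.scaleC_closed R.M.E.scaleC_closed[OF x]
      by (intro inj_onD[OF J_inj]) (simp_all add: J_scaleC)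
    fix y assume y: "y \<in> hcarrier R.DS"
    show "c (x + y) = c x + c y"
      using x y c R.D_add[of x y] R.DS_subset W.add_closed R.M.E.add_closed[OF x y]
      by (intro inj_onD[OF J_inj]) (simp_all add: J_add)
  qed
  fix z assume z: "z \<in> \<D>"
  have \<theta>_ev: "\<theta> z \<eta> = ev (\<lambda>k. z ^ k) (c \<eta>)" if "\<eta> \<in> hcarrier R.DS" "z \<in> \<D>" for \<eta> z
    using fun_cong[OF c(2)[OF that(1)], of z] that(2) by (simp add: \<theta>_def J_def)
  have \<theta>_J: "\<theta> z \<eta> = J (c \<eta>) z" if "\<eta> \<in> hcarrier R.DS" for \<eta> z
    using c(2)[OF that] by (simp add: \<theta>_def)
  have sq: "square_sum (\<lambda>k. z ^ k)" using z by (intro square_sum_power) simp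
  have "bounded_op R.DS E (\<lambda>\<eta>. ev (\<lambda>k. z ^ k) (c \<eta>))"
    by (rule bounded_op_comp[OF R.DS_hilbert W.hilbert_space_axioms c_bounded ev_bounded[OF sq]])
  then show "bounded_op R.DS E (\<theta> z)"
    unfolding bounded_op_def image_subset_iff
    using R.M.E.add_closed R.M.E.scaleC_closed z by (simp add: \<theta>_ev)
  obtain L C \<delta> where L: "bounded_op W E L" "\<delta> > 0" "C \<ge> 0" "\<And>h. cmod h < \<delta> \<Longrightarrow> z + h \<in> \<D>"
    "\<And>h a. \<lbrakk>h \<noteq> 0; cmod h < \<delta>; a \<in> hcarrier W\<rbrakk>
      \<Longrightarrow> hnorm E ((1 / h) *\<^sub>C (J a (z + h) - J a z) - L a) \<le> C * cmod h * hnorm W a"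
    by (rule J_difference_quotient[OF z], rule that)
  have near: "\<forall>\<^sub>F h in at 0. h \<noteq> 0 \<and> cmod h < \<delta>"
    unfolding eventually_at using L(2) by (intro exI[of _ \<delta>]) simp
  have bd: "0 \<le> opnorm R.DS E (\<lambda>x. (1 / h) *\<^sub>C (\<theta> (z + h) x - \<theta> z x) - L (c x)) \<and>
      opnorm R.DS E (\<lambda>x. (1 / h) *\<^sub>C (\<theta> (z + h) x - \<theta> z x) - L (c x)) \<le> C * cmod h * B"
    if h: "h \<noteq> 0 \<and> cmod h < \<delta>" for h
  proof -
    have C0: "0 \<le> C * cmod h * B" using L(3) B(1) by simp
    have "hnorm E ((1 / h) *\<^sub>C (\<theta> (z + h) x - \<theta> z x) - L (c x)) \<le> C * cmod h * B * hnorm R.DS x"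
      if x: "x \<in> hcarrier R.DS" for x
    proof -
      have "hnorm E ((1 / h) *\<^sub>C (\<theta> (z + h) x - \<theta> z x) - L (c x)) \<le> C * cmod h * hnorm W (c x)"
        unfolding \<theta>_J[OF x] using h by (intro L(5) c(1)[OF x]) auto
      also have "\<dots> \<le> C * cmod h * (B * hnorm A x)"
        using c_norm[OF x] L(3) by (intro mult_left_mono) auto
      finally show ?thesis by (simp add: mult.assoc)
    qed
    from opnorm_bounds[OF C0 this] show ?thesis by simp
  qed
  show "\<exists>L. bounded_op R.DS E L \<and>
      ((\<lambda>h. opnorm R.DS E (\<lambda>x. (1 / h) *\<^sub>C (\<theta> (z + h) x - \<theta> z x) - L x)) \<longlongrightarrow> 0) (at 0)"
  proof (rule exI[of _ "\<lambda>x. L (c x)"], rule conjI)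
    show "bounded_op R.DS E (\<lambda>x. L (c x))"
      by (rule bounded_op_comp[OF R.DS_hilbert W.hilbert_space_axioms c_bounded L(1)])
    show "((\<lambda>h. opnorm R.DS E (\<lambda>x. (1 / h) *\<^sub>C (\<theta> (z + h) x - \<theta> z x) - L (c x))) \<longlongrightarrow> 0) (at 0)"
    proof (rule tendsto_sandwich[OF _ _ tendsto_const])
      show "\<forall>\<^sub>F h in at 0. 0 \<le> opnorm R.DS E (\<lambda>x. (1 / h) *\<^sub>C (\<theta> (z + h) x - \<theta> z x) - L (c x))"
        using near by (rule eventually_mono) (use bd in blast)
      show "\<forall>\<^sub>F h in at 0. opnorm R.DS E (\<lambda>x. (1 / h) *\<^sub>C (\<theta> (z + h) x - \<theta> z x) - L (c x)) \<le> C * cmod h * B"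
        using near by (rule eventually_mono) (use bd in blast)
      show "((\<lambda>h. C * cmod h * B) \<longlongrightarrow> 0) (at 0)" by (auto intro!: tendsto_eq_intros)
    qed
  qed
qed

text \<open>
  A Beurling theorem for the Bergman spaces: the closed invariant subspaces of \<open>Mz\<close> are ranges of
  partially isometric multipliers on Hardy spaces.
\<close>

theorem invariant_subspace_is_range:
  "partially_isometric_multiplier 1 R.DS m E \<theta>" "Mult \<theta> ` hcarrier (A2 1 R.DS) = S"
  unfolding partially_isometric_multiplier_def multipliers_def
  using theta_holomorphic theta_partial_isometry theta_range S_sub by auto

end

section \<open>The functional model\<close>

theorem theorem2p4:
  fixes m :: nat and H :: "'h::complex_vector hspace" and T :: "'h \<Rightarrow> 'h"
  assumes "m \<ge> 1"
    and "hilbert_space H"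
    and "Bm_contraction m H T"
  shows "\<exists>(E :: (complex \<Rightarrow> 'h) hspace) (\<theta> :: complex \<Rightarrow> (complex \<Rightarrow> 'h) \<Rightarrow> 'h).
    hilbert_space E \<and>
    partially_isometric_multiplier 1 E m (defect_space m H T) \<theta> \<and>
    unitarily_equivalent
      H T
      (subspace_of (A2 m (defect_space m H T)) (model_space m E (defect_space m H T) \<theta>))
      (\<lambda>f. proj (A2 m (defect_space m H T)) (model_space m E (defect_space m H T) \<theta>) (Mz f))"
proof -
  interpret bm_contraction H T m
    using assms by (intro bm_contraction.intro hilbert_op.intro hilbert_op_axioms.intro
        bm_contraction_axioms.intro) (auto simp: Bm_contraction_def)
  interpret A: hilbert_space "A2 m DS" by (rule M.A2_hilbert)
  let ?A = "A2 m DS"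
  define U where "U x = M.J (dil x)" for x
  have U_A: "U x \<in> hcarrier ?A" if "x \<in> hcarrier H" for x
    using that by (simp add: U_def M.J_A2 dil_closed)
  have U_add: "U (x + y) = U x + U y" if "x \<in> hcarrier H" "y \<in> hcarrier H" for x y
    using that by (simp add: U_def dil_add M.J_add dil_closed)
  have U_scaleC: "U (c *\<^sub>C x) = c *\<^sub>C U x" if "x \<in> hcarrier H" for c x
    using that by (simp add: U_def dil_scaleC M.J_scaleC dil_closed)
  have U_inner: "hinner ?A (U x) (U y) = hinner H x y" if "x \<in> hcarrier H" "y \<in> hcarrier H" for x y
    using that by (simp add: U_def M.J_inner dil_closed dil_inner)
  have Mz_U: "hinner ?A (Mz f) (U x) = hinner ?A f (U (Ts x))"
    if f: "f \<in> hcarrier ?A" and x: "x \<in> hcarrier H" for f x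
    using f
  proof (rule M.A2_E)
    fix a assume a: "a \<in> hcarrier M.W" "f = M.J a"
    then show ?thesis using x
      by (simp add: U_def M.Mz_J M.J_inner M.shift_closed dil_closed adj_closed shift_inner_dil)
  qed
  define Q where "Q = U ` hcarrier H"
  have Q_sub: "Q \<subseteq> hcarrier ?A" using U_A by (auto simp: Q_def)
  have Q_hilbert: "hilbert_space (subspace_of ?A Q)"
    by (rule hilbert_space_image[OF H.hilbert_space_axioms, of _ U])
       (simp_all add: Q_def U_add U_scaleC U_inner)
  interpret I: invariant_subspace DS m "ominus ?A Q"
  proof
    show "closed_subspace ?A (ominus ?A Q)" by (rule A.ominus_closed_subspace[OF Q_sub])
    fix f assume f: "f \<in> ominus ?A Q"
    then show "Mz f \<in> ominus ?A Q"
      using M.Mz_closed_norm Mz_U adj_closed by (auto simp: ominus_def Q_def)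
  qed
  let ?E = "I.R.DS"
  \<comment> \<open>The invariant subspace was chosen as the complement of \<open>Q\<close>, and \<open>Q\<close> is closed.\<close>
  have model: "model_space m ?E DS I.\<theta> = Q"
    unfolding model_space_def I.invariant_subspace_is_range(2) by (rule A.ominus_ominus[OF Q_sub Q_hilbert])
  have "unitary_op H (subspace_of ?A Q) U"
    unfolding unitary_op_def
  proof (intro conjI ballI)
    show "bounded_op H (subspace_of ?A Q) U"
      by (rule bounded_opI[where C = 1]) (auto simp: Q_def U_add U_scaleC U_inner hnorm_def)
    show "bij_betw U (hcarrier H) (hcarrier (subspace_of ?A Q))"
      unfolding bij_betw_def
    proof
      show "inj_on U (hcarrier H)"
      proof (rule inj_onI)
        fix x y assume xy: "x \<in> hcarrier H" "y \<in> hcarrier H" "U x = U y"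
        show "x = y"
          by (rule H.eq_if_inner_eq[OF xy(1,2)]) (use U_inner xy in metis)
      qed
    qed (simp add: Q_def)
  qed (simp add: U_inner)
  moreover have "U (T x) = proj ?A Q (Mz (U x))" if x: "x \<in> hcarrier H" for x
  proof (rule sym, rule A.proj_eq[OF Q_sub Q_hilbert])
    show MU: "Mz (U x) \<in> hcarrier ?A" using M.Mz_closed_norm[OF U_A[OF x]] by blast
    show "U (T x) \<in> Q" using closed[OF x] by (simp add: Q_def)
    fix u assume "u \<in> Q"
    then obtain y where y: "y \<in> hcarrier H" "u = U y" by (auto simp: Q_def)
    have "hinner ?A (Mz (U x)) u = hinner ?A (U (T x)) u"
      using x y closed[OF x] by (simp add: Mz_U U_A U_inner adj_closed inner_adj)
    then show "hinner ?A (Mz (U x) - U (T x)) u = 0"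
      using MU U_A closed[OF x] y by (simp add: A.inner_diff_left)
  qed
  ultimately have "unitarily_equivalent H T (subspace_of ?A Q) (\<lambda>f. proj ?A Q (Mz f))"
    unfolding unitarily_equivalent_def by blast
  then show ?thesis
    using I.R.DS_hilbert I.invariant_subspace_is_range(1) model by (intro exI[of _ ?E] exI[of _ I.\<theta>]) simp
qed

end
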